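(* For every nonzero $f\in\mathcal{H}$ there exists $g\in\mathcal{H}$ such that $f=k_{\Gamma(f)}\,g$. Moreover: (1) $\sigma(g)\subset\sigma(f)$; (2) $g(x)>0$ for every $x\in\Omega(g)$; (3) the set $\Omega(g)$ is Lebesgue regular; (4) $\Omega(f)=\Omega(k_{\Gamma(f)})\cap\Omega(g)$.
   Context: $\mathbb{C}^+=\{z:\Im z>0\}$, $\mathcal{H}$ is the set of analytic maps $\mathbb{C}^+\to\overline{\mathbb{C}^+}$. For $f\in\mathcal{H}$ with Nevanlinna representation $f(z)=\alpha z+\beta+\int_{\mathbb{R}}\frac{1+zt}{t-z}\,d\rho(t)$ ($\alpha\ge0,\beta\in\mathbb{R}$, $\rho$ finite positive Borel), $\sigma(f)$ is the closed support of $\rho$ with $\infty$ added if $\alpha>0$ or the support is unbounded; $\Omega(f)=(\mathbb{R}\cup\{\infty\})\setminus\sigma(f)$ (where $f$ extends analytically and is real-valued); $\Gamma(f)=\{x\in\Omega(f):f(x)<0\}$. Intervals in $\mathbb{R}\cup\{\infty\}$: for $b>a$, $(b,a)=(b,\infty)\cup\{\infty\}\cup(-\infty,a)$. For a proper open interval $J$, $p_J$ is the unique conformal automorphism of $\mathbb{C}^+$ negative exactly on $J$ with $|p_J(i)|=1$ (e.g. $p_{(b,a)}(z)=\frac{|i-b|}{|i-a|}\frac{z-a}{z-b}$ for finite $b<a$, $p_{(-\infty,a)}(z)=\frac{z-a}{|i-a|}$, $p_J=-1/p_{J'}$ if $J$ is the complement of $\overline{J'}$); $p_\varnothing=1$,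 $p_{\mathbb{R}\cup\{\infty\}}=-1$. For an open $O\subset\mathbb{R}\cup\{\infty\}$ with connected components $J_n$, the Kreĭn product is $k_O=\prod_n p_{J_n}$ (convergent uniformly on compacts of $\mathbb{C}^+$). An open set is Lebesgue regular if it equals the largest open set containing it and differing from it by a Lebesgue null set. *)

theory Defs
  imports "HOL-Analysis.Analysis"
begin

datatype rinf = Fin real | Infty

definition rinf_open :: "rinf set \<Rightarrow> bool" where
  "rinf_open S \<longleftrightarrow> open {x. Fin x \<in> S} \<and>
     (Infty \<in> S \<longrightarrow> (\<exists>R. \<forall>x. R < \<bar>x\<bar> \<longrightarrow> Fin x \<in> S))"

definition rinf_top :: "rinf topology" where
  "rinf_top = topology rinf_open"

definition rinf_null :: "rinf set \<Rightarrow> bool" where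
  "rinf_null N \<longleftrightarrow> {x. Fin x \<in> N} \<in> null_sets lebesgue"

definition rinf_reg_hull :: "rinf set \<Rightarrow> rinf set" where
  "rinf_reg_hull S = \<Union>{U. rinf_open U \<and> S \<subseteq> U \<and> rinf_null (U - S)}"

definition lebesgue_regular :: "rinf set \<Rightarrow> bool" where
  "lebesgue_regular S \<longleftrightarrow> rinf_open S \<and> S = rinf_reg_hull S"

definition upper_half :: "complex set" where
  "upper_half = {z. 0 < Im z}"

definition nevanlinna :: "(complex \<Rightarrow> complex) \<Rightarrow> bool" where
  "nevanlinna f \<longleftrightarrow> f holomorphic_on upper_half \<and> (\<forall>z\<in>upper_half. 0 \<le> Im (f z))"

definition nev_rep :: "(complex \<Rightarrow> complex) \<Rightarrow> real \<Rightarrow> real \<Rightarrow> real measure \<Rightarrow> bool" where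
  "nev_rep f \<alpha> \<beta> \<rho> \<longleftrightarrow> 0 \<le> \<alpha> \<and> sets \<rho> = sets borel \<and> finite_measure \<rho> \<and>
     (\<forall>z\<in>upper_half. f z = complex_of_real \<alpha> * z + complex_of_real \<beta> +
        (\<integral>t. (1 + z * complex_of_real t) / (complex_of_real t - z) \<partial>\<rho>))"

text \<open>The (unique) representing triple.\<close>
definition nev_triple :: "(complex \<Rightarrow> complex) \<Rightarrow> real \<times> real \<times> real measure" where
  "nev_triple f = (SOME r. nev_rep f (fst r) (fst (snd r)) (snd (snd r)))"

definition measure_support :: "real measure \<Rightarrow> real set" where
  "measure_support \<rho> = {t. \<forall>e>0. 0 < emeasure \<rho> {t - e<..<t + e}}"

definition nev_sigma :: "(complex \<Rightarrow> complex) \<Rightarrow> rinf set" where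
  "nev_sigma f = (case nev_triple f of (\<alpha>, \<beta>, \<rho>) \<Rightarrow>
      Fin ` measure_support \<rho> \<union>
      (if 0 < \<alpha> \<or> \<not> bounded (measure_support \<rho>) then {Infty} else {}))"

definition nev_Omega :: "(complex \<Rightarrow> complex) \<Rightarrow> rinf set" where
  "nev_Omega f = UNIV - nev_sigma f"

text \<open>Value of (the analytic continuation of) f at a point of R \<union> {\<infinity>},
  as the limit from the upper half plane (meaningful on nev_Omega f, where it is real).\<close>
fun nev_val :: "(complex \<Rightarrow> complex) \<Rightarrow> rinf \<Rightarrow> real" where
  "nev_val f (Fin x) = Re (Lim (at (complex_of_real x) within upper_half) f)"
| "nev_val f Infty = Re (Lim (inf at_infinity (principal upper_half)) f)"

definition nev_Gamma :: "(complex \<Rightarrow> complex) \<Rightarrow> rinf set" where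
  "nev_Gamma f = {x \<in> nev_Omega f. nev_val f x < 0}"

text \<open>p_J for a proper open interval (arc) J of R \<union> {\<infinity>}; p_{} = 1, p_{whole} = -1.
  The four kinds of proper open arcs are (a,b), (-\<infinity>,a), (b,\<infinity>), and
  (b,a) = (b,\<infinity>) \<union> {\<infinity>} \<union> (-\<infinity>,a) with a < b.\<close>
definition p_int :: "rinf set \<Rightarrow> complex \<Rightarrow> complex" where
  "p_int J z =
    (if J = {} then 1
     else if J = UNIV then -1
     else if (\<exists>a b. a < b \<and> J = Fin ` {a<..<b}) then
       (let a = (SOME a. \<exists>b. a < b \<and> J = Fin ` {a<..<b});
            b = (SOME b. a < b \<and> J = Fin ` {a<..<b})
        in complex_of_real (cmod (\<i> - complex_of_real a) / cmod (\<i> - complex_of_real b)) *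
             ((z - complex_of_real b) / (z - complex_of_real a)))
     else if (\<exists>a. J = Fin ` {..<a}) then
       (let a = (SOME a. J = Fin ` {..<a})
        in (z - complex_of_real a) / complex_of_real (cmod (\<i> - complex_of_real a)))
     else if (\<exists>b. J = Fin ` {b<..}) then
       (let b = (SOME b. J = Fin ` {b<..})
        in - complex_of_real (cmod (\<i> - complex_of_real b)) / (z - complex_of_real b))
     else if (\<exists>a b. a < b \<and> J = insert Infty (Fin ` ({..<a} \<union> {b<..}))) then
       (let a = (SOME a. \<exists>b. a < b \<and> J = insert Infty (Fin ` ({..<a} \<union> {b<..})));
            b = (SOME b. a < b \<and> J = insert Infty (Fin ` ({..<a} \<union> {b<..})))
        in - complex_of_real (cmod (\<i> - complex_of_real b) / cmod (\<i> - complex_of_real a)) *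
             ((z - complex_of_real a) / (z - complex_of_real b)))
     else undefined)"

definition rinf_components :: "rinf set \<Rightarrow> rinf set set" where
  "rinf_components S = connected_components_of (subtopology rinf_top S)"

text \<open>Krein product k_O = \<Prod> p_{J_n} over the (countably many) components.\<close>
definition krein_prod :: "rinf set \<Rightarrow> complex \<Rightarrow> complex" where
  "krein_prod S z =
    (let C = rinf_components S in
       if finite C then (\<Prod>J\<in>C. p_int J z)
       else prodinf (\<lambda>n. p_int (from_nat_into C n) z))"

end

theory Submission
  imports Defs "HOL-Probability.Probability" "HOL-Complex_Analysis.Complex_Analysis"
begin

text \<open>
  A nonzero Nevanlinna function \<open>f\<close> is the exponential of a Nevanlinna function \<open>h\<close> with
  \<open>0 \<le> Im h \<le> \<pi>\<close>. The representing measures \<open>\<mu>\<close> of \<open>h\<close> and \<open>\<mu>'\<close> of \<open>\<i>\<pi> - h\<close> add up to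
  \<open>dt / (1 + t\<^sup>2)\<close>; where \<open>f\<close> is negative \<open>\<mu>'\<close> vanishes, where \<open>f\<close> is positive \<open>\<mu>\<close> vanishes. Hence
  the part of \<open>\<mu>\<close> on \<open>\<Gamma>(f)\<close> is \<open>dt / (1 + t\<^sup>2)\<close>, and exponentiating its contribution to \<open>h\<close> gives the
  Krein product, one component of \<open>\<Gamma>(f)\<close> at a time. The rest of \<open>\<mu>\<close> gives \<open>g\<close>, and \<open>\<Omega>(g)\<close> is the
  largest open set that is null for it.
\<close>

section \<open>The Nevanlinna kernel\<close>

text \<open>The sets \<open>nev_sigma\<close> and \<open>nev_Omega\<close> are read off from a
  triple picked by \<open>SOME\<close>. They are tied to the function itself by \<open>tame\<close>,
  which mentions no measure: for every representing triple, \<open>tame\<close> at a real point is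
  equivalent to local vanishing of the measure. So each function can be studied with whatever
  measure is at hand. \<open>tame\<close> also survives products, quotients by functions with
  nonzero limit, exponentials, and logarithms where the boundary value is nonzero. This carries
  regularity between f and h and yields claim (4).

  Bounded imaginary part forces the linear coefficient of h to be 0, and then regularity of h at
  infinity amounts to regularity at all real points of large modulus. Hence most arguments are local
  and take place on the real line.

  Two obstacles remain. At a real zero of f the logarithm is singular; such zeros are isolated, and
  the absolutely continuous \<mu> ignores them. Moreover \<open>p_int\<close> is
  \<open>undefined\<close> on the circle minus one point. A component of \<Gamma>(f) with null
  complement forces \<mu>' = 0, so that f is a negative constant and the component is the whole
  circle.\<close>

definition nev_kernel :: "complex \<Rightarrow> real \<Rightarrow> complex" where
  "nev_kernel z t = (1 + z * complex_of_real t) / (complex_of_real t - z)"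

lemma open_upper_half: "open upper_half"
  unfolding upper_half_def by (rule open_halfspace_Im_gt)

lemma upper_half_ne: "z \<in> upper_half \<Longrightarrow> complex_of_real t - z \<noteq> 0"
  by (auto simp: upper_half_def complex_eq_iff)

lemma Im_le_dist_real: "\<bar>Im z\<bar> \<le> cmod (complex_of_real t - z)"
  using abs_Im_le_cmod[of "complex_of_real t - z"] by simp

text \<open>Partial fractions in t: the kernel is a constant plus a multiple of the resolvent, so
  boundedness, integrability and holomorphy reduce to those of a Cauchy transform.\<close>

lemma nev_kernel_alt:
  "complex_of_real t - z \<noteq> 0 \<Longrightarrow> nev_kernel z t = z + (1 + z\<^sup>2) * inverse (complex_of_real t - z)"
  by (simp add: nev_kernel_def field_simps power2_eq_square)

text \<open>Partial fractions in z: here the resolvent has a real coefficient, which gives the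
  imaginary part at once, and \<open>- t\<close> is the value of the kernel at z = infinity.\<close>

lemma nev_kernel_alt_infty:
  "complex_of_real t - z \<noteq> 0 \<Longrightarrow>
    nev_kernel z t = - complex_of_real t + complex_of_real (1 + t\<^sup>2) * inverse (complex_of_real t - z)"
  by (simp add: nev_kernel_def field_simps power2_eq_square)

lemma Im_nev_kernel: "Im (nev_kernel z t) = Im z * (1 + t\<^sup>2) / (cmod (complex_of_real t - z))\<^sup>2"
proof (cases "complex_of_real t - z = 0")
  case False
  have "Im (nev_kernel z t) = (1 + t\<^sup>2) * Im (inverse (complex_of_real t - z))"
    unfolding nev_kernel_alt_infty[OF False] by simp
  also have "Im (inverse (complex_of_real t - z)) = Im z / (cmod (complex_of_real t - z))\<^sup>2"
    by (simp add: cmod_power2)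
  finally show ?thesis by simp
qed (simp add: nev_kernel_def)

lemma Im_nev_kernel_nonneg: "z \<in> upper_half \<Longrightarrow> 0 \<le> Im (nev_kernel z t)"
  by (simp add: Im_nev_kernel upper_half_def)

lemma norm_resolvent_le:
  assumes "z \<in> upper_half"
  shows "cmod (inverse (complex_of_real t - z)) \<le> inverse (Im z)"
  using Im_le_dist_real[of z t] assms
  by (simp add: norm_inverse upper_half_def le_imp_inverse_le)

lemma norm_nev_kernel_le:
  assumes "z \<in> upper_half"
  shows "cmod (nev_kernel z t) \<le> cmod z + cmod (1 + z\<^sup>2) * inverse (Im z)"
  unfolding nev_kernel_alt[OF upper_half_ne[OF assms]]
  by (intro order_trans[OF norm_triangle_ineq] add_mono order_refl)
     (use norm_resolvent_le[OF assms] in \<open>auto simp: norm_mult intro!: mult_left_mono\<close>)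

lemma measurable_nev_kernel [measurable]: "nev_kernel z \<in> borel_measurable borel"
  unfolding nev_kernel_def by measurable

lemma measurable_nev_kernel_sets:
  "sets \<rho> = sets borel \<Longrightarrow> nev_kernel z \<in> borel_measurable \<rho>"
  using measurable_nev_kernel measurable_cong_sets by blast

lemma integrable_nev_kernel:
  assumes "sets \<rho> = sets borel" "finite_measure \<rho>" "z \<in> upper_half"
  shows "integrable \<rho> (nev_kernel z)"
proof -
  interpret finite_measure \<rho> by fact
  show ?thesis
    by (rule integrable_const_bound[of _ "cmod z + cmod (1 + z\<^sup>2) * inverse (Im z)"])
       (auto simp: measurable_nev_kernel_sets assms norm_nev_kernel_le)
qed

lemma integrable_resolvent:
  assumes "sets \<rho> = sets borel" "finite_measure \<rho>" "z \<in> upper_half"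
  shows "integrable \<rho> (\<lambda>t. inverse (complex_of_real t - z))"
proof -
  interpret finite_measure \<rho> by fact
  have "(\<lambda>t. inverse (complex_of_real t - z)) \<in> borel_measurable borel" by measurable
  then show ?thesis
    by (intro integrable_const_bound[of _ "inverse (Im z)"])
       (use assms in \<open>auto simp: norm_resolvent_le measurable_cong_sets[OF assms(1) refl]\<close>)
qed

lemma integral_nev_kernel_eq:
  assumes "sets \<rho> = sets borel" "finite_measure \<rho>" "z \<in> upper_half"
  shows "(\<integral>t. nev_kernel z t \<partial>\<rho>) =
    complex_of_real (measure \<rho> (space \<rho>)) * z + (1 + z\<^sup>2) * (\<integral>t. inverse (complex_of_real t - z) \<partial>\<rho>)"
proof -
  interpret finite_measure \<rho> by fact
  have "(\<integral>t. nev_kernel z t \<partial>\<rho>) = (\<integral>t. z + (1 + z\<^sup>2) * inverse (complex_of_real t - z) \<partial>\<rho>)"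
    by (intro Bochner_Integration.integral_cong refl nev_kernel_alt upper_half_ne assms)
  also have "\<dots> = (\<integral>t. z \<partial>\<rho>) + (\<integral>t. (1 + z\<^sup>2) * inverse (complex_of_real t - z) \<partial>\<rho>)"
    by (intro Bochner_Integration.integral_add integrable_mult_right integrable_resolvent assms) auto
  also have "\<dots> = complex_of_real (measure \<rho> (space \<rho>)) * z + (1 + z\<^sup>2) * (\<integral>t. inverse (complex_of_real t - z) \<partial>\<rho>)"
    by (simp add: integral_mult_right_zero scaleR_conv_of_real)
  finally show ?thesis .
qed

lemma resolvent_diff:
  fixes z w u :: complex
  assumes "u - z \<noteq> 0" "u - w \<noteq> 0"
  shows "inverse (u - w) - inverse (u - z) = (w - z) * (inverse (u - z) * inverse (u - w))"
  using assms by (simp add: field_simps)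

text \<open>The difference quotient minus the candidate derivative is w - z times an integral of
  products of resolvents, and these are bounded uniformly in t as long as w keeps away from the real
  line.\<close>

lemma has_field_derivative_cauchy_transform:
  assumes "sets \<rho> = sets borel" "finite_measure \<rho>" "z \<in> upper_half"
  shows "((\<lambda>z. \<integral>t. inverse (complex_of_real t - z) \<partial>\<rho>) has_field_derivative
           (\<integral>t. (inverse (complex_of_real t - z))\<^sup>2 \<partial>\<rho>)) (at z)"
proof -
  interpret finite_measure \<rho> by fact
  let ?R = "\<lambda>z t. inverse (complex_of_real t - z)"
  let ?I = "\<lambda>z. \<integral>t. ?R z t \<partial>\<rho>"
  let ?D = "\<integral>t. (?R z t)\<^sup>2 \<partial>\<rho>"
  let ?m = "measure \<rho> (space \<rho>)"
  have Imz: "0 < Im z" using assms(3) by (simp add: upper_half_def)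
  have meas: "(\<lambda>t. ?R w t) \<in> borel_measurable \<rho>" for w
    unfolding measurable_cong_sets[OF assms(1) refl] by measurable
  have intsq: "integrable \<rho> (\<lambda>t. (?R z t)\<^sup>2)"
    by (rule integrable_const_bound[of _ "(inverse (Im z))\<^sup>2"])
       (use meas in \<open>auto simp: norm_power intro!: power_mono norm_resolvent_le assms borel_measurable_power\<close>)
  \<comment> \<open>Staying within \<open>Im z / 2\<close> of z keeps Im w above
    \<open>Im z / 2\<close>; this is the origin of the factor \<open>2 * inverse (Im z)\<close>,
    which bounds the resolvent at w.\<close>
  have est: "cmod ((?I w - ?I z) / (w - z) - ?D) \<le> cmod (w - z) * (?m * (inverse (Im z))\<^sup>2 * (2 * inverse (Im z)))"
    if w: "w \<noteq> z" "cmod (w - z) < Im z / 2" for w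
  proof -
    have "Im z - Im w \<le> cmod (w - z)"
      using abs_Im_le_cmod[of "w - z"] by simp
    then have Imw: "Im w > Im z / 2" using w by linarith
    then have wu: "w \<in> upper_half" using Imz by (simp add: upper_half_def)
    have iw: "inverse (Im w) \<le> 2 * inverse (Im z)"
      using Imw Imz by (simp add: field_simps)
    have pt: "(?R w t - ?R z t) / (w - z) - (?R z t)\<^sup>2 = (w - z) * ((?R z t)\<^sup>2 * ?R w t)" for t
    proof -
      have "(?R w t - ?R z t) / (w - z) = ?R z t * ?R w t"
        using resolvent_diff[OF upper_half_ne[OF assms(3)] upper_half_ne[OF wu], of t] w by simp
      then have "(?R w t - ?R z t) / (w - z) - (?R z t)\<^sup>2 = ?R z t * (?R w t - ?R z t)"
        by (simp add: power2_eq_square algebra_simps)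
      also have "\<dots> = (w - z) * ((?R z t)\<^sup>2 * ?R w t)"
        unfolding resolvent_diff[OF upper_half_ne[OF assms(3)] upper_half_ne[OF wu]]
        by (simp add: power2_eq_square algebra_simps)
      finally show ?thesis .
    qed
    have "(?I w - ?I z) / (w - z) - ?D = (\<integral>t. (?R w t - ?R z t) / (w - z) - (?R z t)\<^sup>2 \<partial>\<rho>)"
      using integrable_resolvent[OF assms(1,2)] wu assms(3) intsq by simp
    also have "\<dots> = (\<integral>t. (w - z) * ((?R z t)\<^sup>2 * ?R w t) \<partial>\<rho>)" by (simp only: pt)
    also have "cmod \<dots> \<le> (\<integral>t. cmod (w - z) * ((inverse (Im z))\<^sup>2 * (2 * inverse (Im z))) \<partial>\<rho>)"
    proof (rule Bochner_Integration.integral_norm_bound_integral)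
      show "integrable \<rho> (\<lambda>t. (w - z) * ((?R z t)\<^sup>2 * ?R w t))"
        using integrable_resolvent[OF assms(1,2)] wu assms(3) intsq
        by (simp only: pt[symmetric]) (intro Bochner_Integration.integrable_diff integrable_divide, auto)
    next
      fix t
      have "cmod (?R w t) \<le> 2 * inverse (Im z)"
        using norm_resolvent_le[OF wu, of t] iw by linarith
      then show "cmod ((w - z) * ((?R z t)\<^sup>2 * ?R w t)) \<le> cmod (w - z) * ((inverse (Im z))\<^sup>2 * (2 * inverse (Im z)))"
        using norm_resolvent_le[OF assms(3), of t]
        by (auto simp: norm_mult norm_power intro!: mult_left_mono mult_mono power_mono)
    qed auto
    finally show ?thesis by (simp add: mult_ac)
  qed
  have "((\<lambda>w. (?I w - ?I z) / (w - z) - ?D) \<longlongrightarrow> 0) (at z)"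
  proof (rule Lim_null_comparison)
    have "eventually (\<lambda>w. dist w z < Im z / 2) (at z)"
      by (rule eventually_at_ball'[of "Im z / 2" z UNIV, THEN eventually_mono])
         (use Imz in \<open>auto simp: dist_commute\<close>)
    moreover have "eventually (\<lambda>w. w \<noteq> z) (at z)"
      by (simp add: eventually_at_filter)
    ultimately show "eventually (\<lambda>w. cmod ((?I w - ?I z) / (w - z) - ?D) \<le> cmod (w - z) * (?m * (inverse (Im z))\<^sup>2 * (2 * inverse (Im z)))) (at z)"
      by eventually_elim (intro est, auto simp: dist_norm)
    have "((\<lambda>w. cmod (w - z) * (?m * (inverse (Im z))\<^sup>2 * (2 * inverse (Im z)))) \<longlongrightarrow> cmod (z - z) * (?m * (inverse (Im z))\<^sup>2 * (2 * inverse (Im z)))) (at z)"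
      by (intro tendsto_intros)
    then show "((\<lambda>w. cmod (w - z) * (?m * (inverse (Im z))\<^sup>2 * (2 * inverse (Im z)))) \<longlongrightarrow> 0) (at z)" by simp
  qed
  then show ?thesis
    unfolding has_field_derivative_iff by (simp add: LIM_zero_iff)
qed

lemma holomorphic_nev_kernel_integral:
  assumes "sets \<rho> = sets borel" "finite_measure \<rho>"
  shows "(\<lambda>z. \<integral>t. nev_kernel z t \<partial>\<rho>) holomorphic_on upper_half"
proof -
  have "(\<lambda>z. \<integral>t. inverse (complex_of_real t - z) \<partial>\<rho>) holomorphic_on upper_half"
    using has_field_derivative_cauchy_transform[OF assms] open_upper_half
    by (auto simp: holomorphic_on_open)
  then have "(\<lambda>z. complex_of_real (measure \<rho> (space \<rho>)) * z + (1 + z\<^sup>2) * (\<integral>t. inverse (complex_of_real t - z) \<partial>\<rho>)) holomorphic_on upper_half"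
    by (intro holomorphic_intros)
  then show ?thesis
    by (rule holomorphic_transform) (simp add: integral_nev_kernel_eq assms)
qed

lemma Im_integral_nev_kernel_nonneg:
  assumes "sets \<rho> = sets borel" "finite_measure \<rho>" "z \<in> upper_half"
  shows "0 \<le> Im (\<integral>t. nev_kernel z t \<partial>\<rho>)"
  using integral_Im[OF integrable_nev_kernel[OF assms]] Im_nev_kernel_nonneg[OF assms(3)]
  by (metis integral_nonneg_AE AE_I2)

lemma nev_rep_iff:
  "nev_rep f \<alpha> \<beta> \<rho> \<longleftrightarrow> 0 \<le> \<alpha> \<and> sets \<rho> = sets borel \<and> finite_measure \<rho> \<and>
     (\<forall>z\<in>upper_half. f z = complex_of_real \<alpha> * z + complex_of_real \<beta> + (\<integral>t. nev_kernel z t \<partial>\<rho>))"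
  unfolding nev_rep_def nev_kernel_def ..

lemma nev_rep_imp_nevanlinna:
  assumes "nev_rep f \<alpha> \<beta> \<rho>"
  shows "nevanlinna f"
proof -
  note r = assms[unfolded nev_rep_iff]
  have "(\<lambda>z. complex_of_real \<alpha> * z + complex_of_real \<beta> + (\<integral>t. nev_kernel z t \<partial>\<rho>)) holomorphic_on upper_half"
    using r by (intro holomorphic_intros holomorphic_nev_kernel_integral) auto
  then have "f holomorphic_on upper_half"
    by (rule holomorphic_transform) (use r in auto)
  moreover have "0 \<le> Im (f z)" if "z \<in> upper_half" for z
  proof -
    have "0 \<le> Im z" using that by (simp add: upper_half_def)
    then show ?thesis using r that Im_integral_nev_kernel_nonneg[of \<rho> z] by simp
  qed
  ultimately show ?thesis by (simp add: nevanlinna_def)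
qed

section \<open>Boundary behaviour off the support of the measure\<close>

text \<open>These are the filters behind \<open>nev_val\<close>; naming them lets real points and
  infinity share statements.\<close>

fun approach :: "rinf \<Rightarrow> complex filter" where
  "approach (Fin x) = at (complex_of_real x) within upper_half"
| "approach Infty = inf at_infinity (principal upper_half)"

abbreviation boundary_weight :: "complex \<Rightarrow> real" where
  "boundary_weight z \<equiv> Im z / (1 + (cmod z)\<^sup>2)"

text \<open>Expresses, without leaving the half-plane, that \<open>f\<close> continues analytically across \<open>x\<close> with real
  boundary values. The denominator of the weight matters only at \<open>x = \<infinity>\<close>.\<close>
definition tame :: "(complex \<Rightarrow> complex) \<Rightarrow> rinf \<Rightarrow> bool" where
  "tame f x \<longleftrightarrow> (\<exists>C. \<forall>\<^sub>F z in approach x. cmod (f z) \<le> C \<and> Im (f z) \<le> C * boundary_weight z)"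

lemma of_real_notin_upper_half [simp]: "complex_of_real x \<notin> upper_half"
  by (simp add: upper_half_def)

lemma eventually_approach_Fin:
  "eventually P (approach (Fin x)) \<longleftrightarrow> (\<exists>e>0. \<forall>z\<in>upper_half. cmod (z - complex_of_real x) < e \<longrightarrow> P z)"
proof -
  have "z \<noteq> complex_of_real x" if "z \<in> upper_half" for z using that by auto
  then show ?thesis unfolding approach.simps eventually_at dist_norm by blast
qed

lemma eventually_approach_Infty:
  "eventually P (approach Infty) \<longleftrightarrow> (\<exists>b. \<forall>z\<in>upper_half. b \<le> cmod z \<longrightarrow> P z)"
  unfolding approach.simps eventually_inf_principal eventually_at_infinity by blast

lemma eventually_approach_upper_half: "eventually (\<lambda>z. z \<in> upper_half) (approach x)"
proof (cases x)
  case (Fin a)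
  then show ?thesis unfolding Fin eventually_approach_Fin by (auto intro: exI[of _ 1])
next
  case Infty
  then show ?thesis unfolding Infty eventually_approach_Infty by auto
qed

lemma approach_neq_bot: "approach x \<noteq> bot"
proof (cases x)
  case (Fin a)
  show ?thesis
    unfolding Fin trivial_limit_def eventually_approach_Fin
  proof (intro notI, elim exE conjE)
    fix e :: real assume e: "0 < e" "\<forall>z\<in>upper_half. cmod (z - complex_of_real a) < e \<longrightarrow> False"
    have "Complex a (e/2) \<in> upper_half" "cmod (Complex a (e/2) - complex_of_real a) < e"
      using e(1) by (auto simp: upper_half_def cmod_def)
    with e(2) show False by blast
  qed
next
  case Infty
  show ?thesis
    unfolding Infty trivial_limit_def eventually_approach_Infty
  proof (intro notI, elim exE)
    fix b :: real assume b: "\<forall>z\<in>upper_half. b \<le> cmod z \<longrightarrow> False"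
    have "Complex 0 (\<bar>b\<bar> + 1) \<in> upper_half" "b \<le> cmod (Complex 0 (\<bar>b\<bar> + 1))"
      by (auto simp: upper_half_def cmod_def)
    with b show False by blast
  qed
qed

lemma nev_val_eqI: "(f \<longlongrightarrow> complex_of_real v) (approach x) \<Longrightarrow> nev_val f x = v"
  using tendsto_Lim[OF approach_neq_bot, of f "complex_of_real v" x] by (cases x) auto

text \<open>A half-disc at a real point contains small half-discs at all nearby real points, and the
  outside of a large disc contains half-discs at all large real points. A bound with fixed constants
  therefore spreads to an open set.\<close>

lemma eventually_approach_local:
  assumes "eventually P (approach x)"
  shows "\<exists>U. rinf_open U \<and> x \<in> U \<and> (\<forall>y\<in>U. eventually P (approach y))"
proof (cases x)
  case (Fin a)
  from assms obtain e where e: "0 < e" "\<And>z. z \<in> upper_half \<Longrightarrow> cmod (z - complex_of_real a) < e \<Longrightarrow> P z"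
    unfolding Fin eventually_approach_Fin by blast
  have "eventually P (approach (Fin y))" if "\<bar>y - a\<bar> < e" for y
    unfolding eventually_approach_Fin
  proof (intro exI conjI ballI impI)
    show "0 < e - \<bar>y - a\<bar>" using that by simp
    fix z assume z: "z \<in> upper_half" "cmod (z - complex_of_real y) < e - \<bar>y - a\<bar>"
    have "cmod (z - complex_of_real a) \<le> cmod (z - complex_of_real y) + cmod (complex_of_real (y - a))"
      using norm_triangle_ineq[of "z - complex_of_real y" "complex_of_real (y - a)"] by simp
    also have "cmod (complex_of_real (y - a)) = \<bar>y - a\<bar>" by (simp only: norm_of_real)
    finally show "P z" using e z by simp
  qed
  moreover have "rinf_open (Fin ` {y. \<bar>y - a\<bar> < e})"
  proof -
    have "{xa. Fin xa \<in> Fin ` {y. \<bar>y - a\<bar> < e}} = ball a e"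
      by (auto simp: dist_real_def)
    then show ?thesis unfolding rinf_open_def by auto
  qed
  ultimately show ?thesis
    using e(1) Fin by (intro exI[of _ "Fin ` {y. \<bar>y - a\<bar> < e}"]) auto
next
  case Infty
  from assms obtain b where b: "\<And>z. z \<in> upper_half \<Longrightarrow> b \<le> cmod z \<Longrightarrow> P z"
    unfolding Infty eventually_approach_Infty by blast
  have "eventually P (approach (Fin y))" if "\<bar>y\<bar> > b" for y
    unfolding eventually_approach_Fin
  proof (intro exI conjI ballI impI)
    show "0 < \<bar>y\<bar> - b" using that by simp
    fix z assume z: "z \<in> upper_half" "cmod (z - complex_of_real y) < \<bar>y\<bar> - b"
    have "cmod (complex_of_real y) \<le> cmod z + cmod (z - complex_of_real y)"
      using norm_triangle_sub[of "complex_of_real y" z] by (simp add: norm_minus_commute)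
    then show "P z" using b z by simp
  qed
  moreover have "rinf_open (insert Infty (Fin ` {y. \<bar>y\<bar> > b}))"
  proof -
    have *: "{xa. Fin xa \<in> insert Infty (Fin ` {y. \<bar>y\<bar> > b})} = {y. \<bar>y\<bar> > b}" by auto
    have "open {y::real. \<bar>y\<bar> > b}" by (intro open_Collect_less continuous_intros)
    then show ?thesis unfolding rinf_open_def * by auto
  qed
  ultimately show ?thesis
    using assms Infty by (intro exI[of _ "insert Infty (Fin ` {y. \<bar>y\<bar> > b})"]) auto
qed

lemma tame_local: "tame f x \<Longrightarrow> \<exists>U. rinf_open U \<and> x \<in> U \<and> (\<forall>y\<in>U. tame f y)"
  unfolding tame_def by (elim exE, drule eventually_approach_local) blast

lemma tame_cong:
  assumes "\<And>z. z \<in> upper_half \<Longrightarrow> f z = g z"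
  shows "tame f x \<longleftrightarrow> tame g x"
proof -
  have *: "eventually (\<lambda>z. f z = g z) (approach x)"
    using eventually_approach_upper_half by eventually_elim (use assms in auto)
  have "(\<forall>\<^sub>F z in approach x. cmod (f z) \<le> C \<and> Im (f z) \<le> C * boundary_weight z)
    \<longleftrightarrow> (\<forall>\<^sub>F z in approach x. cmod (g z) \<le> C \<and> Im (g z) \<le> C * boundary_weight z)" for C
    by (rule eventually_cong[OF *]) simp
  then show ?thesis unfolding tame_def by simp
qed

text \<open>A Lindelof argument: the null intervals with rational endpoints are countably many and
  cover \<open>U\<close>.\<close>

lemma null_of_locally_null:
  fixes \<rho> :: "real measure"
  assumes "sets \<rho> = sets borel" "\<And>t. t \<in> U \<Longrightarrow> \<exists>e>0. emeasure \<rho> {t - e<..<t + e} = 0" "U \<in> sets borel"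
  shows "emeasure \<rho> U = 0"
proof -
  define I where "I = {p \<in> \<rat> \<times> \<rat>. emeasure \<rho> {fst p<..<snd p} = 0}"
  have cI: "countable I"
    unfolding I_def by (intro countable_Collect countable_SIGMA countable_rat)
  have sub: "U \<subseteq> (\<Union>p\<in>I. {fst p<..<snd p})"
  proof
    fix t assume "t \<in> U"
    then obtain e where e: "0 < e" "emeasure \<rho> {t - e<..<t + e} = 0" using assms(2) by blast
    obtain q where q: "q \<in> \<rat>" "t - e < q" "q < t" using Rats_dense_in_real[of "t - e" t] e by auto
    obtain r where r: "r \<in> \<rat>" "t < r" "r < t + e" using Rats_dense_in_real[of t "t + e"] e by auto
    have "emeasure \<rho> {q<..<r} \<le> emeasure \<rho> {t - e<..<t + e}"
      using q r assms(1) by (intro emeasure_mono) auto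
    then have "(q, r) \<in> I" using q r e by (simp add: I_def)
    then show "t \<in> (\<Union>p\<in>I. {fst p<..<snd p})" using q r by (intro UN_I[of "(q, r)"]) auto
  qed
  have "(\<Union>p\<in>I. {fst p<..<snd p}) \<in> null_sets \<rho>"
    by (rule null_sets_UN'[OF cI]) (simp add: null_sets_def I_def assms(1))
  then have "U \<in> null_sets \<rho>"
    by (rule null_sets_subset) (use assms sub in auto)
  then show ?thesis by blast
qed

lemma emeasure_off_support:
  assumes "sets \<rho> = sets borel" "U \<inter> measure_support \<rho> = {}" "U \<in> sets borel"
  shows "emeasure \<rho> U = 0"
proof (rule null_of_locally_null)
  fix t assume "t \<in> U"
  then have "t \<notin> measure_support \<rho>" using assms by auto
  then show "\<exists>e>0. emeasure \<rho> {t - e<..<t + e} = 0"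
    by (auto simp: measure_support_def not_less)
qed (use assms in auto)

lemma AE_dist_ge:
  fixes \<rho> :: "real measure"
  assumes "sets \<rho> = sets borel" "emeasure \<rho> {x - e<..<x + e} = 0"
  shows "AE t in \<rho>. e \<le> \<bar>t - x\<bar>"
proof (rule AE_I)
  show "{t \<in> space \<rho>. \<not> e \<le> \<bar>t - x\<bar>} \<subseteq> {x - e<..<x + e}" by (auto simp: not_le abs_less_iff)
qed (use assms in auto)

text \<open>The representation formula evaluated at a real point. It is used only where \<rho>
  vanishes near x, so that the integrand is bounded almost everywhere.\<close>

definition boundary_val :: "real \<Rightarrow> real \<Rightarrow> real measure \<Rightarrow> real \<Rightarrow> real" where
  "boundary_val \<alpha> \<beta> \<rho> x = \<alpha> * x + \<beta> + (\<integral>t. (1 + x * t) / (t - x) \<partial>\<rho>)"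

lemma nev_kernel_of_real: "nev_kernel (complex_of_real x) t = complex_of_real ((1 + x * t) / (t - x))"
  by (simp add: nev_kernel_def)

lemma integrable_real_kernel:
  fixes \<rho> :: "real measure"
  assumes "sets \<rho> = sets borel" "finite_measure \<rho>" "0 < e" "AE t in \<rho>. e \<le> \<bar>t - x\<bar>"
  shows "integrable \<rho> (\<lambda>t. (1 + x * t) / (t - x))"
proof -
  interpret finite_measure \<rho> by fact
  show ?thesis
  proof (rule integrable_const_bound[of _ "\<bar>x\<bar> + (1 + x\<^sup>2) / e"])
    show "AE t in \<rho>. norm ((1 + x * t) / (t - x)) \<le> \<bar>x\<bar> + (1 + x\<^sup>2) / e"
      using assms(4)
    proof eventually_elim
      case (elim t)
      then have "t - x \<noteq> 0" using assms(3) by auto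
      then have eq: "(1 + x * t) / (t - x) = x + (1 + x\<^sup>2) / (t - x)"
        by (simp add: field_simps power2_eq_square)
      have "\<bar>(1 + x\<^sup>2) / (t - x)\<bar> = (1 + x\<^sup>2) / \<bar>t - x\<bar>" by (simp add: abs_divide)
      also have "\<dots> \<le> (1 + x\<^sup>2) / e" using elim assms(3) by (intro divide_left_mono) auto
      finally show ?case unfolding eq real_norm_def
        using abs_triangle_ineq[of x "(1 + x\<^sup>2) / (t - x)"] by linarith
    qed
    show "(\<lambda>t. (1 + x * t) / (t - x)) \<in> borel_measurable \<rho>"
      unfolding measurable_cong_sets[OF assms(1) refl] by measurable
  qed
qed

lemma nev_kernel_diff:
  assumes "complex_of_real t - z \<noteq> 0" "complex_of_real t - w \<noteq> 0"
  shows "nev_kernel w t - nev_kernel z t =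
    (w - z) * (complex_of_real (1 + t\<^sup>2) * (inverse (complex_of_real t - z) * inverse (complex_of_real t - w)))"
  using assms by (simp add: nev_kernel_def field_simps power2_eq_square)

text \<open>Controls the growth of \<open>1 + t\<^sup>2\<close> by the two resolvents for all t away
  from x, so that remote mass does no harm. The first estimate in the proof is
  \<open>(t - 2 * x)\<^sup>2 \<ge> 0\<close> rearranged.\<close>

lemma one_plus_square_le:
  fixes t x e :: real
  assumes "0 < e" "e \<le> \<bar>t - x\<bar>"
  shows "(1 + t\<^sup>2) \<le> ((1 + 2 * x\<^sup>2) / e\<^sup>2 + 2) * (t - x)\<^sup>2"
proof -
  have "t\<^sup>2 \<le> 2 * x\<^sup>2 + 2 * (t - x)\<^sup>2"
    using sum_squares_ge_zero[of "t - 2 * x" 0] by (simp add: power2_eq_square algebra_simps)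
  then have 1: "1 + t\<^sup>2 \<le> (1 + 2 * x\<^sup>2) + 2 * (t - x)\<^sup>2" by simp
  have "e\<^sup>2 \<le> (t - x)\<^sup>2" using assms power_mono[of e "\<bar>t - x\<bar>" 2] by simp
  then have "(1 + 2 * x\<^sup>2) * 1 \<le> (1 + 2 * x\<^sup>2) * ((t - x)\<^sup>2 / e\<^sup>2)"
    using assms(1) by (intro mult_left_mono) (auto simp: field_simps)
  then show ?thesis using 1 by (simp add: algebra_simps)
qed

text \<open>With no mass near x, the distance from z to the rest of the mass is comparable to
  \<open>\<bar>t - x\<bar>\<close>. The difference of kernels is then O(|z - x|) and the imaginary
  part of the kernel is O(Im z), uniformly in t.\<close>

lemma nev_rep_tame_Fin:
  assumes rep: "nev_rep f \<alpha> \<beta> \<rho>" and e: "0 < e" and null: "emeasure \<rho> {x - e<..<x + e} = 0"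
  shows "tame f (Fin x)" "(f \<longlongrightarrow> complex_of_real (boundary_val \<alpha> \<beta> \<rho> x)) (approach (Fin x))"
proof -
  note r = rep[unfolded nev_rep_iff]
  interpret finite_measure \<rho> using r by simp
  note AE = AE_dist_ge[OF conjunct1[OF conjunct2[OF r]] null]
  define C where "C = (1 + 2 * x\<^sup>2) / e\<^sup>2 + 2"
  define m where "m = measure \<rho> (space \<rho>)"
  have C0: "0 \<le> C" by (simp add: C_def)
  have m0: "0 \<le> m" by (simp add: m_def)
  have \<alpha>0: "0 \<le> \<alpha>" using r by simp
  have intx: "integrable \<rho> (nev_kernel (complex_of_real x))"
    unfolding nev_kernel_of_real using r by (intro integrable_of_real integrable_real_kernel[OF _ _ e AE]) auto
  have bv: "complex_of_real (boundary_val \<alpha> \<beta> \<rho> x) = complex_of_real \<alpha> * complex_of_real x + complex_of_real \<beta> + (\<integral>t. nev_kernel (complex_of_real x) t \<partial>\<rho>)"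
    unfolding nev_kernel_of_real integral_complex_of_real boundary_val_def by simp
  \<comment> \<open>Moving from x to a point z less than e/2 away loses at most half of the distance
    to t.\<close>
  have far: "\<bar>t - x\<bar> \<le> 2 * cmod (complex_of_real t - z)" if "e \<le> \<bar>t - x\<bar>" "cmod (z - complex_of_real x) < e / 2" for t z
  proof -
    have "cmod (complex_of_real (t - x)) \<le> cmod (complex_of_real t - z) + cmod (z - complex_of_real x)"
      using norm_triangle_ineq[of "complex_of_real t - z" "z - complex_of_real x"] by simp
    moreover have "cmod (complex_of_real (t - x)) = \<bar>t - x\<bar>" by (simp only: norm_of_real)
    ultimately show ?thesis using that by linarith
  qed
  have diff: "cmod (f z - complex_of_real (boundary_val \<alpha> \<beta> \<rho> x)) \<le> (\<alpha> + 2 * C * m) * cmod (z - complex_of_real x)"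
    if z: "z \<in> upper_half" "cmod (z - complex_of_real x) < e / 2" for z
  proof -
    have iz: "integrable \<rho> (nev_kernel z)" using r z by (intro integrable_nev_kernel) auto
    have "cmod ((\<integral>t. nev_kernel z t \<partial>\<rho>) - (\<integral>t. nev_kernel (complex_of_real x) t \<partial>\<rho>))
        = cmod (\<integral>t. nev_kernel z t - nev_kernel (complex_of_real x) t \<partial>\<rho>)"
      using iz intx by simp
    also have "\<dots> \<le> (\<integral>t. cmod (nev_kernel z t - nev_kernel (complex_of_real x) t) \<partial>\<rho>)"
      by (rule integral_norm_bound)
    also have "\<dots> \<le> (\<integral>t. cmod (z - complex_of_real x) * (2 * C) \<partial>\<rho>)"
    proof (rule integral_mono_AE)
      show "AE t in \<rho>. cmod (nev_kernel z t - nev_kernel (complex_of_real x) t) \<le> cmod (z - complex_of_real x) * (2 * C)"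
        using AE
      proof eventually_elim
        case (elim t)
        have tx: "0 < \<bar>t - x\<bar>" using elim e by linarith
        have nz: "complex_of_real t - complex_of_real x \<noteq> 0" using tx by auto
        have "(1 + t\<^sup>2) \<le> C * (t - x)\<^sup>2" unfolding C_def by (rule one_plus_square_le[OF e elim])
        have p: "0 < cmod (complex_of_real t - z)" using far[OF elim z(2)] tx by linarith
        have "(1 + t\<^sup>2) \<le> (C * \<bar>t - x\<bar>) * \<bar>t - x\<bar>"
          using \<open>(1 + t\<^sup>2) \<le> C * (t - x)\<^sup>2\<close> by (simp add: power2_eq_square mult.assoc)
        also have "\<dots> \<le> (C * \<bar>t - x\<bar>) * (2 * cmod (complex_of_real t - z))"
          using far[OF elim z(2)] C0 by (intro mult_left_mono) auto
        finally have "(1 + t\<^sup>2) * (inverse \<bar>t - x\<bar> * inverse (cmod (complex_of_real t - z))) \<le> 2 * C"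
          using tx p by (simp add: field_simps)
        moreover have "cmod (complex_of_real t - complex_of_real x) = \<bar>t - x\<bar>"
          by (metis norm_of_real of_real_diff)
        moreover have "cmod (complex_of_real (1 + t\<^sup>2)) = 1 + t\<^sup>2" 
          unfolding norm_of_real by simp
        ultimately show ?case
          unfolding nev_kernel_diff[OF nz upper_half_ne[OF z(1)]]
          by (simp only: norm_mult norm_inverse) (intro mult_left_mono norm_ge_zero)
      qed
    qed (use iz intx in auto)
    also have "\<dots> = (2 * C * m) * cmod (z - complex_of_real x)" by (simp add: m_def)
    finally have A: "cmod ((\<integral>t. nev_kernel z t \<partial>\<rho>) - (\<integral>t. nev_kernel (complex_of_real x) t \<partial>\<rho>)) \<le> (2 * C * m) * cmod (z - complex_of_real x)" .
    have "f z - complex_of_real (boundary_val \<alpha> \<beta> \<rho> x) = complex_of_real \<alpha> * (z - complex_of_real x) + ((\<integral>t. nev_kernel z t \<partial>\<rho>) - (\<integral>t. nev_kernel (complex_of_real x) t \<partial>\<rho>))"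
      unfolding bv using r z(1) by (simp add: algebra_simps)
    also have "cmod \<dots> \<le> \<alpha> * cmod (z - complex_of_real x) + (2 * C * m) * cmod (z - complex_of_real x)"
      by (rule order_trans[OF norm_triangle_ineq add_mono[OF _ A]]) (use \<alpha>0 in \<open>simp add: norm_mult\<close>)
    finally show ?thesis by (simp add: algebra_simps)
  qed
  have nbhd: "eventually (\<lambda>z. z \<in> upper_half \<and> cmod (z - complex_of_real x) < min (e / 2) 1) (approach (Fin x))"
    unfolding eventually_approach_Fin using e by (auto intro!: exI[of _ "min (e/2) 1"])
  show lim: "(f \<longlongrightarrow> complex_of_real (boundary_val \<alpha> \<beta> \<rho> x)) (approach (Fin x))"
  proof (rule LIM_zero_cancel, rule Lim_null_comparison)
    show "eventually (\<lambda>z. cmod (f z - complex_of_real (boundary_val \<alpha> \<beta> \<rho> x)) \<le> (\<alpha> + 2 * C * m) * cmod (z - complex_of_real x)) (approach (Fin x))"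
      using nbhd by eventually_elim (rule diff, auto)
    have "((\<lambda>z. (\<alpha> + 2 * C * m) * cmod (z - complex_of_real x)) \<longlongrightarrow> (\<alpha> + 2 * C * m) * cmod (complex_of_real x - complex_of_real x)) (approach (Fin x))"
      unfolding approach.simps by (intro tendsto_intros)
    then show "((\<lambda>z. (\<alpha> + 2 * C * m) * cmod (z - complex_of_real x)) \<longlongrightarrow> 0) (approach (Fin x))" by simp
  qed
  have Imf: "Im (f z) \<le> (\<alpha> + 4 * C * m) * Im z"
    if z: "z \<in> upper_half" "cmod (z - complex_of_real x) < e / 2" for z
  proof -
    have iz: "integrable \<rho> (nev_kernel z)" using r z by (intro integrable_nev_kernel) auto
    have Imz: "0 < Im z" using z by (simp add: upper_half_def)
    have "(\<integral>t. Im (nev_kernel z t) \<partial>\<rho>) \<le> (\<integral>t. Im z * (4 * C) \<partial>\<rho>)"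
    proof (rule integral_mono_AE)
      show "AE t in \<rho>. Im (nev_kernel z t) \<le> Im z * (4 * C)"
        using AE
      proof eventually_elim
        case (elim t)
        have tx: "0 < \<bar>t - x\<bar>" using elim e by linarith
        have p: "0 < cmod (complex_of_real t - z)" using far[OF elim z(2)] tx by linarith
        have "(1 + t\<^sup>2) \<le> C * (t - x)\<^sup>2" unfolding C_def by (rule one_plus_square_le[OF e elim])
        also have "(t - x)\<^sup>2 \<le> (2 * cmod (complex_of_real t - z))\<^sup>2"
          using power_mono[OF far[OF elim z(2)], of 2] by simp
        finally have "(1 + t\<^sup>2) \<le> 4 * C * (cmod (complex_of_real t - z))\<^sup>2"
          using C0 by (simp add: power_mult_distrib mult_left_mono)
        then have "(1 + t\<^sup>2) / (cmod (complex_of_real t - z))\<^sup>2 \<le> 4 * C" using p by (simp add: field_simps)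
        then have "Im z * ((1 + t\<^sup>2) / (cmod (complex_of_real t - z))\<^sup>2) \<le> Im z * (4 * C)"
          using Imz by (intro mult_left_mono) auto
        then show ?case unfolding Im_nev_kernel by simp
      qed
    qed (use iz in auto)
    also have "\<dots> = (4 * C * m) * Im z" by (simp add: m_def)
    finally have "(\<integral>t. Im (nev_kernel z t) \<partial>\<rho>) \<le> (4 * C * m) * Im z" .
    then show ?thesis using r z integral_Im[OF iz] by (simp add: algebra_simps)
  qed
  define D where "D = \<alpha> + 4 * C * m"
  have D0: "0 \<le> D" using \<alpha>0 C0 m0 by (simp add: D_def)
  \<comment> \<open>The first entry bounds f by its limit plus the error within distance 1. The
    second contains the largest denominator \<open>1 + (cmod z)\<^sup>2\<close> there, which turns
    the bound \<open>D * Im z\<close> into a multiple of the boundary weight.\<close>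
  define B where "B = max (\<bar>boundary_val \<alpha> \<beta> \<rho> x\<bar> + D) (D * (1 + (\<bar>x\<bar> + 1)\<^sup>2))"
  show "tame f (Fin x)"
    unfolding tame_def
  proof (intro exI)
    show "\<forall>\<^sub>F z in approach (Fin x). cmod (f z) \<le> B \<and> Im (f z) \<le> B * boundary_weight z"
      using nbhd
    proof eventually_elim
      case (elim z)
      then have z: "z \<in> upper_half" "cmod (z - complex_of_real x) < e / 2" "cmod (z - complex_of_real x) < 1" by auto
      have "cmod (f z) \<le> cmod (complex_of_real (boundary_val \<alpha> \<beta> \<rho> x)) + cmod (f z - complex_of_real (boundary_val \<alpha> \<beta> \<rho> x))"
        by (rule norm_triangle_sub)
      also have "cmod (f z - complex_of_real (boundary_val \<alpha> \<beta> \<rho> x)) \<le> D * 1"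
      proof (rule order_trans[OF diff[OF z(1,2)]], rule mult_mono)
        show "\<alpha> + 2 * C * m \<le> D" using C0 m0 by (simp add: D_def mult_right_mono)
      qed (use z D0 in auto)
      finally have 1: "cmod (f z) \<le> B" by (simp add: B_def)
      have Imz: "0 < Im z" using z by (simp add: upper_half_def)
      have "cmod z \<le> \<bar>x\<bar> + 1"
        using norm_triangle_ineq[of "complex_of_real x" "z - complex_of_real x"] z by simp
      then have "(cmod z)\<^sup>2 \<le> (\<bar>x\<bar> + 1)\<^sup>2" by (intro power_mono) auto
      then have "D * (1 + (cmod z)\<^sup>2) \<le> B"
        unfolding B_def using D0 by (intro max.coboundedI2 mult_left_mono) auto
      then have "D * (1 + (cmod z)\<^sup>2) * boundary_weight z \<le> B * boundary_weight z"
        using Imz by (intro mult_right_mono) auto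
      moreover have "0 < 1 + (cmod z)\<^sup>2" by (rule add_pos_nonneg) auto
      then have "D * (1 + (cmod z)\<^sup>2) * boundary_weight z = D * Im z" by simp
      ultimately show ?case using 1 Imf[OF z(1,2)] by (simp add: D_def)
    qed
  qed
qed

text \<open>For mass in a bounded interval the kernel differs from its limit \<open>- t\<close> by
  O(1/|z|), and its imaginary part is O(Im z / |z|^2), which is exactly the decay that the boundary
  weight measures at infinity.\<close>

lemma nev_rep_tame_Infty:
  assumes rep: "nev_rep f 0 \<beta> \<rho>" and null: "emeasure \<rho> {t. L < \<bar>t\<bar>} = 0"
  shows "tame f Infty" "\<exists>v. (f \<longlongrightarrow> complex_of_real v) (approach Infty)"
proof -
  note r = rep[unfolded nev_rep_iff]
  have sb: "sets \<rho> = sets borel" using r by simp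
  interpret finite_measure \<rho> using r by simp
  define M where "M = max L 0"
  have M: "0 \<le> M" "L \<le> M" by (auto simp: M_def)
  have "{t::real. L < \<bar>t\<bar>} \<in> sets borel" by measurable
  then have AE: "AE t in \<rho>. \<bar>t\<bar> \<le> M"
    using null sb M by (intro AE_I[of _ _ "{t. L < \<bar>t\<bar>}"]) auto
  define m where "m = measure \<rho> (space \<rho>)"
  have m0: "0 \<le> m" by (simp add: m_def)
  \<comment> \<open>The kernel tends to \<open>- t\<close> as z goes to infinity, so this is the
    expected limit of f.\<close>
  define v where "v = \<beta> - (\<integral>t. t \<partial>\<rho>)"
  have it: "integrable \<rho> (\<lambda>t. t)"
    by (rule integrable_const_bound[of _ M]) (use AE in \<open>auto simp: measurable_cong_sets[OF sb refl]\<close>)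
  have far: "cmod z \<le> 2 * cmod (complex_of_real t - z)" if "\<bar>t\<bar> \<le> M" "2 * M + 1 \<le> cmod z" for t z
  proof -
    have "cmod z \<le> cmod (complex_of_real t) + cmod (complex_of_real t - z)"
      using norm_triangle_ineq4[of "complex_of_real t" "complex_of_real t - z"] by simp
    then show ?thesis using that by simp
  qed
  have sq: "1 + t\<^sup>2 \<le> 1 + M\<^sup>2" if "\<bar>t\<bar> \<le> M" for t
    using power_mono[OF that, of 2] by simp
  have diff: "cmod (f z - complex_of_real v) \<le> (2 * (1 + M\<^sup>2) * m) * inverse (cmod z)"
    if z: "z \<in> upper_half" "2 * M + 1 \<le> cmod z" for z
  proof -
    have iz: "integrable \<rho> (nev_kernel z)" using r z by (intro integrable_nev_kernel) auto
    have cz: "0 < cmod z" using z M by linarith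
    have "f z - complex_of_real v = (\<integral>t. nev_kernel z t \<partial>\<rho>) + (\<integral>t. complex_of_real t \<partial>\<rho>)"
      using r z by (simp add: v_def)
    also have "\<dots> = (\<integral>t. nev_kernel z t + complex_of_real t \<partial>\<rho>)"
      by (rule Bochner_Integration.integral_add[symmetric]) (use it iz in auto)
    also have "cmod \<dots> \<le> (\<integral>t. cmod (nev_kernel z t + complex_of_real t) \<partial>\<rho>)"
      by (rule integral_norm_bound)
    also have "\<dots> \<le> (\<integral>t. 2 * (1 + M\<^sup>2) * inverse (cmod z) \<partial>\<rho>)"
    proof (rule integral_mono_AE)
      show "AE t in \<rho>. cmod (nev_kernel z t + complex_of_real t) \<le> 2 * (1 + M\<^sup>2) * inverse (cmod z)"
        using AE
      proof eventually_elim
        case (elim t)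
        have f: "cmod z \<le> 2 * cmod (complex_of_real t - z)" by (rule far[OF elim z(2)])
        have "cmod (nev_kernel z t + complex_of_real t) = (1 + t\<^sup>2) * inverse (cmod (complex_of_real t - z))"
          unfolding nev_kernel_alt_infty[OF upper_half_ne[OF z(1)]]
          by (simp add: norm_mult norm_inverse del: of_real_add of_real_power)
        also have "\<dots> \<le> (1 + M\<^sup>2) * (2 * inverse (cmod z))"
        proof (rule mult_mono[OF sq[OF elim]])
          show "inverse (cmod (complex_of_real t - z)) \<le> 2 * inverse (cmod z)"
            using f cz upper_half_ne[OF z(1), of t] by (simp add: field_simps)
        qed auto
        finally show ?case by (simp add: mult_ac)
      qed
    qed (use iz it in auto)
    finally show ?thesis by (simp add: m_def mult_ac)
  qed
  have nbhd: "eventually (\<lambda>z. z \<in> upper_half \<and> 2 * M + 1 \<le> cmod z) (approach Infty)"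
    unfolding eventually_approach_Infty by auto
  have lim: "(f \<longlongrightarrow> complex_of_real v) (approach Infty)"
  proof (rule LIM_zero_cancel, rule Lim_null_comparison)
    show "eventually (\<lambda>z. cmod (f z - complex_of_real v) \<le> (2 * (1 + M\<^sup>2) * m) * inverse (cmod z)) (approach Infty)"
      using nbhd by eventually_elim (rule diff, auto)
    have "((\<lambda>z::complex. (2 * (1 + M\<^sup>2) * m) * inverse (cmod z)) \<longlongrightarrow> (2 * (1 + M\<^sup>2) * m) * 0) at_infinity"
      by (intro tendsto_mult tendsto_const tendsto_inverse_0_at_top filterlim_norm_at_top)
    then show "((\<lambda>z. (2 * (1 + M\<^sup>2) * m) * inverse (cmod z)) \<longlongrightarrow> 0) (approach Infty)"
      by (auto intro: tendsto_mono[of _ at_infinity])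
  qed
  then show "\<exists>v. (f \<longlongrightarrow> complex_of_real v) (approach Infty)" ..
  \<comment> \<open>The 8 consists of a factor 4 from squaring \<open>far\<close> and a factor 2
    from \<open>1 + |z|^2 \<le> 2 |z|^2\<close>, valid since |z| is at least 1.\<close>
  define D where "D = 8 * (1 + M\<^sup>2) * m"
  have D0: "0 \<le> D" using m0 by (simp add: D_def)
  have Imf: "Im (f z) \<le> D * boundary_weight z"
    if z: "z \<in> upper_half" "2 * M + 1 \<le> cmod z" for z
  proof -
    have iz: "integrable \<rho> (nev_kernel z)" using r z by (intro integrable_nev_kernel) auto
    have Imz: "0 < Im z" using z by (simp add: upper_half_def)
    have cz: "1 \<le> cmod z" using z M by linarith
    then have cz2: "1 \<le> (cmod z)\<^sup>2" by simp
    have "(\<integral>t. Im (nev_kernel z t) \<partial>\<rho>) \<le> (\<integral>t. 8 * (1 + M\<^sup>2) * boundary_weight z \<partial>\<rho>)"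
    proof (rule integral_mono_AE)
      show "AE t in \<rho>. Im (nev_kernel z t) \<le> 8 * (1 + M\<^sup>2) * boundary_weight z"
        using AE
      proof eventually_elim
        case (elim t)
        have f: "cmod z \<le> 2 * cmod (complex_of_real t - z)" by (rule far[OF elim z(2)])
        then have "(cmod z)\<^sup>2 \<le> 4 * (cmod (complex_of_real t - z))\<^sup>2"
          using power_mono[OF f, of 2] by (simp add: power_mult_distrib)
        then have g: "1 + (cmod z)\<^sup>2 \<le> 8 * (cmod (complex_of_real t - z))\<^sup>2" using cz2 by linarith
        have pos: "0 < (cmod (complex_of_real t - z))\<^sup>2" using upper_half_ne[OF z(1), of t] by simp
        have "inverse ((cmod (complex_of_real t - z))\<^sup>2) \<le> 8 * inverse (1 + (cmod z)\<^sup>2)"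
          using g pos cz2 by (simp add: field_simps)
        then have "(1 + t\<^sup>2) * inverse ((cmod (complex_of_real t - z))\<^sup>2) \<le> (1 + M\<^sup>2) * (8 * inverse (1 + (cmod z)\<^sup>2))"
          by (intro mult_mono sq[OF elim]) auto
        then have "Im z * ((1 + t\<^sup>2) * inverse ((cmod (complex_of_real t - z))\<^sup>2)) \<le> Im z * ((1 + M\<^sup>2) * (8 * inverse (1 + (cmod z)\<^sup>2)))"
          using Imz by (intro mult_left_mono) auto
        then show ?case unfolding Im_nev_kernel by (simp only: divide_inverse mult_ac)
      qed
    qed (use iz in auto)
    also have "\<dots> = D * boundary_weight z" by (simp add: m_def D_def)
    finally show ?thesis using r z integral_Im[OF iz] by simp
  qed
  define B where "B = max (\<bar>v\<bar> + 2 * (1 + M\<^sup>2) * m) D"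
  show "tame f Infty"
    unfolding tame_def
  proof (intro exI)
    show "\<forall>\<^sub>F z in approach Infty. cmod (f z) \<le> B \<and> Im (f z) \<le> B * boundary_weight z"
      using nbhd
    proof eventually_elim
      case (elim z)
      then have z: "z \<in> upper_half" "2 * M + 1 \<le> cmod z" by auto
      have Imz: "0 < Im z" using z by (simp add: upper_half_def)
      have cz: "1 \<le> cmod z" using z M by linarith
      have "cmod (f z) \<le> cmod (complex_of_real v) + cmod (f z - complex_of_real v)"
        by (rule norm_triangle_sub)
      also have "cmod (f z - complex_of_real v) \<le> (2 * (1 + M\<^sup>2) * m) * 1"
        by (rule order_trans[OF diff[OF z(1,2)]], rule mult_left_mono) (use cz m0 in \<open>auto simp: inverse_le_1_iff\<close>)
      finally have 1: "cmod (f z) \<le> B" by (simp add: B_def)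
      have "D * boundary_weight z \<le> B * boundary_weight z"
        using Imz by (intro mult_right_mono) (auto simp: B_def)
      then show ?case using 1 Imf[OF z(1,2)] by simp
    qed
  qed
qed

text \<open>The increment of the boundary function from x1 to x2 is \<alpha> (x2 - x1) plus the
  integral of \<open>h\<close>, which is positive because almost every t lies on the same side of
  both points. A zero increment thus forces \<alpha> = 0 and \<rho> = 0.\<close>

lemma boundary_val_inj:
  assumes rep: "nev_rep f \<alpha> \<beta> \<rho>" and e: "emeasure \<rho> {a<..<b} = 0" and x: "a < x1" "x1 < x2" "x2 < b"
    and eq: "boundary_val \<alpha> \<beta> \<rho> x1 = boundary_val \<alpha> \<beta> \<rho> x2" and z: "z \<in> upper_half"
  shows "f z = complex_of_real \<beta>"
proof -
  note r = rep[unfolded nev_rep_iff]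
  have sb: "sets \<rho> = sets borel" using r by simp
  interpret finite_measure \<rho> using r by simp
  have AE: "AE t in \<rho>. \<not> (a < t \<and> t < b)"
    using e sb by (intro AE_I[of _ _ "{a<..<b}"]) auto
  define e1 where "e1 = min (x1 - a) (b - x2)"
  have e1: "0 < e1" using x by (simp add: e1_def)
  have AE1: "AE t in \<rho>. e1 \<le> \<bar>t - x1\<bar>" and AE2: "AE t in \<rho>. e1 \<le> \<bar>t - x2\<bar>"
    using AE x by (auto simp: e1_def elim!: eventually_mono)
  have i1: "integrable \<rho> (\<lambda>t. (1 + x1 * t) / (t - x1))" and i2: "integrable \<rho> (\<lambda>t. (1 + x2 * t) / (t - x2))"
    using r e1 AE1 AE2 by (auto intro!: integrable_real_kernel)
  define h where "h t = (1 + x2 * t) / (t - x2) - (1 + x1 * t) / (t - x1)" for t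
  have ih: "integrable \<rho> h" unfolding h_def using i1 i2 by simp
  have hpos: "AE t in \<rho>. 0 < h t"
    using AE
  proof eventually_elim
    case (elim t)
    then have nz: "t - x1 \<noteq> 0" "t - x2 \<noteq> 0" using x by auto
    then have "h t = (x2 - x1) * (1 + t\<^sup>2) / ((t - x1) * (t - x2))"
      by (simp add: h_def field_simps power2_eq_square)
    moreover have "0 < (t - x1) * (t - x2)"
      using elim x by (cases "t \<le> a") (auto intro: mult_pos_pos mult_neg_neg)
    moreover have "0 < (x2 - x1) * (1 + t\<^sup>2)"
      using x by (intro mult_pos_pos) (auto simp: add_pos_nonneg)
    ultimately show ?case by simp
  qed
  have "\<alpha> * (x2 - x1) + (\<integral>t. h t \<partial>\<rho>) = 0"
    using eq i1 i2 by (simp add: boundary_val_def h_def algebra_simps)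
  moreover have ge: "0 \<le> (\<integral>t. h t \<partial>\<rho>)"
    using hpos by (intro integral_nonneg_AE) (auto elim: eventually_mono)
  moreover have "0 \<le> \<alpha> * (x2 - x1)" using r x by simp
  ultimately have 0: "\<alpha> * (x2 - x1) = 0" "(\<integral>t. h t \<partial>\<rho>) = 0" by linarith+
  then have \<alpha>: "\<alpha> = 0" using x by simp
  have "AE t in \<rho>. 0 \<le> h t" using hpos by eventually_elim simp
  from integral_nonneg_eq_0_iff_AE[OF ih this] have "AE t in \<rho>. h t = 0" using 0(2) by blast
  with hpos have "AE t in \<rho>. False" by eventually_elim simp
  then have "(\<integral>t. nev_kernel z t \<partial>\<rho>) = (\<integral>t. 0 \<partial>\<rho>)"
    using sb by (intro integral_cong_AE) (auto elim: eventually_mono simp: measurable_nev_kernel_sets)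
  then show ?thesis using r z \<alpha> by simp
qed

section \<open>Existence of the Nevanlinna representation\<close>

lemma cauchy_circle:
  assumes F: "continuous_on (cball 0 1) F" "F holomorphic_on ball 0 1" and w: "cmod w < 1"
  shows "((\<lambda>\<theta>. F (cis \<theta>) * (cis \<theta> / (cis \<theta> - w))) has_integral 2 * complex_of_real pi * F w) {0..2*pi}"
proof -
  have "((\<lambda>u. F u / (u - w)) has_contour_integral (2 * of_real pi * \<i> * F w)) (part_circlepath 0 1 0 (2 * pi))"
    using Cauchy_integral_circlepath[OF F, of w] w by (simp add: circlepath_def)
  then have "((\<lambda>\<theta>. F (cis \<theta>) / (cis \<theta> - w) * \<i> * cis \<theta>) has_integral (2 * of_real pi * \<i> * F w)) {0..2*pi}"
    by (subst (asm) has_contour_integral_part_circlepath_iff) auto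
  from has_integral_mult_right[OF this, of "- \<i>"]
  show ?thesis by (simp add: mult_ac divide_inverse)
qed

text \<open>Cauchy's formula for \<open>F\<close> at \<open>w\<close>, combined with the conjugate of Cauchy's formula at \<open>0\<close> for
  \<open>F u / (1 - cnj w * u)\<close>.\<close>
lemma schwarz_formula:
  assumes F: "continuous_on (cball 0 1) F" "F holomorphic_on ball 0 1" and w: "cmod w < 1"
  shows "((\<lambda>\<theta>. complex_of_real (Re (F (cis \<theta>))) * ((cis \<theta> + w) / (cis \<theta> - w)))
           has_integral 2 * complex_of_real pi * (F w - \<i> * complex_of_real (Im (F 0)))) {0..2*pi}"
proof -
  have ne: "cis \<theta> - w \<noteq> 0" for \<theta> using w norm_cis[of \<theta>] by auto
  have ne': "1 - cnj w * u \<noteq> 0" if "cmod u \<le> 1" for u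
  proof -
    have "cmod (cnj w * u) \<le> cmod w * 1" using that by (simp add: norm_mult mult_left_le)
    then show ?thesis using w by auto
  qed
  have A: "((\<lambda>\<theta>. F (cis \<theta>) * (cis \<theta> / (cis \<theta> - w))) has_integral 2 * complex_of_real pi * F w) {0..2*pi}"
    by (rule cauchy_circle[OF F w])
  have A0: "((\<lambda>\<theta>. F (cis \<theta>)) has_integral 2 * complex_of_real pi * F 0) {0..2*pi}"
    using cauchy_circle[OF F, of 0] by simp
  have B0: "((\<lambda>\<theta>. cnj (F (cis \<theta>))) has_integral 2 * complex_of_real pi * cnj (F 0)) {0..2*pi}"
    using has_integral_cnj[of "\<lambda>\<theta>. F (cis \<theta>)", THEN iffD2, OF A0] by (simp add: o_def)
  have "((\<lambda>\<theta>. F (cis \<theta>) / (1 - cnj w * cis \<theta>) * (cis \<theta> / (cis \<theta> - 0))) has_integral 2 * complex_of_real pi * (F 0 / (1 - cnj w * 0))) {0..2*pi}"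
    by (rule cauchy_circle) (use F ne' in \<open>auto intro!: continuous_intros holomorphic_intros\<close>)
  then have "((\<lambda>\<theta>. F (cis \<theta>) / (1 - cnj w * cis \<theta>)) has_integral 2 * complex_of_real pi * F 0) {0..2*pi}"
    by simp
  from has_integral_cnj[of "\<lambda>\<theta>. F (cis \<theta>) / (1 - cnj w * cis \<theta>)", THEN iffD2, OF this]
  have B1: "((\<lambda>\<theta>. cnj (F (cis \<theta>)) / (1 - w * cnj (cis \<theta>))) has_integral 2 * complex_of_real pi * cnj (F 0)) {0..2*pi}"
    by (simp add: o_def)
  \<comment> \<open>On the unit circle conjugation is inversion, so the conjugated formula acquires
    the same kernel as \<open>A\<close>.\<close>
  have eq: "cnj (F (cis \<theta>)) / (1 - w * cnj (cis \<theta>)) = cnj (F (cis \<theta>)) * (cis \<theta> / (cis \<theta> - w))" for \<theta>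
  proof -
    have inv: "cnj (cis \<theta>) = inverse (cis \<theta>)" by (simp only: cis_cnj cis_inverse)
    have "1 - w * inverse e = (e - w) / e" if "e \<noteq> 0" for e
      using that by (simp add: field_simps)
    from this[OF cis_neq_zero] have "1 - w * inverse (cis \<theta>) = (cis \<theta> - w) / cis \<theta>" .
    have "1 - w * cnj (cis \<theta>) = (cis \<theta> - w) / cis \<theta>"
      using \<open>1 - w * inverse (cis \<theta>) = (cis \<theta> - w) / cis \<theta>\<close> inv by simp
    then show ?thesis by simp
  qed
  have B: "((\<lambda>\<theta>. cnj (F (cis \<theta>)) * (cis \<theta> / (cis \<theta> - w))) has_integral 2 * complex_of_real pi * cnj (F 0)) {0..2*pi}"
    using B1 unfolding eq .
  \<comment> \<open>Subtracting half of the two formulas at 0 replaces \<open>e / (e - w)\<close> by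
    \<open>e / (e - w) - 1/2\<close>, half of the Schwarz kernel, while F plus its conjugate
    supplies twice the real part.\<close>
  have "((\<lambda>\<theta>. (F (cis \<theta>) * (cis \<theta> / (cis \<theta> - w)) + cnj (F (cis \<theta>)) * (cis \<theta> / (cis \<theta> - w)))
          - (F (cis \<theta>) + cnj (F (cis \<theta>))) * (1/2))
     has_integral (2 * complex_of_real pi * F w + 2 * complex_of_real pi * cnj (F 0))
          - (2 * complex_of_real pi * F 0 + 2 * complex_of_real pi * cnj (F 0)) * (1/2)) {0..2*pi}"
    by (intro has_integral_diff has_integral_add A B A0 B0 has_integral_mult_left)
  moreover have "(u * (e / (e - w)) + cnj u * (e / (e - w))) - (u + cnj u) * (1/2) = complex_of_real (Re u) * ((e + w) / (e - w))"
    if "e - w \<noteq> 0" for u e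
  proof -
    have "(u * (e / (e - w)) + cnj u * (e / (e - w))) - (u + cnj u) * (1/2) = (u + cnj u) * (e / (e - w) - 1/2)"
      by (simp add: algebra_simps add_divide_distrib)
    also have "e / (e - w) - 1/2 = (e + w) / (e - w) / 2" using that by (simp add: field_simps)
    also have "(u + cnj u) * ((e + w) / (e - w) / 2) = complex_of_real (Re u) * ((e + w) / (e - w))"
    proof -
      have "2 * a * (b / 2) = a * b" for a b :: complex by simp
      then show ?thesis unfolding complex_add_cnj of_real_mult of_real_numeral .
    qed
    finally show ?thesis .
  qed
  moreover have "(2 * complex_of_real pi * F w + 2 * complex_of_real pi * cnj (F 0))
          - (2 * complex_of_real pi * F 0 + 2 * complex_of_real pi * cnj (F 0)) * (1/2) = 2 * complex_of_real pi * (F w - \<i> * complex_of_real (Im (F 0)))"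
    by (simp add: complex_eq_iff algebra_simps)
  ultimately show ?thesis using ne by simp
qed

text \<open>Open mapping: the range of a nonconstant f would contain a disc about the real number
  \<open>f z0\<close>, hence points below the real axis.\<close>

lemma nevanlinna_constant:
  assumes "nevanlinna f" "z0 \<in> upper_half" "Im (f z0) = 0" "z \<in> upper_half"
  shows "f z = f z0"
proof (rule ccontr)
  assume "f z \<noteq> f z0"
  then have nc: "\<not> f constant_on upper_half"
    using assms unfolding constant_on_def by metis
  have "connected upper_half"
    unfolding upper_half_def by (intro convex_connected convex_halfspace_Im_gt)
  then have "open (f ` upper_half)"
    using nc assms open_upper_half by (intro open_mapping_thm[of f upper_half]) (auto simp: nevanlinna_def)
  then obtain e where e: "0 < e" "ball (f z0) e \<subseteq> f ` upper_half"
    using assms(2) open_contains_ball by blast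
  have "f z0 - \<i> * complex_of_real (e / 2) \<in> ball (f z0) e"
    using e(1) by (simp add: dist_norm norm_mult)
  then have "f z0 - \<i> * complex_of_real (e / 2) \<in> f ` upper_half" using e(2) by (rule set_rev_mp)
  then obtain u where u: "u \<in> upper_half" "f z0 - \<i> * complex_of_real (e / 2) = f u" by (rule imageE)
  have "Im (f z0 - \<i> * complex_of_real (e / 2)) = - e / 2" using assms(3) by simp
  then have "Im (f u) < 0" unfolding u(2) using e(1) by simp
  moreover have "0 \<le> Im (f u)" using assms(1) u(1) by (simp add: nevanlinna_def)
  ultimately show False by simp
qed

text \<open>The Schwarz kernel of the unit disc, whose real part is the Poisson kernel.\<close>

definition herglotz_kernel :: "complex \<Rightarrow> real \<Rightarrow> complex" where
  "herglotz_kernel w \<theta> = (cis \<theta> + w) / (cis \<theta> - w)"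

lemma isCont_herglotz_kernel: "cmod w < 1 \<Longrightarrow> isCont (herglotz_kernel w) \<theta>"
proof -
  assume w: "cmod w < 1"
  have "cis \<theta> - w \<noteq> 0" using w norm_cis[of \<theta>] by auto
  moreover have "isCont cis \<theta>"
    using continuous_on_cis[OF continuous_on_id, of UNIV] by (simp add: continuous_on_eq_continuous_at)
  ultimately show ?thesis unfolding herglotz_kernel_def by (intro continuous_intros)
qed

lemma norm_herglotz_kernel_le:
  assumes "cmod w < 1"
  shows "cmod (herglotz_kernel w \<theta>) \<le> 2 / (1 - cmod w)"
proof -
  have "1 - cmod w \<le> cmod (cis \<theta> - w)" using norm_triangle_ineq2[of "cis \<theta>" w] by simp
  moreover have "cmod (cis \<theta> + w) \<le> 2" using norm_triangle_ineq[of "cis \<theta>" w] assms by simp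
  ultimately show ?thesis unfolding herglotz_kernel_def norm_divide
    using assms by (intro frac_le) auto
qed

lemma measurable_herglotz_kernel [measurable]: "herglotz_kernel w \<in> borel_measurable borel"
proof -
  have [measurable]: "cis \<in> borel_measurable borel"
    by (intro borel_measurable_continuous_onI continuous_intros)
  show ?thesis unfolding herglotz_kernel_def by measurable
qed

text \<open>The Schwarz formula read as an integral against Re F. Division by
  \<open>2 * pi * c\<close> makes the density a probability density, as required for weak limits.
  The interval \<open>{- 1<..8}\<close> is chosen to contain all angles from 0 to 2 pi, in the
  half-open form that \<open>tight\<close> asks for.\<close>

lemma herglotz_density:
  assumes F: "continuous_on (cball 0 1) F" "F holomorphic_on ball 0 1"
    and pos: "\<And>u. cmod u = 1 \<Longrightarrow> 0 \<le> Re (F u)" and c: "Re (F 0) = c" "0 < c"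
  defines "\<mu> \<equiv> density lborel (\<lambda>\<theta>. ennreal (indicator {0..2*pi} \<theta> * (Re (F (cis \<theta>)) / (2 * pi * c))))"
  shows "real_distribution \<mu>" "measure \<mu> {- 1<..8} = 1"
    "\<And>w. cmod w < 1 \<Longrightarrow> (\<integral>\<theta>. herglotz_kernel w \<theta> \<partial>\<mu>) = (F w - \<i> * complex_of_real (Im (F 0))) / c"
proof -
  define p where "p \<theta> = Re (F (cis \<theta>)) / (2 * pi * c)" for \<theta>
  have contF: "continuous_on A (\<lambda>\<theta>. F (cis \<theta>))" for A
    by (rule continuous_on_compose2[OF F(1)]) (auto intro!: continuous_intros)
  have contp: "continuous_on A p" for A
    unfolding p_def using c by (intro continuous_intros contF) auto
  have p0: "0 \<le> p \<theta>" for \<theta>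
    unfolding p_def using pos[of "cis \<theta>"] c by simp
  have [measurable]: "p \<in> borel_measurable borel"
    by (intro borel_measurable_continuous_onI contp)
  have mu: "\<mu> = density lborel (\<lambda>\<theta>. ennreal (indicator {0..2*pi} \<theta> * p \<theta>))"
    unfolding \<mu>_def p_def ..
  have kern: "(\<integral>\<theta>. herglotz_kernel w \<theta> \<partial>\<mu>) = (F w - \<i> * complex_of_real (Im (F 0))) / c" if w: "cmod w < 1" for w
  proof -
    have "(\<integral>\<theta>. herglotz_kernel w \<theta> \<partial>\<mu>) = (\<integral>\<theta>. (indicator {0..2*pi} \<theta> * p \<theta>) *\<^sub>R herglotz_kernel w \<theta> \<partial>lborel)"
      unfolding mu using p0 by (intro integral_density) auto
    also have "\<dots> = (LINT \<theta>:{0..2*pi}|lborel. p \<theta> *\<^sub>R herglotz_kernel w \<theta>)"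
      by (simp add: set_lebesgue_integral_def)
    also have "\<dots> = integral {0..2*pi} (\<lambda>\<theta>. p \<theta> *\<^sub>R herglotz_kernel w \<theta>)"
    proof (intro set_borel_integral_eq_integral(2) borel_integrable_atLeastAtMost' continuous_on_scaleR contp)
      show "continuous_on {0..2*pi} (herglotz_kernel w)"
        using isCont_herglotz_kernel[OF w] by (intro continuous_at_imp_continuous_on) auto
    qed
    also have "(\<lambda>\<theta>. p \<theta> *\<^sub>R herglotz_kernel w \<theta>) = (\<lambda>\<theta>. (complex_of_real (Re (F (cis \<theta>))) * ((cis \<theta> + w) / (cis \<theta> - w))) * (1 / (2 * pi * c)))"
      by (auto simp: p_def herglotz_kernel_def scaleR_conv_of_real)
    also have "integral {0..2*pi} \<dots> = (2 * complex_of_real pi * (F w - \<i> * complex_of_real (Im (F 0)))) * (1 / (2 * pi * c))"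
      by (rule integral_unique, rule has_integral_mult_left, rule schwarz_formula[OF F w])
    finally show ?thesis by simp
  qed
  \<comment> \<open>The kernel at w = 0 is identically 1, so the total mass is read off from the
    formula at the centre.\<close>
  have "(\<integral>\<theta>. 1 \<partial>\<mu>) = (1::complex)"
  proof -
    have "F 0 - \<i> * complex_of_real (Im (F 0)) = complex_of_real c" using c by (simp add: complex_eq_iff)
    moreover have "herglotz_kernel 0 \<theta> = 1" for \<theta> by (simp add: herglotz_kernel_def)
    ultimately show ?thesis using kern[of 0] c by simp
  qed
  have one: "(\<integral>\<theta>. indicator {0..2*pi} \<theta> * p \<theta> \<partial>lborel) = 1"
  proof -
    have "complex_of_real (\<integral>\<theta>. indicator {0..2*pi} \<theta> * p \<theta> \<partial>lborel) = (\<integral>\<theta>. (indicator {0..2*pi} \<theta> * p \<theta>) *\<^sub>R 1 \<partial>lborel)"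
      unfolding integral_complex_of_real[symmetric] by (simp add: scaleR_conv_of_real)
    also have "\<dots> = (\<integral>\<theta>. 1 \<partial>\<mu>)"
      unfolding mu using p0 by (intro integral_density[symmetric]) auto
    finally show ?thesis using \<open>(\<integral>\<theta>. 1 \<partial>\<mu>) = (1::complex)\<close> by simp
  qed
  have intp: "integrable lborel (\<lambda>\<theta>. indicator {0..2*pi} \<theta> * p \<theta>)"
    using borel_integrable_atLeastAtMost'[OF contp] by (simp add: set_integrable_def)
  have tot: "(\<integral>\<^sup>+\<theta>. ennreal (indicator {0..2*pi} \<theta> * p \<theta>) \<partial>lborel) = 1"
    using nn_integral_eq_integral[OF intp] p0 one by simp
  have em: "emeasure \<mu> A = (\<integral>\<^sup>+\<theta>. ennreal (indicator {0..2*pi} \<theta> * p \<theta>) * indicator A \<theta> \<partial>lborel)" if "A \<in> sets borel" for A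
    unfolding mu using that by (intro emeasure_density) auto
  have "emeasure \<mu> (space \<mu>) = 1" using em[of UNIV] tot by (simp add: mu)
  then have pr: "prob_space \<mu>" by (rule prob_spaceI)
  then show rd: "real_distribution \<mu>"
    by (simp add: real_distribution_def real_distribution_axioms_def mu)
  have "emeasure \<mu> {- 1<..8} = (\<integral>\<^sup>+\<theta>. ennreal (indicator {0..2*pi} \<theta> * p \<theta>) \<partial>lborel)"
    unfolding em[OF greaterThanAtMost_borel]
  proof (intro nn_integral_cong)
    fix \<theta> :: real
    have "2 * pi \<le> 8" using pi_less_4 by linarith
    then show "ennreal (indicator {0..2*pi} \<theta> * p \<theta>) * indicator {- 1<..8} \<theta> = ennreal (indicator {0..2*pi} \<theta> * p \<theta>)"
      by (auto simp: indicator_def)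
  qed
  then show "measure \<mu> {- 1<..8} = 1" using tot by (simp add: measure_def)
  show "\<And>w. cmod w < 1 \<Longrightarrow> (\<integral>\<theta>. herglotz_kernel w \<theta> \<partial>\<mu>) = (F w - \<i> * complex_of_real (Im (F 0))) / c"
    by (rule kern)
qed

text \<open>\<open>M\<close> is a weak limit (Helly) of the densities \<open>Re F\<close> on circles of radius tending to \<open>1\<close>.\<close>
lemma herglotz_disc:
  assumes F: "F holomorphic_on ball 0 1" and pos: "\<And>u. cmod u < 1 \<Longrightarrow> 0 \<le> Re (F u)"
    and c: "Re (F 0) = c" "0 < c"
  shows "\<exists>M. real_distribution M \<and>
    (\<forall>w. cmod w < 1 \<longrightarrow> F w = \<i> * complex_of_real (Im (F 0)) + c * (\<integral>\<theta>. herglotz_kernel w \<theta> \<partial>M))"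
proof -
  \<comment> \<open>The shift by 2 makes the first radius 1/2, so that all radii are strictly
    between 0 and 1.\<close>
  define r where "r n = 1 - 1 / (real n + 2)" for n :: nat
  have r: "0 < r n" "r n < 1" for n by (auto simp: r_def field_simps)
  have rlim: "r \<longlonglongrightarrow> 1"
    unfolding r_def by real_asymp
  define G where "G n u = F (complex_of_real (r n) * u)" for n u
  have small: "cmod (complex_of_real (r n) * u) < 1" if "cmod u \<le> 1" for n u
  proof -
    have "r n * cmod u \<le> r n * 1" using r[of n] that by (intro mult_left_mono) auto
    moreover have "cmod (complex_of_real (r n) * u) = r n * cmod u" using r[of n] by (simp add: norm_mult)
    ultimately show ?thesis using r[of n] by linarith
  qed
  have G_hol: "G n holomorphic_on cball 0 1" for n
    unfolding G_def
    by (rule holomorphic_on_compose_gen[unfolded o_def, OF _ F]) (use small in \<open>auto intro!: holomorphic_intros\<close>)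
  have G_cont: "continuous_on (cball 0 1) (G n)" for n
    by (rule holomorphic_on_imp_continuous_on[OF G_hol])
  have G_hol': "G n holomorphic_on ball 0 1" for n
    by (rule holomorphic_on_subset[OF G_hol]) auto
  have G_pos: "0 \<le> Re (G n u)" if "cmod u = 1" for n u
    unfolding G_def using pos[OF small[of u n]] that by simp
  have G0: "G n 0 = F 0" for n by (simp add: G_def)
  have G0c: "Re (G n 0) = c" for n using c by (simp add: G0)
  define \<mu> where "\<mu> n = density lborel (\<lambda>\<theta>. ennreal (indicator {0..2*pi} \<theta> * (Re (G n (cis \<theta>)) / (2 * pi * c))))" for n
  note D = herglotz_density[OF G_cont G_hol' G_pos G0c c(2), folded \<mu>_def]
  \<comment> \<open>All measures live on the same bounded interval.\<close>
  have "tight \<mu>"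
    unfolding tight_def
  proof (intro conjI allI impI)
    fix \<epsilon> :: real assume "0 < \<epsilon>"
    then have "(-1::real) < 8 \<and> (\<forall>n. measure (\<mu> n) {- 1<..8} > 1 - \<epsilon>)" using D(2) by simp
    then show "\<exists>a b. a < b \<and> (\<forall>n. measure (\<mu> n) {a<..b} > 1 - \<epsilon>)" by blast
  qed (rule D(1))
  from tight_imp_convergent_subsubsequence[OF this strict_mono_id]
  obtain s M where s: "strict_mono (s :: nat \<Rightarrow> nat)" and M: "real_distribution M" and conv: "weak_conv_m (\<mu> \<circ> s) M"
    by auto
  have "F w = \<i> * complex_of_real (Im (F 0)) + c * (\<integral>\<theta>. herglotz_kernel w \<theta> \<partial>M)" if w: "cmod w < 1" for w
  proof -
    \<comment> \<open>For fixed w inside the disc the kernel is bounded and continuous in the angle,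
      so it is an admissible test function for weak convergence.\<close>
    have "(\<lambda>n. \<integral>\<theta>. herglotz_kernel w \<theta> \<partial>(\<mu> \<circ> s) n) \<longlonglongrightarrow> (\<integral>\<theta>. herglotz_kernel w \<theta> \<partial>M)"
      by (rule weak_conv_imp_integral_bdd_continuous_conv[OF _ M conv])
        (use D(1) isCont_herglotz_kernel[OF w] norm_herglotz_kernel_le[OF w] in auto)
    moreover have "(\<lambda>n. (F (complex_of_real (r (s n)) * w) - \<i> * complex_of_real (Im (F 0))) / c) \<longlonglongrightarrow> (F (complex_of_real 1 * w) - \<i> * complex_of_real (Im (F 0))) / c"
    proof (intro tendsto_intros)
      have "isCont F w"
        using holomorphic_on_imp_continuous_on[OF F] w by (simp add: continuous_on_eq_continuous_at)
      moreover have "(\<lambda>n. complex_of_real (r (s n)) * w) \<longlonglongrightarrow> complex_of_real 1 * w"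
        using LIMSEQ_subseq_LIMSEQ[OF rlim s] by (intro tendsto_intros) (auto simp: o_def)
      ultimately show "(\<lambda>n. F (complex_of_real (r (s n)) * w)) \<longlonglongrightarrow> F (complex_of_real 1 * w)"
        using isCont_tendsto_compose[of w F] by simp
    qed (use c in auto)
    moreover have "(\<integral>\<theta>. herglotz_kernel w \<theta> \<partial>(\<mu> \<circ> s) n) = (F (complex_of_real (r (s n)) * w) - \<i> * complex_of_real (Im (F 0))) / c" for n
      using D(3)[OF _ w, of "s n"] by (simp add: G_def)
    ultimately have "(\<integral>\<theta>. herglotz_kernel w \<theta> \<partial>M) = (F w - \<i> * complex_of_real (Im (F 0))) / c"
      using LIMSEQ_unique by fastforce
    then show ?thesis using c by simp
  qed
  with M show ?thesis by blast
qed

text \<open>Transport by the Cayley transform: after clearing \<open>z + \<i>\<close>, numerator and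
  denominator of the Schwarz kernel become \<open>- \<i> * (1 - e) * (1 + z * t)\<close> and
  \<open>(1 - e) * (t - z)\<close>.\<close>

lemma cayley_kernel:
  assumes z: "z \<in> upper_half" and t: "complex_of_real t = \<i> * (1 + e) / (1 - e)" and e: "e \<noteq> 1"
  shows "\<i> * ((e + (z - \<i>) / (z + \<i>)) / (e - (z - \<i>) / (z + \<i>))) = nev_kernel z t"
proof -
  have zi: "z + \<i> \<noteq> 0" using z by (auto simp: upper_half_def complex_eq_iff)
  have e1: "1 - e \<noteq> 0" using e by auto
  have tz: "complex_of_real t - z \<noteq> 0" by (rule upper_half_ne[OF z])
  have t': "complex_of_real t * (1 - e) = \<i> * (1 + e)" using t e1 by simp
  have A: "(1 - e) * (1 + z * complex_of_real t) = \<i> * (e * (z + \<i>) + (z - \<i>))"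
  proof -
    have "(1 - e) * (1 + z * complex_of_real t) = (1 - e) + z * (complex_of_real t * (1 - e))" by (simp add: algebra_simps)
    also have "\<dots> = \<i> * (e * (z + \<i>) + (z - \<i>))" unfolding t' by (simp add: algebra_simps)
    finally show ?thesis by simp
  qed
  have B: "(1 - e) * (complex_of_real t - z) = e * (z + \<i>) - (z - \<i>)"
  proof -
    have "(1 - e) * (complex_of_real t - z) = complex_of_real t * (1 - e) - z * (1 - e)" by (simp add: algebra_simps)
    also have "\<dots> = e * (z + \<i>) - (z - \<i>)" unfolding t' by (simp add: algebra_simps)
    finally show ?thesis .
  qed
  have ne: "e * (z + \<i>) - (z - \<i>) \<noteq> 0" unfolding B[symmetric] using e1 tz by simp
  have "(e + (z - \<i>) / (z + \<i>)) / (e - (z - \<i>) / (z + \<i>)) = (e * (z + \<i>) + (z - \<i>)) / (e * (z + \<i>) - (z - \<i>))"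
  proof -
    have 1: "e + (z - \<i>) / (z + \<i>) = (e * (z + \<i>) + (z - \<i>)) / (z + \<i>)"
      "e - (z - \<i>) / (z + \<i>) = (e * (z + \<i>) - (z - \<i>)) / (z + \<i>)"
      using zi by (simp_all add: add_divide_distrib diff_divide_distrib)
    show ?thesis unfolding 1 using zi by simp
  qed
  then have "\<i> * ((e + (z - \<i>) / (z + \<i>)) / (e - (z - \<i>) / (z + \<i>))) = ((1 - e) * (1 + z * complex_of_real t)) / ((1 - e) * (complex_of_real t - z))"
    unfolding A B by simp
  then show ?thesis using e1 by (simp add: nev_kernel_def)
qed

text \<open>The Herglotz formula in the disc is carried to the half-plane. Mass at the angles sent
  to infinity becomes the linear coefficient, the remaining mass is pushed forward to the line. A
  function with real value at \<open>\<i>\<close> is constant and gets the zero measure, because the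
  disc formula needs a positive value at the centre.\<close>

lemma nev_rep_exists:
  assumes f: "nevanlinna f"
  shows "\<exists>\<alpha> \<beta> \<rho>. nev_rep f \<alpha> \<beta> \<rho>"
proof (cases "Im (f \<i>) = 0")
  case True
  have i: "\<i> \<in> upper_half" by (simp add: upper_half_def)
  have "nev_rep f 0 (Re (f \<i>)) (null_measure borel)"
    unfolding nev_rep_iff
  proof (intro conjI ballI)
    show "finite_measure (null_measure borel)" by (rule finite_measureI) simp
    fix z assume "z \<in> upper_half"
    have "(\<integral>t. nev_kernel z t \<partial>null_measure borel) = 0"
      by (rule integral_eq_zero_AE) (auto intro!: AE_I[of _ _ UNIV])
    then show "f z = complex_of_real 0 * z + complex_of_real (Re (f \<i>)) + (\<integral>t. nev_kernel z t \<partial>null_measure borel)"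
      using nevanlinna_constant[OF f i True \<open>z \<in> upper_half\<close>] True by (simp add: complex_eq_iff)
  qed auto
  then show ?thesis by blast
next
  case False
  define c where "c = Im (f \<i>)"
  have i: "\<i> \<in> upper_half" by (simp add: upper_half_def)
  then have c: "0 < c" using f False by (auto simp: c_def nevanlinna_def less_le)
  \<comment> \<open>The Cayley transform from the disc to the half-plane, with 0 sent to
    \<open>\<i>\<close> and 1 to infinity.\<close>
  define \<phi> where "\<phi> w = \<i> * (1 + w) / (1 - w)" for w :: complex
  have \<phi>: "\<phi> w \<in> upper_half" if "cmod w < 1" for w
  proof -
    have "1 - w \<noteq> 0" using that by auto
    have "\<phi> w = \<i> * ((1 + w) / (1 - w))" by (simp add: \<phi>_def)
    then have "Im (\<phi> w) = Re ((1 + w) / (1 - w))" by (simp only: Im_i_times)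
    also have "\<dots> = (1 - (cmod w)\<^sup>2) / (cmod (1 - w))\<^sup>2"
      unfolding Re_divide cmod_power2 by (simp add: power2_eq_square algebra_simps)
    also have "\<dots> > 0"
      using that \<open>1 - w \<noteq> 0\<close> power_strict_mono[of "cmod w" 1 2] by (intro divide_pos_pos) auto
    finally show ?thesis by (simp add: upper_half_def)
  qed
  define F where "F w = - \<i> * f (\<phi> w)" for w
  have \<phi>h: "\<phi> holomorphic_on ball 0 1" unfolding \<phi>_def by (auto intro!: holomorphic_intros)
  have "(\<lambda>w. f (\<phi> w)) holomorphic_on ball 0 1"
    by (rule holomorphic_on_compose_gen[unfolded o_def, OF \<phi>h, of f upper_half]) (use \<phi> f in \<open>auto simp: nevanlinna_def\<close>)
  then have F: "F holomorphic_on ball 0 1" unfolding F_def by (intro holomorphic_intros)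
  have pos: "0 \<le> Re (F u)" if "cmod u < 1" for u
    using f \<phi>[OF that] by (simp add: F_def nevanlinna_def)
  have F0: "F 0 = - \<i> * f \<i>" by (simp add: F_def \<phi>_def)
  obtain M where M: "real_distribution M"
    and rep: "\<And>w. cmod w < 1 \<Longrightarrow> F w = \<i> * complex_of_real (Im (F 0)) + c * (\<integral>\<theta>. herglotz_kernel w \<theta> \<partial>M)"
    using herglotz_disc[OF F pos, of c] c by (auto simp: F0 c_def)
  interpret M: real_distribution M by fact
  have sM: "space M = UNIV" using sets_eq_imp_space_eq[OF M.events_eq_borel] by simp
  \<comment> \<open>The complement of \<open>A\<close> consists of the angles sent to infinity; its
    mass becomes \<alpha>.\<close>
  define A where "A = {\<theta>. cis \<theta> \<noteq> 1}"
  have [measurable]: "cis \<in> borel_measurable borel"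
    by (intro borel_measurable_continuous_onI continuous_intros)
  have [measurable]: "A \<in> sets borel" unfolding A_def by measurable
  define T where "T \<theta> = Re (\<phi> (cis \<theta>))" for \<theta>
  have [measurable]: "T \<in> borel_measurable borel" unfolding T_def \<phi>_def by measurable
  have T: "complex_of_real (T \<theta>) = \<i> * (1 + cis \<theta>) / (1 - cis \<theta>)" if "cis \<theta> \<noteq> 1" for \<theta>
  proof -
    have "\<phi> (cis \<theta>) = \<i> * ((1 + cis \<theta>) / (1 - cis \<theta>))" by (simp add: \<phi>_def)
    then have "Im (\<phi> (cis \<theta>)) = Re ((1 + cis \<theta>) / (1 - cis \<theta>))" by (simp only: Im_i_times)
    also have "\<dots> = 0"
    proof -
      have "(1 + cos \<theta>) * (1 - cos \<theta>) + sin \<theta> * (- sin \<theta>) = 0"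
        using sin_cos_squared_add3[of \<theta>] by (simp add: algebra_simps)
      then have "Re (1 + cis \<theta>) * Re (1 - cis \<theta>) + Im (1 + cis \<theta>) * Im (1 - cis \<theta>) = 0" by simp
      then show ?thesis unfolding Re_divide by (simp only: div_0)
    qed
    finally show ?thesis by (simp add: T_def complex_eq_iff \<phi>_def)
  qed
  define N where "N = density M (\<lambda>\<theta>. ennreal (c * indicator A \<theta>))"
  define \<rho> where "\<rho> = distr N borel T"
  define \<alpha> where "\<alpha> = c * measure M (- A)"
  have iA: "integrable M (\<lambda>\<theta>. c * indicator A \<theta>)" 
    by (intro integrable_mult_right) (simp add: integrable_indicator_iff M.emeasure_eq_measure)
  have fin: "finite_measure \<rho>"
  proof (rule finite_measureI)
    have "emeasure \<rho> (space \<rho>) = (\<integral>\<^sup>+\<theta>. ennreal (c * indicator A \<theta>) \<partial>M)"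
      unfolding \<rho>_def N_def by (subst emeasure_distr) (auto simp: emeasure_density sM)
    also have "\<dots> \<noteq> \<infinity>" using nn_integral_eq_integral[OF iA] c by simp
    finally show "emeasure \<rho> (space \<rho>) \<noteq> \<infinity>" .
  qed
  have "f z = complex_of_real \<alpha> * z + complex_of_real (Re (f \<i>)) + (\<integral>t. nev_kernel z t \<partial>\<rho>)" if z: "z \<in> upper_half" for z
  proof -
    define w where "w = (z - \<i>) / (z + \<i>)"
    have zi: "z + \<i> \<noteq> 0" using z by (auto simp: upper_half_def complex_eq_iff)
    have "(cmod (z - \<i>))\<^sup>2 < (cmod (z + \<i>))\<^sup>2"
      unfolding cmod_power2 using z by (simp add: upper_half_def power2_eq_square algebra_simps)
    then have "cmod (z - \<i>) < cmod (z + \<i>)" by (rule power2_less_imp_less) simp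
    then have w: "cmod w < 1" using zi by (simp add: w_def norm_divide)
    have w1: "1 - w = 2 * \<i> / (z + \<i>)" "1 + w = 2 * z / (z + \<i>)"
      unfolding w_def using zi by (simp_all add: field_simps)
    have \<phi>w: "\<phi> w = z" unfolding \<phi>_def w1 using zi by simp
    \<comment> \<open>Where \<open>cis \<theta> = 1\<close> the left side is
      \<open>\<i> * (1 + w) / (1 - w)\<close>, which equals z; elsewhere
      \<open>cayley_kernel\<close> applies.\<close>
    have k: "\<i> * herglotz_kernel w \<theta> = (c * indicator A \<theta> / c) *\<^sub>R nev_kernel z (T \<theta>) + indicator (- A) \<theta> *\<^sub>R z" for \<theta>
    proof (cases "cis \<theta> = 1")
      case True
      then show ?thesis unfolding herglotz_kernel_def True w1 using zi by (simp add: A_def indicator_def True)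
    next
      case False
      then show ?thesis using cayley_kernel[OF z T[OF False] False] c
        by (simp add: herglotz_kernel_def w_def A_def)
    qed
    have bdd: "cmod (indicator A \<theta> *\<^sub>R nev_kernel z (T \<theta>)) \<le> cmod z + cmod (1 + z\<^sup>2) * inverse (Im z)" for \<theta>
      using norm_nev_kernel_le[OF z, of "T \<theta>"] order_trans[OF norm_ge_zero norm_nev_kernel_le[OF z, of "T \<theta>"]]
      unfolding indicator_def by (cases "\<theta> \<in> A") (simp_all only: of_bool_eq if_True if_False scaleR_one scaleR_zero_left norm_zero)
    have [measurable]: "nev_kernel z \<in> borel_measurable borel" by (rule measurable_nev_kernel)
    have intA: "integrable M (\<lambda>\<theta>. indicator A \<theta> *\<^sub>R nev_kernel z (T \<theta>))"
      by (rule M.integrable_const_bound[of _ "cmod z + cmod (1 + z\<^sup>2) * inverse (Im z)"]) (use bdd in auto)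
    have intB: "integrable M (\<lambda>\<theta>. indicator (- A) \<theta> *\<^sub>R z)"
      by (intro integrable_scaleR_left) (simp add: integrable_indicator_iff M.emeasure_eq_measure)
    have "f z = \<i> * F w" by (simp add: F_def \<phi>w)
    also have "\<dots> = \<i> * (\<i> * complex_of_real (Im (F 0))) + c * (\<i> * (\<integral>\<theta>. herglotz_kernel w \<theta> \<partial>M))"
      unfolding rep[OF w] by (simp add: algebra_simps)
    also have "\<i> * (\<integral>\<theta>. herglotz_kernel w \<theta> \<partial>M) = (\<integral>\<theta>. \<i> * herglotz_kernel w \<theta> \<partial>M)" by simp
    also have "\<dots> = (\<integral>\<theta>. indicator A \<theta> *\<^sub>R nev_kernel z (T \<theta>) + indicator (- A) \<theta> *\<^sub>R z \<partial>M)"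
      unfolding k using c by simp
    also have "\<dots> = (\<integral>\<theta>. indicator A \<theta> *\<^sub>R nev_kernel z (T \<theta>) \<partial>M) + (\<integral>\<theta>. indicator (- A) \<theta> *\<^sub>R z \<partial>M)"
      by (rule Bochner_Integration.integral_add[OF intA intB])
    also have "(\<integral>\<theta>. indicator (- A) \<theta> *\<^sub>R z \<partial>M) = measure M (- A) *\<^sub>R z"
      by (subst integral_scaleR_left) (auto simp: integrable_indicator_iff M.emeasure_eq_measure sM)
    also have "c * ((\<integral>\<theta>. indicator A \<theta> *\<^sub>R nev_kernel z (T \<theta>) \<partial>M) + measure M (- A) *\<^sub>R z)
        = complex_of_real \<alpha> * z + c * (\<integral>\<theta>. indicator A \<theta> *\<^sub>R nev_kernel z (T \<theta>) \<partial>M)"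
      by (simp add: \<alpha>_def scaleR_conv_of_real algebra_simps)
    also have "c * (\<integral>\<theta>. indicator A \<theta> *\<^sub>R nev_kernel z (T \<theta>) \<partial>M) = (\<integral>\<theta>. (c * indicator A \<theta>) *\<^sub>R nev_kernel z (T \<theta>) \<partial>M)"
      by (simp add: scaleR_conv_of_real mult.assoc)
    also have "\<dots> = (\<integral>\<theta>. nev_kernel z (T \<theta>) \<partial>N)"
      unfolding N_def using c by (intro integral_density[symmetric]) auto
    also have "\<dots> = (\<integral>t. nev_kernel z t \<partial>\<rho>)"
      unfolding \<rho>_def by (rule integral_distr[symmetric]) (auto simp: N_def)
    also have "\<i> * (\<i> * complex_of_real (Im (F 0))) = complex_of_real (Re (f \<i>))"
      by (simp add: F0 algebra_simps)
    finally show ?thesis by (simp add: add_ac)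
  qed
  then have "nev_rep f \<alpha> (Re (f \<i>)) \<rho>"
    unfolding nev_rep_iff using fin c by (auto simp: \<rho>_def \<alpha>_def)
  then show ?thesis by blast
qed

section \<open>Stieltjes inversion\<close>

text \<open>The integral over x from c to d of the imaginary part of the kernel at x + iy, as
  \<open>integral_strip\<close> shows.\<close>

definition poisson_diff :: "real \<Rightarrow> real \<Rightarrow> real \<Rightarrow> real \<Rightarrow> real" where
  "poisson_diff c d y t = (1 + t\<^sup>2) * (arctan ((d - t) / y) - arctan ((c - t) / y))"

text \<open>\<open>1 + t\<^sup>2\<close> on \<open>(c, d)\<close>, with weight one half at the endpoints since \<open>sgn 0 = 0\<close>.\<close>
definition stieltjes_weight :: "real \<Rightarrow> real \<Rightarrow> real \<Rightarrow> real" where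
  "stieltjes_weight c d t = (1 + t\<^sup>2) * ((sgn (d - t) - sgn (c - t)) / 2)"

lemma DERIV_arctan_shift:
  fixes t x y :: real
  assumes "0 < y"
  shows "((\<lambda>x. arctan ((x - t) / y)) has_real_derivative y / (y\<^sup>2 + (x - t)\<^sup>2)) (at x within S)"
proof -
  have "0 < 1 + ((x - t) / y)\<^sup>2" "0 < y\<^sup>2 + (x - t)\<^sup>2" using assms by (auto intro: add_pos_nonneg)
  have "((\<lambda>x. arctan ((x - t) / y)) has_real_derivative inverse (1 + ((x - t) / y)\<^sup>2) * (1 / y)) (at x within S)"
    using assms by (auto intro!: derivative_eq_intros)
  moreover have "inverse (1 + ((x - t) / y)\<^sup>2) * (1 / y) = y / (y\<^sup>2 + (x - t)\<^sup>2)"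
  proof -
    have "1 + ((x - t) / y)\<^sup>2 = (y\<^sup>2 + (x - t)\<^sup>2) / y\<^sup>2" using assms by (simp add: power_divide add_divide_distrib)
    then show ?thesis using assms by (simp add: power2_eq_square)
  qed
  ultimately show ?thesis by simp
qed

lemma poisson_diff_nonneg: "c \<le> d \<Longrightarrow> 0 < y \<Longrightarrow> 0 \<le> poisson_diff c d y t"
  unfolding poisson_diff_def
  by (intro mult_nonneg_nonneg) (auto simp: arctan_le_iff divide_right_mono)

text \<open>Supplies the dominating constant for the limit y to 0. For bounded t the arctangents
  differ by at most pi; for large t the mean value theorem yields a decay that beats the factor
  \<open>1 + t\<^sup>2\<close>.\<close>

lemma poisson_diff_bounded:
  assumes "c < d"
  shows "\<exists>B. \<forall>t y. 0 < y \<longrightarrow> y \<le> 1 \<longrightarrow> \<bar>poisson_diff c d y t\<bar> \<le> B"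
proof -
  \<comment> \<open>Beyond \<open>L\<close> every x between c and d satisfies
    \<open>\<bar>t\<bar> \<le> 2 * \<bar>x - t\<bar>\<close>; the summand 1 ensures
    \<open>1 \<le> \<bar>t\<bar>\<close> there.\<close>
  define L where "L = 2 * (\<bar>c\<bar> + \<bar>d\<bar>) + 1"
  define B where "B = max ((1 + L\<^sup>2) * pi) (8 * (d - c))"
  have "\<bar>poisson_diff c d y t\<bar> \<le> B" if y: "0 < y" "y \<le> 1" for t y
  proof (cases "\<bar>t\<bar> \<le> L")
    case True
    then have "t\<^sup>2 \<le> L\<^sup>2" using power_mono[OF True, of 2] by simp
    moreover have "arctan ((d - t) / y) - arctan ((c - t) / y) \<le> pi"
      using arctan_ubound[of "(d - t) / y"] arctan_lbound[of "(c - t) / y"] by linarith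
    moreover have "0 \<le> arctan ((d - t) / y) - arctan ((c - t) / y)"
      using y assms by (simp add: arctan_le_iff divide_right_mono)
    ultimately have "poisson_diff c d y t \<le> (1 + L\<^sup>2) * pi"
      unfolding poisson_diff_def by (intro mult_mono) auto
    then show ?thesis using poisson_diff_nonneg[of c d y t] assms y by (simp add: B_def)
  next
    case False
    obtain x where x: "c < x" "x < d" and eq: "arctan ((d - t) / y) - arctan ((c - t) / y) = (d - c) * (y / (y\<^sup>2 + (x - t)\<^sup>2))"
      using MVT2[OF assms, of "\<lambda>x. arctan ((x - t) / y)" "\<lambda>x. y / (y\<^sup>2 + (x - t)\<^sup>2)"] DERIV_arctan_shift[OF y(1)] by blast
    have t1: "1 \<le> \<bar>t\<bar>" using False by (simp add: L_def)
    have "\<bar>t\<bar> \<le> 2 * \<bar>x - t\<bar>" 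
    proof -
      have "\<bar>x\<bar> \<le> \<bar>c\<bar> + \<bar>d\<bar>" using x by arith
      moreover have "\<bar>t\<bar> \<le> \<bar>x - t\<bar> + \<bar>x\<bar>" by arith
      moreover have "T \<le> 2 * U" if "X \<le> S" "T \<le> U + X" "\<not> T \<le> 2 * S + 1" for T U X S :: real
        using that by linarith
      ultimately show ?thesis using False unfolding L_def by blast
    qed
    then have "t\<^sup>2 \<le> 4 * (x - t)\<^sup>2"
      using power_mono[of "\<bar>t\<bar>" "2 * \<bar>x - t\<bar>" 2] by (simp add: power_mult_distrib)
    have t2: "1 \<le> t\<^sup>2" using power_mono[OF t1, of 2] by simp
    have A: "1 + t\<^sup>2 \<le> 8 * (y\<^sup>2 + (x - t)\<^sup>2)"
    proof -
      have "1 + T \<le> 8 * (Y + X)" if "T \<le> 4 * X" "1 \<le> T" "0 \<le> Y" for T X Y :: real using that by argo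
      then show "1 + t\<^sup>2 \<le> 8 * (y\<^sup>2 + (x - t)\<^sup>2)"
        using \<open>t\<^sup>2 \<le> 4 * (x - t)\<^sup>2\<close> \<open>1 \<le> t\<^sup>2\<close> zero_le_power2[of y] by blast
    qed
    have p: "0 < y\<^sup>2 + (x - t)\<^sup>2" using y by (auto intro: add_pos_nonneg)
    have "(1 + t\<^sup>2) * (y / (y\<^sup>2 + (x - t)\<^sup>2)) \<le> 8 * (y\<^sup>2 + (x - t)\<^sup>2) * (y / (y\<^sup>2 + (x - t)\<^sup>2))"
      using y p by (intro mult_right_mono A) auto
    also have "\<dots> = 8 * y"
    proof -
      have "8 * P * (y / P) = 8 * y" if "0 < P" for P using that by simp
      then show ?thesis using p by blast
    qed
    also have "\<dots> \<le> 8" using y by simp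
    finally have "(d - c) * ((1 + t\<^sup>2) * (y / (y\<^sup>2 + (x - t)\<^sup>2))) \<le> (d - c) * 8"
      using assms by (intro mult_left_mono) auto
    then have "poisson_diff c d y t \<le> 8 * (d - c)" unfolding poisson_diff_def eq by (simp only: mult_ac)
    then show ?thesis using poisson_diff_nonneg[of c d y t] assms y by (simp add: B_def)
  qed
  then show ?thesis by blast
qed

lemma arctan_scaled_limit: "(\<lambda>n. arctan (u / (1 / (real n + 1)))) \<longlonglongrightarrow> pi / 2 * sgn u"
proof -
  have A: "(\<lambda>n. arctan (v * (real n + 1))) \<longlonglongrightarrow> pi / 2" if "0 < v" for v
  proof (rule filterlim_compose[OF tendsto_arctan_at_top])
    show "filterlim (\<lambda>n. v * (real n + 1)) at_top sequentially" using that by real_asymp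
  qed
  consider "u > 0" | "u = 0" | "u < 0" by linarith
  then show ?thesis
  proof cases
    case 3
    have "(\<lambda>n. - arctan (- u * (real n + 1))) \<longlonglongrightarrow> - (pi / 2)"
      by (intro tendsto_minus A) (use 3 in simp)
    moreover have "- arctan (- u * (real n + 1)) = arctan (u * (real n + 1))" for n
      unfolding mult_minus_left arctan_minus by simp
    ultimately show ?thesis using 3 by simp
  qed (use A[of u] in auto)
qed

lemma poisson_diff_limit: "(\<lambda>n. poisson_diff c d (1 / (real n + 1)) t) \<longlonglongrightarrow> pi * stieltjes_weight c d t"
proof -
  have "(\<lambda>n. poisson_diff c d (1 / (real n + 1)) t) \<longlonglongrightarrow> (1 + t\<^sup>2) * (pi / 2 * sgn (d - t) - pi / 2 * sgn (c - t))"
    unfolding poisson_diff_def by (intro tendsto_intros arctan_scaled_limit)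
  moreover have "(1 + t\<^sup>2) * (pi / 2 * sgn (d - t) - pi / 2 * sgn (c - t)) = pi * stieltjes_weight c d t"
    by (simp add: stieltjes_weight_def field_simps)
  ultimately show ?thesis by simp
qed

lemma measurable_stieltjes_weight [measurable]: "stieltjes_weight c d \<in> borel_measurable borel"
  unfolding stieltjes_weight_def by measurable

lemma stieltjes_weight_bounded: "\<bar>stieltjes_weight c d t\<bar> \<le> 1 + (\<bar>c\<bar> + \<bar>d\<bar>)\<^sup>2" if "c < d"
proof (cases "c \<le> t \<and> t \<le> d")
  case True
  then have "\<bar>t\<bar> \<le> \<bar>\<bar>c\<bar> + \<bar>d\<bar>\<bar>" by auto
  then have "t\<^sup>2 \<le> (\<bar>c\<bar> + \<bar>d\<bar>)\<^sup>2" by (simp only: abs_le_square_iff)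
  then have "(1 + t\<^sup>2) * \<bar>(sgn (d - t) - sgn (c - t)) / 2\<bar> \<le> (1 + (\<bar>c\<bar> + \<bar>d\<bar>)\<^sup>2) * 1"
    by (intro mult_mono) (auto simp: sgn_if)
  then show ?thesis by (simp add: stieltjes_weight_def abs_mult)
next
  case False
  then have "stieltjes_weight c d t = 0" using that by (auto simp: stieltjes_weight_def sgn_if)
  then show ?thesis by simp
qed

lemma stieltjes_weight_nonneg: "c < d \<Longrightarrow> 0 \<le> stieltjes_weight c d t"
  by (auto simp: stieltjes_weight_def sgn_if)

lemma Im_nev_kernel_Complex: "Im (nev_kernel (Complex x y) t) = (1 + t\<^sup>2) * (y / (y\<^sup>2 + (x - t)\<^sup>2))"
proof -
  have "(cmod (complex_of_real t - Complex x y))\<^sup>2 = y\<^sup>2 + (x - t)\<^sup>2"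
    by (simp add: cmod_power2 power2_commute)
  then show ?thesis by (simp add: Im_nev_kernel)
qed

text \<open>Fubini: for fixed height y the kernel is bounded over the segment, and its integral in x
  is a difference of arctangents.\<close>

lemma integral_strip:
  assumes rep: "nev_rep f \<alpha> \<beta> \<rho>" and cd: "c < d" and y: "0 < y"
  shows "(LINT x:{c..d}|lborel. Im (f (Complex x y))) = \<alpha> * y * (d - c) + (\<integral>t. poisson_diff c d y t \<partial>\<rho>)"
proof -
  note r = rep[unfolded nev_rep_iff]
  have sb: "sets \<rho> = sets borel" using r by simp
  have sp: "space \<rho> = UNIV" using sets_eq_imp_space_eq[OF sb] by simp
  interpret finite_measure \<rho> using r by simp
  interpret P: pair_sigma_finite lborel \<rho> ..
  define k where "k x t = indicator {c..d} x *\<^sub>R ((1 + t\<^sup>2) * (y / (y\<^sup>2 + (x - t)\<^sup>2)))" for x t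
  define L where "L = \<bar>c\<bar> + \<bar>d\<bar> + y"
  have uh: "Complex x y \<in> upper_half" for x using y by (simp add: upper_half_def)
  have bound: "\<bar>(1 + t\<^sup>2) * (y / (y\<^sup>2 + (x - t)\<^sup>2))\<bar> \<le> L + (1 + L\<^sup>2) * inverse y" if x: "x \<in> {c..d}" for x t
  proof -
    have "cmod (Complex x y) \<le> \<bar>x\<bar> + \<bar>y\<bar>" using cmod_le[of "Complex x y"] by simp
    then have l: "cmod (Complex x y) \<le> L" using x y by (auto simp: L_def)
    have "cmod (1 + (Complex x y)\<^sup>2) \<le> 1 + (cmod (Complex x y))\<^sup>2"
      by (rule order_trans[OF norm_triangle_ineq]) (simp add: norm_power)
    also have "\<dots> \<le> 1 + L\<^sup>2" using l by (intro add_left_mono power_mono) auto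
    finally have l2: "cmod (1 + (Complex x y)\<^sup>2) * inverse y \<le> (1 + L\<^sup>2) * inverse y"
      using y by (intro mult_right_mono) auto
    have "\<bar>Im (nev_kernel (Complex x y) t)\<bar> \<le> cmod (nev_kernel (Complex x y) t)" by (rule abs_Im_le_cmod)
    also have "\<dots> \<le> cmod (Complex x y) + cmod (1 + (Complex x y)\<^sup>2) * inverse y"
      using norm_nev_kernel_le[OF uh, of x t] by simp
    finally show ?thesis unfolding Im_nev_kernel_Complex using l l2 by linarith
  qed
  have meas: "(\<lambda>p. k (fst p) (snd p)) \<in> borel_measurable (lborel \<Otimes>\<^sub>M \<rho>)"
  proof -
    have "sets (lborel \<Otimes>\<^sub>M \<rho>) = sets (borel \<Otimes>\<^sub>M borel)" using sb by (intro sets_pair_measure_cong) auto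
    then show ?thesis unfolding k_def measurable_cong_sets[OF \<open>sets (lborel \<Otimes>\<^sub>M \<rho>) = _\<close> refl] by measurable
  qed
  have int: "integrable (lborel \<Otimes>\<^sub>M \<rho>) (case_prod k)"
  proof (rule integrableI_bounded_set[of "{c..d} \<times> UNIV"])
    show "{c..d} \<times> UNIV \<in> sets (lborel \<Otimes>\<^sub>M \<rho>)" using sets.top[of \<rho>] sp by (intro pair_measureI) auto
    show "case_prod k \<in> borel_measurable (lborel \<Otimes>\<^sub>M \<rho>)" using meas by (simp add: case_prod_beta')
    have "emeasure (lborel \<Otimes>\<^sub>M \<rho>) ({c..d} \<times> UNIV) = emeasure lborel {c..d} * emeasure \<rho> UNIV"
      using sets.top[of \<rho>] sp by (intro emeasure_pair_measure_Times) auto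
    also have "\<dots> < \<infinity>" using cd by (simp add: emeasure_eq_measure ennreal_mult_less_top)
    finally show "emeasure (lborel \<Otimes>\<^sub>M \<rho>) ({c..d} \<times> UNIV) < \<infinity>" .
    show "AE x in lborel \<Otimes>\<^sub>M \<rho>. x \<in> {c..d} \<times> UNIV \<longrightarrow> norm (case_prod k x) \<le> L + (1 + L\<^sup>2) * inverse y"
      using bound by (intro AE_I2) (auto simp: k_def)
    show "AE x in lborel \<Otimes>\<^sub>M \<rho>. x \<notin> {c..d} \<times> UNIV \<longrightarrow> case_prod k x = 0"
      by (intro AE_I2) (auto simp: k_def indicator_def)
  qed
  have inner: "(\<integral>x. k x t \<partial>lborel) = poisson_diff c d y t" for t
  proof -
    have "(\<integral>x. k x t \<partial>lborel) = (1 + t\<^sup>2) * arctan ((d - t) / y) - (1 + t\<^sup>2) * arctan ((c - t) / y)"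
      unfolding k_def
    proof (rule integral_FTC_atLeastAtMost)
      show "continuous_on {c..d} (\<lambda>x. (1 + t\<^sup>2) * (y / (y\<^sup>2 + (x - t)\<^sup>2)))"
        using y by (intro continuous_intros) (auto simp: add_nonneg_eq_0_iff)
      fix x
      show "((\<lambda>x. (1 + t\<^sup>2) * arctan ((x - t) / y)) has_vector_derivative (1 + t\<^sup>2) * (y / (y\<^sup>2 + (x - t)\<^sup>2))) (at x within {c..d})"
        unfolding has_real_derivative_iff_has_vector_derivative[symmetric]
        by (intro DERIV_cmult DERIV_arctan_shift y)
    qed (use cd in simp)
    then show ?thesis by (simp add: poisson_diff_def algebra_simps)
  qed
  have sect: "indicator {c..d} x *\<^sub>R Im (f (Complex x y)) = indicator {c..d} x *\<^sub>R (\<alpha> * y) + (\<integral>t. k x t \<partial>\<rho>)" for x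
  proof -
    have "Im (f (Complex x y)) = \<alpha> * y + (\<integral>t. Im (nev_kernel (Complex x y) t) \<partial>\<rho>)"
      using r uh[of x] integral_Im[OF integrable_nev_kernel[OF sb _ uh[of x]]] by simp
    then show ?thesis unfolding k_def Im_nev_kernel_Complex
      by (cases "x \<in> {c..d}") simp_all
  qed
  have "(LINT x:{c..d}|lborel. Im (f (Complex x y))) = (\<integral>x. indicator {c..d} x *\<^sub>R (\<alpha> * y) + (\<integral>t. k x t \<partial>\<rho>) \<partial>lborel)"
    unfolding set_lebesgue_integral_def sect ..
  also have "\<dots> = (\<integral>x. indicator {c..d} x *\<^sub>R (\<alpha> * y) \<partial>lborel) + (\<integral>x. (\<integral>t. k x t \<partial>\<rho>) \<partial>lborel)"
  proof (rule Bochner_Integration.integral_add)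
    show "integrable lborel (\<lambda>x. indicator {c..d} x *\<^sub>R (\<alpha> * y))"
      using borel_integrable_atLeastAtMost'[of c d "\<lambda>_. \<alpha> * y"] by (simp add: set_integrable_def)
    show "integrable lborel (\<lambda>x. \<integral>t. k x t \<partial>\<rho>)" using P.integrable_fst[OF int] by simp
  qed
  also have "(\<integral>x. indicator {c..d} x *\<^sub>R (\<alpha> * y) \<partial>lborel) = \<alpha> * y * (d - c)" using cd by simp
  also have "(\<integral>x. (\<integral>t. k x t \<partial>\<rho>) \<partial>lborel) = (\<integral>t. (\<integral>x. k x t \<partial>lborel) \<partial>\<rho>)"
    by (rule P.Fubini_integral[OF int, symmetric])
  finally show ?thesis unfolding inner .
qed

text \<open>As the height tends to 0 the arctangents become step functions and the linear term
  disappears; dominated convergence passes to the limit under \<rho>.\<close>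

lemma stieltjes_inversion:
  assumes rep: "nev_rep f \<alpha> \<beta> \<rho>" and cd: "c < d"
  shows "(\<lambda>n. LINT x:{c..d}|lborel. Im (f (Complex x (1 / (real n + 1))))) \<longlonglongrightarrow> pi * (\<integral>t. stieltjes_weight c d t \<partial>\<rho>)"
proof -
  note r = rep[unfolded nev_rep_iff]
  have sb: "sets \<rho> = sets borel" using r by simp
  interpret finite_measure \<rho> using r by simp
  obtain B where B: "\<And>t y. 0 < y \<Longrightarrow> y \<le> 1 \<Longrightarrow> \<bar>poisson_diff c d y t\<bar> \<le> B"
    using poisson_diff_bounded[OF cd] by blast
  have [measurable]: "poisson_diff c d y \<in> borel_measurable \<rho>" for y
    unfolding measurable_cong_sets[OF sb refl] poisson_diff_def divide_inverse
    by (intro borel_measurable_continuous_onI continuous_intros)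
  have [measurable]: "stieltjes_weight c d \<in> borel_measurable \<rho>"
    unfolding measurable_cong_sets[OF sb refl] by measurable
  have "(\<lambda>n. \<integral>t. poisson_diff c d (1 / (real n + 1)) t \<partial>\<rho>) \<longlonglongrightarrow> (\<integral>t. pi * stieltjes_weight c d t \<partial>\<rho>)"
  proof (rule integral_dominated_convergence[where w = "\<lambda>_. B"])
    show "AE t in \<rho>. (\<lambda>n. poisson_diff c d (1 / (real n + 1)) t) \<longlonglongrightarrow> pi * stieltjes_weight c d t"
      by (rule AE_I2) (rule poisson_diff_limit)
    show "\<And>n. AE t in \<rho>. norm (poisson_diff c d (1 / (real n + 1)) t) \<le> B"
      unfolding real_norm_def by (intro AE_I2 B) auto
    show "(\<lambda>t. pi * stieltjes_weight c d t) \<in> borel_measurable \<rho>" by measurable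
    show "\<And>n. poisson_diff c d (1 / (real n + 1)) \<in> borel_measurable \<rho>" by measurable
  qed simp
  moreover have "(\<lambda>n. \<alpha> * (1 / (real n + 1)) * (d - c)) \<longlonglongrightarrow> 0" by real_asymp
  ultimately have "(\<lambda>n. \<alpha> * (1 / (real n + 1)) * (d - c) + (\<integral>t. poisson_diff c d (1 / (real n + 1)) t \<partial>\<rho>)) \<longlonglongrightarrow> 0 + (\<integral>t. pi * stieltjes_weight c d t \<partial>\<rho>)"
    by (intro tendsto_add) auto
  then show ?thesis using integral_strip[OF rep cd] by simp
qed

lemma integrable_stieltjes_weight:
  assumes "sets \<rho> = sets borel" "finite_measure \<rho>" "c < d"
  shows "integrable \<rho> (stieltjes_weight c d)"
proof -
  interpret finite_measure \<rho> by fact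
  show ?thesis
  proof (rule integrable_const_bound)
    show "AE t in \<rho>. norm (stieltjes_weight c d t) \<le> 1 + (\<bar>c\<bar> + \<bar>d\<bar>)\<^sup>2"
      unfolding real_norm_def by (rule AE_I2) (rule stieltjes_weight_bounded[OF assms(3)])
    show "stieltjes_weight c d \<in> borel_measurable \<rho>"
      unfolding measurable_cong_sets[OF assms(1) refl] by measurable
  qed
qed

lemma set_integrable_strip:
  assumes "nevanlinna f" "0 < y"
  shows "set_integrable lborel {c..d} (\<lambda>x. Im (f (Complex x y)))"
proof (rule borel_integrable_atLeastAtMost')
  have cf: "continuous_on upper_half f"
    using assms by (auto simp: nevanlinna_def intro: holomorphic_on_imp_continuous_on)
  have "continuous_on {c..d} (\<lambda>x. f (Complex x y))"
  proof (rule continuous_on_compose2[OF cf])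
    show "continuous_on {c..d} (\<lambda>x. Complex x y)" unfolding Complex_eq by (intro continuous_intros)
  qed (use assms(2) in \<open>auto simp: upper_half_def\<close>)
  then show "continuous_on {c..d} (\<lambda>x. Im (f (Complex x y)))" by (rule continuous_on_Im)
qed

text \<open>If Im f is O(y) over an interval, its integrals at height y tend to 0. By inversion a
  nonnegative weight, positive inside the interval, then has integral zero against \<rho>.\<close>

lemma tame_Fin_imp_null:
  assumes rep: "nev_rep f \<alpha> \<beta> \<rho>" and tame: "tame f (Fin x)"
  shows "\<exists>e>0. emeasure \<rho> {x - e<..<x + e} = 0"
proof -
  note r = rep[unfolded nev_rep_iff]
  have sb: "sets \<rho> = sets borel" using r by simp
  note nf = nev_rep_imp_nevanlinna[OF rep]
  from tame obtain C e where e: "0 < e"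
    and C: "\<And>z. z \<in> upper_half \<Longrightarrow> cmod (z - complex_of_real x) < e \<Longrightarrow> Im (f z) \<le> C * boundary_weight z"
    unfolding tame_def eventually_approach_Fin by blast
  \<comment> \<open>Half of e in the horizontal direction and less than half in the vertical one
    keep the points inside the disc of radius e.\<close>
  define c d where "c = x - e / 2" and "d = x + e / 2"
  have cd: "c < d" using e by (simp add: c_def d_def)
  have le: "Im (f (Complex x' y)) \<le> \<bar>C\<bar> * y" if x': "x' \<in> {c..d}" and y: "0 < y" "y < e / 2" for x' y
  proof -
    have u: "Complex x' y \<in> upper_half" using y by (simp add: upper_half_def)
    have "cmod (Complex x' y - complex_of_real x) \<le> \<bar>x' - x\<bar> + \<bar>y\<bar>"
      using cmod_le[of "Complex x' y - complex_of_real x"] by simp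
    also have "\<dots> < e" using x' y by (auto simp: c_def d_def)
    finally have "Im (f (Complex x' y)) \<le> C * (y / (1 + (cmod (Complex x' y))\<^sup>2))" using C[OF u] by simp
    also have "\<dots> \<le> \<bar>C\<bar> * (y / 1)"
    proof (rule mult_mono)
      show "y / (1 + (cmod (Complex x' y))\<^sup>2) \<le> y / 1" using y by (intro divide_left_mono) (auto intro: add_pos_nonneg)
    qed (use y in auto)
    finally show ?thesis by simp
  qed
  have up: "(LINT x':{c..d}|lborel. Im (f (Complex x' y))) \<le> \<bar>C\<bar> * y * (d - c)" if y: "0 < y" "y < e / 2" for y
  proof -
    have "(LINT x':{c..d}|lborel. Im (f (Complex x' y))) \<le> (LINT x':{c..d}|lborel. \<bar>C\<bar> * y)"
    proof (rule set_integral_mono)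
      show "set_integrable lborel {c..d} (\<lambda>x'. \<bar>C\<bar> * y)"
        by (intro borel_integrable_atLeastAtMost' continuous_intros)
    qed (use set_integrable_strip[OF nf y(1)] le y in auto)
    then show ?thesis using cd by (simp add: set_lebesgue_integral_def mult_ac)
  qed
  have "pi * (\<integral>t. stieltjes_weight c d t \<partial>\<rho>) \<le> 0"
  proof (rule LIMSEQ_le[OF stieltjes_inversion[OF rep cd]])
    show "(\<lambda>n. \<bar>C\<bar> * (1 / (real n + 1)) * (d - c)) \<longlonglongrightarrow> 0" by real_asymp
    have "(\<lambda>n. 1 / (real n + 1)) \<longlonglongrightarrow> 0" by real_asymp
    then have "eventually (\<lambda>n. 1 / (real n + 1) < e / 2) sequentially" using e by (intro order_tendstoD) auto
    then obtain N where "\<And>n. n \<ge> N \<Longrightarrow> 1 / (real n + 1) < e / 2" by (auto simp: eventually_sequentially)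
    then show "\<exists>N. \<forall>n\<ge>N. (LINT x:{c..d}|lborel. Im (f (Complex x (1 / (real n + 1))))) \<le> \<bar>C\<bar> * (1 / (real n + 1)) * (d - c)"
      by (intro exI[of _ N] allI impI up) auto
  qed
  then have "(\<integral>t. stieltjes_weight c d t \<partial>\<rho>) \<le> 0" by (simp add: mult_le_0_iff) (use pi_gt_zero in linarith)
  moreover have nn: "AE t in \<rho>. 0 \<le> stieltjes_weight c d t" using stieltjes_weight_nonneg[OF cd] by simp
  ultimately have "(\<integral>t. stieltjes_weight c d t \<partial>\<rho>) = 0" using integral_nonneg_AE[OF nn] by linarith
  then have "AE t in \<rho>. stieltjes_weight c d t = 0"
    using integral_nonneg_eq_0_iff_AE[OF integrable_stieltjes_weight[OF sb _ cd] nn] r by blast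
  moreover have "stieltjes_weight c d t \<noteq> 0" if "c < t" "t < d" for t
  proof -
    have "stieltjes_weight c d t = 1 + t\<^sup>2" using that by (simp add: stieltjes_weight_def)
    moreover have "0 < 1 + t\<^sup>2" by (intro add_pos_nonneg) auto
    ultimately show ?thesis by simp
  qed
  ultimately have "AE t in \<rho>. t \<notin> {c<..<d}" by (auto elim!: eventually_mono)
  then have "emeasure \<rho> {c<..<d} = 0"
    using sb AE_iff_null_sets[of "{c<..<d}" \<rho>] by auto
  then show ?thesis using e by (intro exI[of _ "e / 2"]) (auto simp: c_def d_def)
qed

text \<open>Undoes the factor 1 / (1 + t^2) contained in the representing measures, so that
  complementary ones can be compared with \<open>lborel\<close> itself.\<close>

definition poisson_weight :: "real \<Rightarrow> ennreal" where
  "poisson_weight t = ennreal (1 + t\<^sup>2)"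

lemma measurable_poisson_weight [measurable]: "poisson_weight \<in> borel_measurable borel"
  unfolding poisson_weight_def by measurable

text \<open>Packages the sum as a measure, so that it can be identified with \<open>lborel\<close>
  by its values on intervals.\<close>

lemma sum_of_measures:
  assumes "sets M = sets N"
  shows "\<exists>S. sets S = sets M \<and> (\<forall>A\<in>sets M. emeasure S A = emeasure M A + emeasure N A)"
proof -
  define S where "S = measure_of (space M) (sets M) (\<lambda>A. emeasure M A + emeasure N A)"
  have "emeasure S A = emeasure M A + emeasure N A" if "A \<in> sets M" for A
    unfolding S_def
  proof (rule emeasure_measure_of_sigma)
    show "countably_additive (sets M) (\<lambda>A. emeasure M A + emeasure N A)"
    proof (rule countably_additiveI)
      fix A :: "nat \<Rightarrow> _" assume A: "range A \<subseteq> sets M" "disjoint_family A" "(\<Union>i. A i) \<in> sets M"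
      have "(\<Sum>i. emeasure M (A i) + emeasure N (A i)) = (\<Sum>i. emeasure M (A i)) + (\<Sum>i. emeasure N (A i))"
        by (rule suminf_add[symmetric]) auto
      then show "(\<Sum>i. emeasure M (A i) + emeasure N (A i)) = emeasure M (\<Union>i. A i) + emeasure N (\<Union>i. A i)"
        using suminf_emeasure[of A M] suminf_emeasure[of A N] A assms by simp
    qed
  qed (use that in \<open>auto simp: positive_def sets.sigma_algebra_axioms\<close>)
  moreover have "sets S = sets M" unfolding S_def by (rule sets.sets_measure_of_eq)
  ultimately show ?thesis by blast
qed

lemma integral_poisson_weight_Ioo:
  assumes "sets \<rho> = sets borel" "finite_measure \<rho>"
  shows "emeasure (density \<rho> poisson_weight) {c<..<d} = ennreal (\<integral>t. (1 + t\<^sup>2) * indicator {c<..<d} t \<partial>\<rho>)"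
    "integrable \<rho> (\<lambda>t. (1 + t\<^sup>2) * indicator {c<..<d} t)"
proof -
  interpret finite_measure \<rho> by fact
  show int: "integrable \<rho> (\<lambda>t. (1 + t\<^sup>2) * indicator {c<..<d} t)"
  proof (rule integrable_const_bound)
    have "\<bar>(1 + t\<^sup>2) * indicator {c<..<d} t\<bar> \<le> 1 + (\<bar>c\<bar> + \<bar>d\<bar>)\<^sup>2" for t
    proof (cases "c < t \<and> t < d")
      case True
      then have "\<bar>t\<bar> \<le> \<bar>\<bar>c\<bar> + \<bar>d\<bar>\<bar>" by auto
      then have "t\<^sup>2 \<le> (\<bar>c\<bar> + \<bar>d\<bar>)\<^sup>2" by (simp only: abs_le_square_iff)
      then show ?thesis using True by simp
    qed (auto simp: indicator_def)
    then show "AE t in \<rho>. norm ((1 + t\<^sup>2) * indicator {c<..<d} t) \<le> 1 + (\<bar>c\<bar> + \<bar>d\<bar>)\<^sup>2" by simp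
    show "(\<lambda>t. (1 + t\<^sup>2) * indicator {c<..<d} t) \<in> borel_measurable \<rho>"
      unfolding measurable_cong_sets[OF assms(1) refl] by measurable
  qed
  have [measurable]: "poisson_weight \<in> borel_measurable \<rho>"
    unfolding measurable_cong_sets[OF assms(1) refl] by measurable
  have "emeasure (density \<rho> poisson_weight) {c<..<d} = (\<integral>\<^sup>+t. poisson_weight t * indicator {c<..<d} t \<partial>\<rho>)"
    using assms(1) by (intro emeasure_density) auto
  also have "\<dots> = (\<integral>\<^sup>+t. ennreal ((1 + t\<^sup>2) * indicator {c<..<d} t) \<partial>\<rho>)"
    by (intro nn_integral_cong) (auto simp: poisson_weight_def indicator_def)
  also have "\<dots> = ennreal (\<integral>t. (1 + t\<^sup>2) * indicator {c<..<d} t \<partial>\<rho>)"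
    using int by (intro nn_integral_eq_integral) auto
  finally show "emeasure (density \<rho> poisson_weight) {c<..<d} = ennreal (\<integral>t. (1 + t\<^sup>2) * indicator {c<..<d} t \<partial>\<rho>)" .
qed

text \<open>The shift by 3 keeps the gap at most a third of the length, so removing it at both ends
  leaves a nondegenerate interval for every n.\<close>

lemma shrinking_gap:
  fixes c d :: real
  assumes "c < d"
  shows "0 < (d - c) / (real n + 3)" "3 * ((d - c) / (real n + 3)) \<le> d - c"
proof -
  show "0 < (d - c) / (real n + 3)" using assms by (intro divide_pos_pos) auto
  have "(d - c) / (real n + 3) \<le> (d - c) / 3" using assms by (intro divide_left_mono) auto
  moreover have "3 * X \<le> d - c" if "X \<le> (d - c) / 3" for X using that by simp
  ultimately show "3 * ((d - c) / (real n + 3)) \<le> d - c" by blast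
qed

text \<open>Approaching (c, d) from inside removes the half weights at the endpoints: in the limit
  an endpoint gets weight 0 and the open interval its full weight.\<close>

abbreviation shrunk_weight :: "real \<Rightarrow> real \<Rightarrow> nat \<Rightarrow> real \<Rightarrow> real" where
  "shrunk_weight c d n \<equiv> stieltjes_weight (c + (d - c) / (real n + 3)) (d - (d - c) / (real n + 3))"

lemma stieltjes_weight_Ioo_limit:
  assumes "c < d"
  shows "(\<lambda>n. shrunk_weight c d n t) \<longlonglongrightarrow> (1 + t\<^sup>2) * indicator {c<..<d} t"
proof (rule tendsto_eventually)
  have lim: "(\<lambda>n. c + (d - c) / (real n + 3)) \<longlonglongrightarrow> c" "(\<lambda>n. d - (d - c) / (real n + 3)) \<longlonglongrightarrow> d" by real_asymp+
  show "\<forall>\<^sub>F n in sequentially. shrunk_weight c d n t = (1 + t\<^sup>2) * indicator {c<..<d} t"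
  proof (cases "c < t \<and> t < d")
    case True
    have "eventually (\<lambda>n. c + (d - c) / (real n + 3) < t) sequentially"
      by (rule order_tendstoD(2)[OF lim(1)]) (use True in simp)
    moreover have "eventually (\<lambda>n. d - (d - c) / (real n + 3) > t) sequentially"
      by (rule order_tendstoD(1)[OF lim(2)]) (use True in simp)
    ultimately show ?thesis
      by eventually_elim (use True in \<open>simp add: stieltjes_weight_def\<close>)
  next
    case False
    have "shrunk_weight c d n t = 0" for n
    proof -
      define \<delta> where "\<delta> = (d - c) / (real n + 3)"
      have \<delta>: "0 < \<delta>" "3 * \<delta> \<le> d - c" unfolding \<delta>_def by (rule shrinking_gap[OF assms])+
      then have "sgn (d - \<delta> - t) = sgn (c + \<delta> - t)" using False by (auto simp: sgn_if)
      then show ?thesis by (simp add: stieltjes_weight_def \<delta>_def)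
    qed
    then show ?thesis using False by (auto simp: indicator_def)
  qed
qed

text \<open>Inversion applied to h and h' turns the constant sum pi of the imaginary parts into the
  length of the interval. Possible atoms at the endpoints are avoided by exhausting the open
  interval from inside.\<close>

lemma complementary_measures:
  assumes rep: "nev_rep h \<alpha> \<beta> \<mu>" and rep': "nev_rep h' \<alpha>' \<beta>' \<mu>'"
    and sum: "\<And>z. z \<in> upper_half \<Longrightarrow> Im (h z) + Im (h' z) = pi"
    and A: "A \<in> sets borel"
  shows "emeasure (density \<mu> poisson_weight) A + emeasure (density \<mu>' poisson_weight) A = emeasure lborel A"
proof -
  note r = rep[unfolded nev_rep_iff] and r' = rep'[unfolded nev_rep_iff]
  have sb: "sets \<mu> = sets borel" "sets \<mu>' = sets borel" and fin: "finite_measure \<mu>" "finite_measure \<mu>'" using r r' by auto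
  have W: "(\<integral>t. stieltjes_weight c d t \<partial>\<mu>) + (\<integral>t. stieltjes_weight c d t \<partial>\<mu>') = d - c" if cd: "c < d" for c d
  proof -
    have eq: "(LINT x:{c..d}|lborel. Im (h (Complex x (1 / (real n + 1))))) + (LINT x:{c..d}|lborel. Im (h' (Complex x (1 / (real n + 1))))) = pi * (d - c)" for n
    proof -
      have "(LINT x:{c..d}|lborel. Im (h (Complex x (1 / (real n + 1))))) + (LINT x:{c..d}|lborel. Im (h' (Complex x (1 / (real n + 1)))))
         = (LINT x:{c..d}|lborel. Im (h (Complex x (1 / (real n + 1)))) + Im (h' (Complex x (1 / (real n + 1)))))"
        by (rule set_integral_add(2)[symmetric]) (auto intro!: set_integrable_strip nev_rep_imp_nevanlinna[OF rep] nev_rep_imp_nevanlinna[OF rep'])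
      also have "\<dots> = (LINT x:{c..d}|lborel. pi)"
        using sum by (simp add: upper_half_def)
      also have "\<dots> = pi * (d - c)" using cd by (simp add: set_lebesgue_integral_def)
      finally show ?thesis .
    qed
    have "(\<lambda>n::nat. pi * (d - c)) \<longlonglongrightarrow> pi * (\<integral>t. stieltjes_weight c d t \<partial>\<mu>) + pi * (\<integral>t. stieltjes_weight c d t \<partial>\<mu>')"
      using tendsto_add[OF stieltjes_inversion[OF rep cd] stieltjes_inversion[OF rep' cd]] unfolding eq .
    then have "pi * (d - c) = pi * (\<integral>t. stieltjes_weight c d t \<partial>\<mu>) + pi * (\<integral>t. stieltjes_weight c d t \<partial>\<mu>')"
      by (simp add: LIMSEQ_const_iff)
    then have "pi * ((\<integral>t. stieltjes_weight c d t \<partial>\<mu>) + (\<integral>t. stieltjes_weight c d t \<partial>\<mu>')) = pi * (d - c)"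
      by (simp add: algebra_simps)
    then show ?thesis by simp
  qed
  have lim: "(\<lambda>n. \<integral>t. shrunk_weight c d n t \<partial>\<rho>) \<longlonglongrightarrow> (\<integral>t. (1 + t\<^sup>2) * indicator {c<..<d} t \<partial>\<rho>)"
    if cd: "c < d" and \<rho>: "sets \<rho> = sets borel" "finite_measure \<rho>" for c d \<rho>
  proof -
    interpret finite_measure \<rho> by fact
    \<comment> \<open>Both shrunk endpoints lie between c and d, so each has modulus at most
      \<open>\<bar>c\<bar> + \<bar>d\<bar>\<close>; this gives one bound for all n.\<close>
    define B where "B = 1 + (2 * (\<bar>c\<bar> + \<bar>d\<bar>))\<^sup>2"
    have between: "c \<le> c + (d - c) / (real n + 3)" "c + (d - c) / (real n + 3) < d - (d - c) / (real n + 3)" "d - (d - c) / (real n + 3) \<le> d" for n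
      using shrinking_gap[OF cd, of n] by linarith+
    have bnd: "\<bar>shrunk_weight c d n t\<bar> \<le> B" for n t
    proof -
      have "\<bar>c + (d - c) / (real n + 3)\<bar> + \<bar>d - (d - c) / (real n + 3)\<bar> \<le> 2 * (\<bar>c\<bar> + \<bar>d\<bar>)"
      proof -
        have "\<bar>p\<bar> + \<bar>q\<bar> \<le> 2 * (\<bar>c\<bar> + \<bar>d\<bar>)" if "c \<le> p" "p < q" "q \<le> d" for p q
        proof -
          have "\<bar>u\<bar> \<le> \<bar>c\<bar> + \<bar>d\<bar>" if "c \<le> u" "u \<le> d" for u using that by arith
          from this[of p] this[of q] show ?thesis using that unfolding distrib_left by linarith
        qed
        then show ?thesis using between[of n] by blast
      qed
      then have "(\<bar>c + (d - c) / (real n + 3)\<bar> + \<bar>d - (d - c) / (real n + 3)\<bar>)\<^sup>2 \<le> (2 * (\<bar>c\<bar> + \<bar>d\<bar>))\<^sup>2"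
        by (intro power_mono) auto
      then show ?thesis using stieltjes_weight_bounded[OF between(2), of n t] unfolding B_def by linarith
    qed
    show ?thesis
    proof (rule integral_dominated_convergence[where w = "\<lambda>_. B"])
      show "(\<lambda>t. (1 + t\<^sup>2) * indicator {c<..<d} t) \<in> borel_measurable \<rho>"
        "\<And>n. shrunk_weight c d n \<in> borel_measurable \<rho>"
        unfolding measurable_cong_sets[OF \<rho>(1) refl] by measurable
      show "AE t in \<rho>. (\<lambda>n. shrunk_weight c d n t) \<longlonglongrightarrow> (1 + t\<^sup>2) * indicator {c<..<d} t"
        by (rule AE_I2) (rule stieltjes_weight_Ioo_limit[OF cd])
      show "\<And>n. AE t in \<rho>. norm (shrunk_weight c d n t) \<le> B"
        unfolding real_norm_def by (rule AE_I2) (rule bnd)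
    qed simp
  qed
  obtain S where S: "sets S = sets (density \<mu> poisson_weight)"
    and emS: "\<And>A. A \<in> sets (density \<mu> poisson_weight) \<Longrightarrow> emeasure S A = emeasure (density \<mu> poisson_weight) A + emeasure (density \<mu>' poisson_weight) A"
    using sum_of_measures[of "density \<mu> poisson_weight" "density \<mu>' poisson_weight"] sb by auto
  \<comment> \<open>Lebesgue measure is characterised by its values on boxes, which are open
    intervals in dimension one.\<close>
  have "lborel = S"
  proof (rule lborel_eqI)
    fix c d :: real assume "\<And>b. b \<in> Basis \<Longrightarrow> c \<bullet> b \<le> d \<bullet> b"
    then have "c \<le> d" by simp
    have "emeasure S {c<..<d} = ennreal (d - c)"
    proof (cases "c < d")
      case True
      have "emeasure S {c<..<d} = emeasure (density \<mu> poisson_weight) {c<..<d} + emeasure (density \<mu>' poisson_weight) {c<..<d}"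
        using sb by (intro emS) auto
      also have "\<dots> = ennreal ((\<integral>t. (1 + t\<^sup>2) * indicator {c<..<d} t \<partial>\<mu>) + (\<integral>t. (1 + t\<^sup>2) * indicator {c<..<d} t \<partial>\<mu>'))"
        unfolding integral_poisson_weight_Ioo(1)[OF sb(1) fin(1)] integral_poisson_weight_Ioo(1)[OF sb(2) fin(2)]
        by (rule ennreal_plus[symmetric]) (auto intro!: integral_nonneg_AE)
      also have "(\<integral>t. (1 + t\<^sup>2) * indicator {c<..<d} t \<partial>\<mu>) + (\<integral>t. (1 + t\<^sup>2) * indicator {c<..<d} t \<partial>\<mu>') = d - c"
      proof (rule LIMSEQ_unique)
        show "(\<lambda>n. (\<integral>t. shrunk_weight c d n t \<partial>\<mu>) + (\<integral>t. shrunk_weight c d n t \<partial>\<mu>')) \<longlonglongrightarrow> (\<integral>t. (1 + t\<^sup>2) * indicator {c<..<d} t \<partial>\<mu>) + (\<integral>t. (1 + t\<^sup>2) * indicator {c<..<d} t \<partial>\<mu>')"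
          by (intro tendsto_add lim True sb fin)
        have "c + (d - c) / (real n + 3) < d - (d - c) / (real n + 3)" for n
          using shrinking_gap[OF True, of n] by linarith
        then have eq: "(\<integral>t. shrunk_weight c d n t \<partial>\<mu>) + (\<integral>t. shrunk_weight c d n t \<partial>\<mu>') = (d - (d - c) / (real n + 3)) - (c + (d - c) / (real n + 3))" for n
          by (rule W)
        show "(\<lambda>n. (\<integral>t. shrunk_weight c d n t \<partial>\<mu>) + (\<integral>t. shrunk_weight c d n t \<partial>\<mu>')) \<longlonglongrightarrow> d - c"
          unfolding eq by real_asymp
      qed
      finally show ?thesis .
    next
      case False
      then show ?thesis using \<open>c \<le> d\<close> by simp
    qed
    then show "emeasure S (box c d) = (\<Prod>b\<in>Basis. (d - c) \<bullet> b)"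
      by (simp add: box_real)
  qed (use S sb in simp)
  then show ?thesis using emS[of A] A sb by simp
qed

section \<open>Krein products as exponentials\<close>

text \<open>The integrand of the Nevanlinna representation when the measure is dt / (1 +
  t^2).\<close>

definition arg_density :: "complex \<Rightarrow> real \<Rightarrow> complex" where
  "arg_density z t = nev_kernel z t / complex_of_real (1 + t\<^sup>2)"

text \<open>The exponential of the function represented by dt / (1 + t^2) restricted to
  \<open>S\<close>, with zero constants; for an arc it turns out to be the factor p_J.\<close>

definition arc_exp :: "real set \<Rightarrow> complex \<Rightarrow> complex" where
  "arc_exp S z = exp (LINT t:S|lborel. arg_density z t)"

lemma one_plus_square_pos: "0 < 1 + (t::real)\<^sup>2"
  by (intro add_pos_nonneg) auto

text \<open>In this form an antiderivative in t is visible: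
  \<open>Ln (z - t) - ln (1 + t\<^sup>2) / 2\<close>.\<close>

lemma arg_density_alt:
  assumes "z \<in> upper_half"
  shows "arg_density z t = - inverse (z - complex_of_real t) - complex_of_real (t / (1 + t\<^sup>2))"
proof -
  have nz: "complex_of_real t - z \<noteq> 0" by (rule upper_half_ne[OF assms])
  have nz': "complex_of_real (1 + t\<^sup>2) \<noteq> 0" using one_plus_square_pos[of t] unfolding of_real_eq_0_iff by linarith
  have "nev_kernel z t = complex_of_real (1 + t\<^sup>2) * inverse (complex_of_real t - z) - complex_of_real t"
    unfolding nev_kernel_alt_infty[OF nz] by simp
  then have "arg_density z t = (complex_of_real (1 + t\<^sup>2) * inverse (complex_of_real t - z)) / complex_of_real (1 + t\<^sup>2) - complex_of_real t / complex_of_real (1 + t\<^sup>2)"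
    unfolding arg_density_def by (simp only: diff_divide_distrib)
  also have "(complex_of_real (1 + t\<^sup>2) * inverse (complex_of_real t - z)) / complex_of_real (1 + t\<^sup>2) = inverse (complex_of_real t - z)"
    using nz' by (rule nonzero_mult_div_cancel_left)
  also have "inverse (complex_of_real t - z) = - inverse (z - complex_of_real t)"
    by (metis inverse_minus_eq minus_diff_eq)
  finally show ?thesis by (simp only: of_real_divide)
qed

lemma measurable_arg_density [measurable]: "arg_density z \<in> borel_measurable borel"
  unfolding arg_density_def by measurable

lemma integrable_arg_density:
  assumes "z \<in> upper_half"
  shows "integrable lborel (arg_density z)"
proof (rule Bochner_Integration.integrable_bound)
  let ?B = "cmod z + cmod (1 + z\<^sup>2) * inverse (Im z)"
  have "einterval (-\<infinity>) \<infinity> = UNIV" by (auto simp: einterval_def)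
  then show "integrable lborel (\<lambda>t. ?B * inverse (1 + t\<^sup>2))"
    using integrable_inverse_1_plus_square by (simp add: set_integrable_def)
  show "AE t in lborel. norm (arg_density z t) \<le> norm (?B * inverse (1 + t\<^sup>2))"
  proof (rule AE_I2)
    fix t :: real
    have "norm (arg_density z t) = cmod (nev_kernel z t) * inverse (1 + t\<^sup>2)"
      unfolding arg_density_def norm_divide norm_of_real using one_plus_square_pos[of t] by (simp add: divide_inverse)
    also have "\<dots> \<le> ?B * inverse (1 + t\<^sup>2)"
      using one_plus_square_pos[of t] by (intro mult_right_mono norm_nev_kernel_le assms) auto
    also have "\<dots> \<le> norm (?B * inverse (1 + t\<^sup>2))" by simp
    finally show "norm (arg_density z t) \<le> norm (?B * inverse (1 + t\<^sup>2))" .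
  qed
qed measurable

lemma set_integrable_arg_density:
  "z \<in> upper_half \<Longrightarrow> S \<in> sets borel \<Longrightarrow> set_integrable lborel S (arg_density z)"
  using integrable_arg_density[of z] unfolding set_integrable_def
  by (intro integrable_mult_indicator) auto

lemma arc_exp_Un:
  assumes "z \<in> upper_half" "S \<in> sets borel" "T \<in> sets borel" "S \<inter> T = {}"
  shows "arc_exp (S \<union> T) z = arc_exp S z * arc_exp T z"
  unfolding arc_exp_def using assms
  by (subst set_integral_Un) (auto simp: exp_add set_integrable_arg_density)

lemma cmod_i_minus: "cmod (\<i> - complex_of_real a) = sqrt (1 + a\<^sup>2)"
  by (simp add: cmod_def add.commute)

text \<open>The fundamental theorem of calculus applies because z - t stays in the upper half-plane,
  off the cut of \<open>Ln\<close>. The real logarithm in the antiderivative produces the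
  normalising moduli, since |i - t| is the square root of 1 + t^2.\<close>

lemma arc_exp_Ioo:
  assumes z: "z \<in> upper_half" and ab: "a < b"
  shows "arc_exp {a<..<b} z = complex_of_real (cmod (\<i> - complex_of_real a) / cmod (\<i> - complex_of_real b)) *
             ((z - complex_of_real b) / (z - complex_of_real a))"
proof -
  have nz: "z - complex_of_real t \<noteq> 0" for t using upper_half_ne[OF z, of t] by (metis eq_iff_diff_eq_0)
  have np: "z - complex_of_real t \<notin> \<real>\<^sub>\<le>\<^sub>0" for t
    using z by (auto simp: upper_half_def complex_nonpos_Reals_iff)
  define E where "E t = Ln (z - complex_of_real t) - complex_of_real (ln (1 + t\<^sup>2) / 2)" for t
  have "(LINT t:{a<..<b}|lborel. arg_density z t) = (\<integral>t. indicator {a..b} t *\<^sub>R arg_density z t \<partial>lborel)"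
    unfolding set_lebesgue_integral_def
  proof (rule integral_cong_AE)
    show "AE x in lborel. indicator {a<..<b} x *\<^sub>R arg_density z x = indicator {a..b} x *\<^sub>R arg_density z x"
      using AE_lborel_singleton[of a] AE_lborel_singleton[of b]
      by eventually_elim (auto simp: indicator_def)
  qed measurable
  also have "\<dots> = E b - E a"
  proof (rule integral_FTC_atLeastAtMost)
    show "a \<le> b" using ab by simp
    show "continuous_on {a..b} (arg_density z)"
    proof -
      have "continuous_on {a..b} (\<lambda>t. - inverse (z - complex_of_real t) - complex_of_real (t / (1 + t\<^sup>2)))"
        using nz one_plus_square_pos by (intro continuous_intros) (auto simp: less_le)
      then show ?thesis unfolding arg_density_alt[OF z] .
    qed
    fix t :: real
    have "((\<lambda>w. Ln (z - w)) has_field_derivative (- inverse (z - complex_of_real t))) (at (complex_of_real t))"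
      using np[of t] by (auto intro!: derivative_eq_intros simp: divide_inverse)
    then have 1: "((\<lambda>t. Ln (z - complex_of_real t)) has_vector_derivative (- inverse (z - complex_of_real t))) (at t within {a..b})"
      by (rule has_vector_derivative_at_within[OF has_vector_derivative_real_field])
    have "((\<lambda>t. ln (1 + t\<^sup>2) / 2) has_real_derivative t / (1 + t\<^sup>2)) (at t)"
    proof -
      have "((\<lambda>t. ln (1 + t\<^sup>2)) has_real_derivative 2 * t / (1 + t\<^sup>2)) (at t)"
        using one_plus_square_pos[of t] by (auto intro!: derivative_eq_intros)
      from DERIV_cdivide[OF this, of 2] have "((\<lambda>t. ln (1 + t\<^sup>2) / 2) has_real_derivative 2 * t / (1 + t\<^sup>2) / 2) (at t)" .
      moreover have "2 * u / v / 2 = u / v" for u v :: real by simp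
      ultimately show ?thesis by (simp only:)
    qed
    then have 2: "((\<lambda>t. complex_of_real (ln (1 + t\<^sup>2) / 2)) has_vector_derivative complex_of_real (t / (1 + t\<^sup>2))) (at t within {a..b})"
      by (intro has_vector_derivative_at_within[OF has_vector_derivative_of_real])
         (simp add: has_real_derivative_iff_has_vector_derivative)
    show "(E has_vector_derivative arg_density z t) (at t within {a..b})"
      unfolding E_def arg_density_alt[OF z] by (rule has_vector_derivative_diff[OF 1 2])
  qed
  finally have "arc_exp {a<..<b} z = exp (E b) / exp (E a)"
    unfolding arc_exp_def by (simp only: exp_diff)
  moreover have "exp (E t) = (z - complex_of_real t) / complex_of_real (cmod (\<i> - complex_of_real t))" for t
  proof -
    have "exp (ln (1 + t\<^sup>2) / 2) = sqrt (1 + t\<^sup>2)"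
      using one_plus_square_pos[of t] by (simp add: ln_sqrt[symmetric] real_sqrt_gt_zero)
    then show ?thesis unfolding E_def exp_diff exp_of_real using nz[of t] by (simp add: cmod_i_minus)
  qed
  ultimately show ?thesis by (simp add: field_simps)
qed

text \<open>The contribution of an endpoint that moves to infinity: 1 on the left and -1 on the
  right, whence the minus sign in \<open>p_int\<close> for rays to the right.\<close>

lemma far_ratio_limit:
  "(\<lambda>n. (z - complex_of_real (- real n)) / complex_of_real (cmod (\<i> - complex_of_real (- real n)))) \<longlonglongrightarrow> 1"
  "(\<lambda>n. (z - complex_of_real (real n)) / complex_of_real (cmod (\<i> - complex_of_real (real n)))) \<longlonglongrightarrow> - 1"
proof -
  have A: "(\<lambda>n. complex_of_real (1 / sqrt (1 + (real n)\<^sup>2))) \<longlonglongrightarrow> complex_of_real 0"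
    by (rule tendsto_of_real) real_asymp
  have B: "(\<lambda>n. complex_of_real (real n / sqrt (1 + (real n)\<^sup>2))) \<longlonglongrightarrow> complex_of_real 1"
    by (rule tendsto_of_real) real_asymp
  have "(\<lambda>n. z * complex_of_real (1 / sqrt (1 + (real n)\<^sup>2)) + complex_of_real (real n / sqrt (1 + (real n)\<^sup>2))) \<longlonglongrightarrow> z * complex_of_real 0 + complex_of_real 1"
    by (intro tendsto_intros A B)
  then show "(\<lambda>n. (z - complex_of_real (- real n)) / complex_of_real (cmod (\<i> - complex_of_real (- real n)))) \<longlonglongrightarrow> 1"
    unfolding cmod_i_minus by (simp add: add_divide_distrib)
  have "(\<lambda>n. z * complex_of_real (1 / sqrt (1 + (real n)\<^sup>2)) - complex_of_real (real n / sqrt (1 + (real n)\<^sup>2))) \<longlonglongrightarrow> z * complex_of_real 0 - complex_of_real 1"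
    by (intro tendsto_intros A B)
  then show "(\<lambda>n. (z - complex_of_real (real n)) / complex_of_real (cmod (\<i> - complex_of_real (real n)))) \<longlonglongrightarrow> - 1"
    unfolding cmod_i_minus by (simp add: diff_divide_distrib)
qed

text \<open>Rays are exhausted by bounded intervals, so their factors arise as limits of the
  interval formula.\<close>

lemma arc_exp_cont_up:
  assumes "z \<in> upper_half" "\<And>n. A n \<in> sets borel" "incseq A"
  shows "(\<lambda>n. arc_exp (A n) z) \<longlonglongrightarrow> arc_exp (\<Union>n. A n) z"
  unfolding arc_exp_def
  by (intro tendsto_exp set_integral_cont_up set_integrable_arg_density) (use assms in auto)

lemma arc_exp_lessThan:
  assumes z: "z \<in> upper_half"
  shows "arc_exp {..<a} z = (z - complex_of_real a) / complex_of_real (cmod (\<i> - complex_of_real a))"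
proof -
  define A where "A n = {- real n<..<a}" for n
  have "incseq A" by (auto simp: A_def incseq_def)
  have lim: "(\<lambda>n. arc_exp (A n) z) \<longlonglongrightarrow> arc_exp (\<Union>n. A n) z"
    by (rule arc_exp_cont_up[OF z _ \<open>incseq A\<close>]) (simp add: A_def)
  have UA: "(\<Union>n. A n) = {..<a}"
  proof (intro equalityI subsetI)
    fix t assume t: "t \<in> {..<a}"
    obtain n where "- t < real n" using reals_Archimedean2 by blast
    then show "t \<in> (\<Union>n. A n)" using t by (auto simp: A_def intro!: exI[of _ n])
  qed (auto simp: A_def)
  have nz: "z - complex_of_real t \<noteq> 0" for t using upper_half_ne[OF z, of t] by (metis eq_iff_diff_eq_0)
  have cnz: "complex_of_real (cmod (\<i> - complex_of_real t)) \<noteq> 0" for t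
    unfolding cmod_i_minus using one_plus_square_pos[of t] by simp
  obtain N where N: "- a < real N" using reals_Archimedean2 by blast
  have "(\<lambda>n. ((z - complex_of_real a) / complex_of_real (cmod (\<i> - complex_of_real a))) /
      ((z - complex_of_real (- real n)) / complex_of_real (cmod (\<i> - complex_of_real (- real n)))))
    \<longlonglongrightarrow> ((z - complex_of_real a) / complex_of_real (cmod (\<i> - complex_of_real a))) / 1"
    by (intro tendsto_divide tendsto_const far_ratio_limit) auto
  moreover have "eventually (\<lambda>n. ((z - complex_of_real a) / complex_of_real (cmod (\<i> - complex_of_real a))) /
      ((z - complex_of_real (- real n)) / complex_of_real (cmod (\<i> - complex_of_real (- real n)))) = arc_exp (A n) z) sequentially"
  proof (rule eventually_sequentiallyI)
    fix n assume "N \<le> n"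
    then have n: "- real n < a" using N by linarith
    show "((z - complex_of_real a) / complex_of_real (cmod (\<i> - complex_of_real a))) /
      ((z - complex_of_real (- real n)) / complex_of_real (cmod (\<i> - complex_of_real (- real n)))) = arc_exp (A n) z"
      unfolding A_def arc_exp_Ioo[OF z n] of_real_divide
      using nz cnz by (simp only: divide_divide_eq_left divide_divide_eq_right times_divide_eq_left times_divide_eq_right mult.commute)
  qed
  ultimately have "(\<lambda>n. arc_exp (A n) z) \<longlonglongrightarrow> (z - complex_of_real a) / complex_of_real (cmod (\<i> - complex_of_real a))"
    using tendsto_cong by force
  with lim show ?thesis unfolding UA using LIMSEQ_unique by blast
qed

lemma arc_exp_greaterThan:
  assumes z: "z \<in> upper_half"
  shows "arc_exp {a<..} z = - complex_of_real (cmod (\<i> - complex_of_real a)) / (z - complex_of_real a)"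
proof -
  define A where "A n = {a<..<real n}" for n
  have "incseq A" by (auto simp: A_def incseq_def)
  have lim: "(\<lambda>n. arc_exp (A n) z) \<longlonglongrightarrow> arc_exp (\<Union>n. A n) z"
    by (rule arc_exp_cont_up[OF z _ \<open>incseq A\<close>]) (simp add: A_def)
  have UA: "(\<Union>n. A n) = {a<..}"
  proof (intro equalityI subsetI)
    fix t assume t: "t \<in> {a<..}"
    obtain n where "t < real n" using reals_Archimedean2 by blast
    then show "t \<in> (\<Union>n. A n)" using t by (auto simp: A_def intro!: exI[of _ n])
  qed (auto simp: A_def)
  obtain N where N: "a < real N" using reals_Archimedean2 by blast
  have "(\<lambda>n. (complex_of_real (cmod (\<i> - complex_of_real a)) / (z - complex_of_real a)) *
      ((z - complex_of_real (real n)) / complex_of_real (cmod (\<i> - complex_of_real (real n)))))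
    \<longlonglongrightarrow> (complex_of_real (cmod (\<i> - complex_of_real a)) / (z - complex_of_real a)) * (- 1)"
    by (intro tendsto_mult tendsto_const far_ratio_limit)
  moreover have "eventually (\<lambda>n. (complex_of_real (cmod (\<i> - complex_of_real a)) / (z - complex_of_real a)) *
      ((z - complex_of_real (real n)) / complex_of_real (cmod (\<i> - complex_of_real (real n)))) = arc_exp (A n) z) sequentially"
  proof (rule eventually_sequentiallyI)
    fix n assume "N \<le> n"
    then have n: "a < real n" using N by linarith
    show "(complex_of_real (cmod (\<i> - complex_of_real a)) / (z - complex_of_real a)) *
      ((z - complex_of_real (real n)) / complex_of_real (cmod (\<i> - complex_of_real (real n)))) = arc_exp (A n) z"
      unfolding A_def arc_exp_Ioo[OF z n] of_real_divide
      by (simp only: times_divide_times_eq mult.commute)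
  qed
  ultimately have "(\<lambda>n. arc_exp (A n) z) \<longlonglongrightarrow> (complex_of_real (cmod (\<i> - complex_of_real a)) / (z - complex_of_real a)) * (- 1)"
    using tendsto_cong by force
  with lim have "arc_exp {a<..} z = (complex_of_real (cmod (\<i> - complex_of_real a)) / (z - complex_of_real a)) * (- 1)"
    unfolding UA using LIMSEQ_unique by blast
  then show ?thesis by simp
qed

section \<open>The explicit factors of the various arcs\<close>

definition finite_part :: "rinf set \<Rightarrow> real set" where
  "finite_part J = {x. Fin x \<in> J}"

lemma finite_part_simps [simp]:
  "finite_part (Fin ` S) = S" "finite_part (insert Infty J) = finite_part J" "finite_part UNIV = UNIV" "finite_part {} = {}"
  "finite_part (J \<union> K) = finite_part J \<union> finite_part K" "finite_part (- J) = - finite_part J" "finite_part (J - K) = finite_part J - finite_part K"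
  "x \<in> finite_part J \<longleftrightarrow> Fin x \<in> J"
  by (auto simp: finite_part_def)

lemma Fin_image_finite_part: "Infty \<notin> J \<Longrightarrow> Fin ` finite_part J = J"
  unfolding finite_part_def by (auto simp: image_iff) (metis rinf.exhaust)

lemma insert_Infty_finite_part: "Infty \<in> J \<Longrightarrow> insert Infty (Fin ` finite_part J) = J"
  unfolding finite_part_def by (auto simp: image_iff) (metis rinf.exhaust)

lemma Fin_image_eq_iff: "Fin ` S = Fin ` T \<longleftrightarrow> S = T"
  by (metis finite_part_simps(1))

lemma insert_Infty_Fin_image_eq_iff: "insert Infty (Fin ` S) = insert Infty (Fin ` T) \<longleftrightarrow> S = T"
  by (metis finite_part_simps(1,2))

text \<open>\<open>p_int\<close> distinguishes shapes of arcs and recovers endpoints with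
  \<open>SOME\<close>. This and the following facts show that the shape and the endpoints are
  determined by the arc.\<close>

lemma Ioo_eq_Ioo: "a < b \<Longrightarrow> c < d \<Longrightarrow> {a<..<b} = {c<..<d} \<longleftrightarrow> a = c \<and> b = (d::real)"
  by (metis cInf_greaterThanLessThan cSup_greaterThanLessThan)

lemma not_Ioo_lessThan: "{..<a::real} \<noteq> {c<..<d}"
proof
  assume eq: "{..<a} = {c<..<d}"
  have "- \<bar>a\<bar> - \<bar>c\<bar> - 1 \<in> {..<a}" unfolding lessThan_iff by linarith
  then have "c < - \<bar>a\<bar> - \<bar>c\<bar> - 1" unfolding eq by simp
  then show False by linarith
qed

lemma not_Ioo_greaterThan: "{a::real<..} \<noteq> {c<..<d}"
proof
  assume eq: "{a<..} = {c<..<d}"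
  have "\<bar>a\<bar> + \<bar>d\<bar> + 1 \<in> {a<..}" unfolding greaterThan_iff by linarith
  then have "\<bar>a\<bar> + \<bar>d\<bar> + 1 < d" unfolding eq by simp
  then show False by linarith
qed

lemma not_lessThan_greaterThan: "{a::real<..} \<noteq> {..<d}"
proof
  assume eq: "{a<..} = {..<d}"
  have "\<bar>a\<bar> + \<bar>d\<bar> + 1 \<in> {a<..}" unfolding greaterThan_iff by linarith
  then have "\<bar>a\<bar> + \<bar>d\<bar> + 1 < d" unfolding eq by simp
  then show False by linarith
qed

lemma p_int_UNIV: "p_int UNIV z = - 1"
  by (simp add: p_int_def)

lemma p_int_Ioo:
  assumes ab: "a < b"
  shows "p_int (Fin ` {a<..<b}) z = complex_of_real (cmod (\<i> - complex_of_real a) / cmod (\<i> - complex_of_real b)) *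
             ((z - complex_of_real b) / (z - complex_of_real a))"
proof -
  have ne: "Fin ` {a<..<b} \<noteq> {}" "Fin ` {a<..<b} \<noteq> UNIV" using ab by auto
  have ex: "\<exists>c d. c < d \<and> Fin ` {a<..<b} = Fin ` {c<..<d}" using ab by blast
  have A: "(SOME c. \<exists>d. c < d \<and> Fin ` {a<..<b} = Fin ` {c<..<d}) = a"
    by (rule some_equality) (use ab in \<open>auto simp: Fin_image_eq_iff Ioo_eq_Ioo\<close>)
  have B: "(SOME d. a < d \<and> Fin ` {a<..<b} = Fin ` {a<..<d}) = b"
    by (rule some_equality) (use ab in \<open>auto simp: Fin_image_eq_iff Ioo_eq_Ioo\<close>)
  show ?thesis unfolding p_int_def Let_def A B using ne ex by (simp only: if_False if_True)
qed

lemma p_int_lessThan: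
  "p_int (Fin ` {..<a}) z = (z - complex_of_real a) / complex_of_real (cmod (\<i> - complex_of_real a))"
proof -
  have ne: "Fin ` {..<a} \<noteq> {}" "Fin ` {..<a} \<noteq> UNIV" by auto
  have n1: "\<not> (\<exists>c d. c < d \<and> Fin ` {..<a} = Fin ` {c<..<d})" by (simp add: Fin_image_eq_iff not_Ioo_lessThan)
  have ex: "\<exists>c. Fin ` {..<a} = Fin ` {..<c}" by blast
  have A: "(SOME c. Fin ` {..<a} = Fin ` {..<c}) = a"
    by (rule some_equality) (auto simp: Fin_image_eq_iff)
  show ?thesis unfolding p_int_def Let_def A using ne n1 ex by (simp only: if_False if_True)
qed

lemma p_int_greaterThan:
  "p_int (Fin ` {a<..}) z = - complex_of_real (cmod (\<i> - complex_of_real a)) / (z - complex_of_real a)"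
proof -
  have ne: "Fin ` {a<..} \<noteq> {}" "Fin ` {a<..} \<noteq> UNIV" by auto
  have n1: "\<not> (\<exists>c d. c < d \<and> Fin ` {a<..} = Fin ` {c<..<d})" by (simp add: Fin_image_eq_iff not_Ioo_greaterThan)
  have n2: "\<not> (\<exists>c. Fin ` {a<..} = Fin ` {..<c})" by (simp add: Fin_image_eq_iff not_lessThan_greaterThan)
  have ex: "\<exists>c. Fin ` {a<..} = Fin ` {c<..}" by blast
  have A: "(SOME c. Fin ` {a<..} = Fin ` {c<..}) = a"
    by (rule some_equality) (auto simp: Fin_image_eq_iff)
  show ?thesis unfolding p_int_def Let_def A using ne n1 n2 ex by (simp only: if_False if_True)
qed

lemma outer_eq_outer: 
  assumes "a < b" "c < d" "{..<a} \<union> {b<..} = {..<c} \<union> {d<..}"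
  shows "a = c \<and> b = (d::real)"
proof -
  have "- ({..<a} \<union> {b<..}) = - ({..<c} \<union> {d<..})" using assms(3) by simp
  moreover have "- ({..<u} \<union> {v<..}) = {u..v}" for u v :: real by auto
  ultimately have "{a..b} = {c..d}" by simp
  then show ?thesis using assms by (simp add: Icc_eq_Icc)
qed

lemma p_int_outer:
  assumes ab: "a < b"
  shows "p_int (insert Infty (Fin ` ({..<a} \<union> {b<..}))) z = - complex_of_real (cmod (\<i> - complex_of_real b) / cmod (\<i> - complex_of_real a)) *
             ((z - complex_of_real a) / (z - complex_of_real b))"
proof -
  let ?J = "insert Infty (Fin ` ({..<a} \<union> {b<..}))"
  have "Fin a \<notin> ?J" using ab by auto
  then have ne: "?J \<noteq> {}" "?J \<noteq> UNIV" by auto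
  have inf: "?J \<noteq> Fin ` S" for S by auto
  have n1: "\<not> (\<exists>c d. c < d \<and> ?J = Fin ` {c<..<d})" and n2: "\<not> (\<exists>c. ?J = Fin ` {..<c})" and n3: "\<not> (\<exists>c. ?J = Fin ` {c<..})"
    using inf by blast+
  have ex: "\<exists>c d. c < d \<and> ?J = insert Infty (Fin ` ({..<c} \<union> {d<..}))" using ab by blast
  have A: "(SOME c. \<exists>d. c < d \<and> ?J = insert Infty (Fin ` ({..<c} \<union> {d<..}))) = a"
    by (rule some_equality) (use ab outer_eq_outer in \<open>unfold insert_Infty_Fin_image_eq_iff, blast+\<close>)
  have B: "(SOME d. a < d \<and> ?J = insert Infty (Fin ` ({..<a} \<union> {d<..}))) = b"
    by (rule some_equality) (use ab outer_eq_outer in \<open>unfold insert_Infty_Fin_image_eq_iff, blast+\<close>)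
  show ?thesis unfolding p_int_def Let_def A B using ne n1 n2 n3 ex by (simp only: if_False if_True)
qed

lemma arc_exp_outer:
  assumes z: "z \<in> upper_half" and ab: "a < b"
  shows "arc_exp ({..<a} \<union> {b<..}) z = - complex_of_real (cmod (\<i> - complex_of_real b) / cmod (\<i> - complex_of_real a)) *
             ((z - complex_of_real a) / (z - complex_of_real b))"
proof -
  have "arc_exp ({..<a} \<union> {b<..}) z = arc_exp {..<a} z * arc_exp {b<..} z"
    using ab by (intro arc_exp_Un z) auto
  then show ?thesis unfolding arc_exp_lessThan[OF z] arc_exp_greaterThan[OF z] by simp
qed

text \<open>Dropping the null set {0} leaves two rays, whose factors are z and -1/z.\<close>

lemma arc_exp_UNIV:
  assumes z: "z \<in> upper_half"
  shows "arc_exp UNIV z = - 1"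
proof -
  have "arc_exp UNIV z = arc_exp ({..<0} \<union> {0<..}) z"
    unfolding arc_exp_def set_lebesgue_integral_def
  proof (rule arg_cong[where f = exp], rule integral_cong_AE)
    show "AE x in lborel. indicator UNIV x *\<^sub>R arg_density z x = indicator ({..<0} \<union> {0<..}) x *\<^sub>R arg_density z x"
      using AE_lborel_singleton[of 0] by eventually_elim (auto simp: indicator_def)
  qed measurable
  also have "\<dots> = arc_exp {..<0} z * arc_exp {0<..} z" by (intro arc_exp_Un z) auto
  also have "\<dots> = - 1"
    unfolding arc_exp_lessThan[OF z] arc_exp_greaterThan[OF z] using z by (auto simp: upper_half_def)
  finally show ?thesis .
qed

section \<open>Topology and components of the extended real line\<close>

lemma openin_rinf_top: "openin rinf_top S \<longleftrightarrow> rinf_open S"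
proof -
  have "istopology rinf_open"
    unfolding istopology_def
  proof (intro conjI allI impI)
    fix S T assume S: "rinf_open S" and T: "rinf_open T"
    have "{x. Fin x \<in> S \<inter> T} = {x. Fin x \<in> S} \<inter> {x. Fin x \<in> T}" by auto
    moreover have "\<exists>R. \<forall>x. R < \<bar>x\<bar> \<longrightarrow> Fin x \<in> S \<inter> T" if inf: "Infty \<in> S \<inter> T"
    proof -
      obtain R1 R2 where "\<And>x. R1 < \<bar>x\<bar> \<Longrightarrow> Fin x \<in> S" "\<And>x. R2 < \<bar>x\<bar> \<Longrightarrow> Fin x \<in> T"
        using S T inf unfolding rinf_open_def by blast
      then show ?thesis by (intro exI[of _ "max R1 R2"]) auto
    qed
    ultimately show "rinf_open (S \<inter> T)" using S T unfolding rinf_open_def by (simp add: open_Int)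
  next
    fix \<K> assume K: "\<forall>K\<in>\<K>. rinf_open K"
    have "{x. Fin x \<in> \<Union>\<K>} = (\<Union>K\<in>\<K>. {x. Fin x \<in> K})" by auto
    moreover have "open (\<Union>K\<in>\<K>. {x. Fin x \<in> K})" using K by (intro open_UN) (auto simp: rinf_open_def)
    moreover have "\<exists>R. \<forall>x. R < \<bar>x\<bar> \<longrightarrow> Fin x \<in> \<Union>\<K>" if inf: "Infty \<in> \<Union>\<K>"
    proof -
      obtain K where "K \<in> \<K>" "Infty \<in> K" using inf by blast
      then show ?thesis using K unfolding rinf_open_def by blast
    qed
    ultimately show "rinf_open (\<Union>\<K>)" unfolding rinf_open_def by simp
  qed
  then show ?thesis unfolding rinf_top_def by (simp add: topology_inverse')
qed

lemma topspace_rinf_top [simp]: "topspace rinf_top = UNIV"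
proof -
  have "openin rinf_top UNIV" unfolding openin_rinf_top rinf_open_def by simp
  then show ?thesis using openin_subset by blast
qed

lemma rinf_open_Fin_image: "rinf_open (Fin ` S) \<longleftrightarrow> open S"
proof -
  have "{x. Fin x \<in> Fin ` S} = S" by auto
  then show ?thesis unfolding rinf_open_def by auto
qed

lemma open_finite_part: "rinf_open S \<Longrightarrow> open (finite_part S)"
  by (simp add: rinf_open_def finite_part_def)

lemma connectedin_Fin_image:
  assumes "connected S"
  shows "connectedin rinf_top (Fin ` S)"
proof (rule connectedin_continuous_map_image)
  show "continuous_map euclidean rinf_top Fin"
    unfolding continuous_map_def by (auto simp: openin_rinf_top rinf_open_def)
  show "connectedin euclidean S" using assms by simp
qed

text \<open>Infinity lies in the closure of every unbounded set, and adding closure points preserves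
  connectedness.\<close>

lemma connectedin_insert_Infty:
  assumes "connected S" "\<not> bounded S"
  shows "connectedin rinf_top (insert Infty (Fin ` S))"
proof (rule connectedin_intermediate_closure_of[OF connectedin_Fin_image[OF assms(1)]])
  have "Infty \<in> rinf_top closure_of (Fin ` S)"
    unfolding in_closure_of
  proof (intro conjI allI impI)
    fix T assume T: "Infty \<in> T \<and> openin rinf_top T"
    then obtain R where R: "\<And>x. R < \<bar>x\<bar> \<Longrightarrow> Fin x \<in> T" unfolding openin_rinf_top rinf_open_def by blast
    obtain x where "x \<in> S" "R < \<bar>x\<bar>" using assms(2) unfolding bounded_real by (auto simp: not_le)
    then show "\<exists>y. y \<in> Fin ` S \<and> y \<in> T" using R by blast
  qed simp
  then show "insert Infty (Fin ` S) \<subseteq> rinf_top closure_of (Fin ` S)"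
    using closure_of_subset[of "Fin ` S" rinf_top] by simp
qed auto

lemma connectedin_rinf_UNIV: "connectedin rinf_top UNIV"
proof -
  have "insert Infty (Fin ` UNIV) = UNIV"
    using insert_Infty_finite_part[of UNIV] by simp
  moreover have "\<not> bounded (UNIV :: real set)" by (rule not_bounded_UNIV)
  ultimately show ?thesis using connectedin_insert_Infty[of UNIV] by simp
qed

text \<open>Local connectedness, the reason why components of open sets are open. At infinity the
  neighbourhood consists of two rays joined through \<open>Infty\<close>.\<close>

lemma connected_rinf_neighbourhood:
  assumes "rinf_open S" "x \<in> S"
  shows "\<exists>N. rinf_open N \<and> x \<in> N \<and> N \<subseteq> S \<and> connectedin rinf_top N"
proof (cases x)
  case (Fin a)
  have "open (finite_part S)" using assms(1) by (rule open_finite_part)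
  then obtain e where e: "0 < e" "ball a e \<subseteq> finite_part S" using assms(2) Fin open_contains_ball by (metis finite_part_simps(8))
  then show ?thesis using Fin
    by (intro exI[of _ "Fin ` ball a e"]) (auto simp: rinf_open_Fin_image intro!: connectedin_Fin_image)
next
  case Infty
  then obtain R where R: "\<And>x. R < \<bar>x\<bar> \<Longrightarrow> Fin x \<in> S" using assms unfolding rinf_open_def by blast
  define M where "M = max R 0"
  have M0: "0 \<le> M" by (simp add: M_def)
  let ?N = "insert Infty (Fin ` {..<-M}) \<union> insert Infty (Fin ` {M<..})"
  have "rinf_open ?N"
  proof -
    have "{x. Fin x \<in> ?N} = {..<-M} \<union> {M<..}" by auto
    then show ?thesis unfolding rinf_open_def by (auto intro!: exI[of _ M])
  qed
  moreover have "?N \<subseteq> S" using R assms(2) Infty by (auto simp: M_def)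
  moreover have "\<not> bounded {..<-M}" "\<not> bounded {M<..}"
  proof -
    show "\<not> bounded {..<-M}"
    proof
      assume "bounded {..<-M}"
      then obtain B where "\<And>x. x < - M \<Longrightarrow> \<bar>x\<bar> \<le> B" unfolding bounded_real by auto
      note B = this
      have "- M - \<bar>B\<bar> - 1 < - M" by linarith
      from B[OF this] show False using M0 by linarith
    qed
    show "\<not> bounded {M<..}"
    proof
      assume "bounded {M<..}"
      then obtain B where "\<And>x. M < x \<Longrightarrow> \<bar>x\<bar> \<le> B" unfolding bounded_real by auto
      note B = this
      have "M < M + \<bar>B\<bar> + 1" by linarith
      from B[OF this] show False using M0 by linarith
    qed
  qed
  then have "connectedin rinf_top ?N"
    by (intro connectedin_Un connectedin_insert_Infty) auto
  ultimately show ?thesis using Infty by blast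
qed

lemma rinf_components_props:
  assumes S: "rinf_open S" and C: "C \<in> rinf_components S"
  shows "connectedin rinf_top C" "C \<subseteq> S" "C \<noteq> {}" "rinf_open C"
proof -
  have "connectedin (subtopology rinf_top S) C"
    using C unfolding rinf_components_def by (rule connectedin_connected_components_of)
  then show "connectedin rinf_top C" and CS: "C \<subseteq> S" by (auto simp: connectedin_subtopology)
  show "C \<noteq> {}" using C unfolding rinf_components_def by (rule nonempty_connected_components_of)
  have "\<exists>N. openin rinf_top N \<and> x \<in> N \<and> N \<subseteq> C" if x: "x \<in> C" for x
  proof -
    obtain N where N: "rinf_open N" "x \<in> N" "N \<subseteq> S" "connectedin rinf_top N"
      using connected_rinf_neighbourhood[OF S] x CS by blast
    then have "connectedin (subtopology rinf_top S) N" by (simp add: connectedin_subtopology)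
    moreover have "\<not> disjnt C N" using N x by (auto simp: disjnt_def)
    ultimately have "N \<subseteq> C" using C unfolding rinf_components_def by (intro connected_components_of_maximal)
    then show ?thesis using N openin_rinf_top by blast
  qed
  then have "openin rinf_top C" by (subst openin_subopen) blast
  then show "rinf_open C" by (simp add: openin_rinf_top)
qed

lemma Union_rinf_components: "\<Union>(rinf_components S) = S"
  unfolding rinf_components_def Union_connected_components_of by simp

lemma disjoint_rinf_components:
  "C \<in> rinf_components S \<Longrightarrow> D \<in> rinf_components S \<Longrightarrow> C \<noteq> D \<Longrightarrow> C \<inter> D = {}"
  using pairwise_disjoint_connected_components_of[of "subtopology rinf_top S"]
  unfolding rinf_components_def pairwise_def disjnt_def by blast

lemma rinf_components_UNIV: "rinf_components UNIV = {UNIV}"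
proof -
  have "connected_space rinf_top"
    using connectedin_rinf_UNIV by (metis connectedin_topspace topspace_rinf_top)
  then show ?thesis
    unfolding rinf_components_def subtopology_UNIV connected_components_of_eq_singleton
    by (metis UNIV_not_empty null_topspace_iff_trivial topspace_rinf_top)
qed

lemma rinf_open_nonempty_finite_part:
  assumes "rinf_open C" "C \<noteq> {}"
  shows "finite_part C \<noteq> {}"
proof -
  obtain x where "x \<in> C" using assms by blast
  show ?thesis
  proof (cases x)
    case (Fin a)
    then show ?thesis using \<open>x \<in> C\<close> by auto
  next
    case Infty
    then obtain R where R: "\<And>x. R < \<bar>x\<bar> \<Longrightarrow> Fin x \<in> C" using assms \<open>x \<in> C\<close> unfolding rinf_open_def by blast
    have "Fin (\<bar>R\<bar> + 1) \<in> C" by (rule R) simp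
    then show ?thesis by (metis empty_iff finite_part_simps(8))
  qed
qed

text \<open>The finite parts of the components are nonempty, open and disjoint in the real
  line.\<close>

lemma countable_rinf_components:
  assumes "rinf_open S"
  shows "countable (rinf_components S)"
proof -
  note P = rinf_components_props[OF assms]
  have inj: "inj_on finite_part (rinf_components S)"
  proof (rule inj_onI, rule ccontr)
    fix C D assume CD: "C \<in> rinf_components S" "D \<in> rinf_components S" "finite_part C = finite_part D" "C \<noteq> D"
    obtain x where "x \<in> finite_part C" using rinf_open_nonempty_finite_part[OF P(4)[OF CD(1)] P(3)[OF CD(1)]] by blast
    then have "Fin x \<in> C \<inter> D" using CD(3) by (auto simp: finite_part_def)
    then show False using disjoint_rinf_components[OF CD(1,2,4)] by blast
  qed
  have "countable (finite_part ` rinf_components S)"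
  proof (rule countable_disjoint_open_subsets)
    show "\<And>T. T \<in> finite_part ` rinf_components S \<Longrightarrow> open T" using P(4) open_finite_part by blast
    show "pairwise disjnt (finite_part ` rinf_components S)"
      unfolding pairwise_def disjnt_def
    proof (intro ballI impI)
      fix T U assume "T \<in> finite_part ` rinf_components S" "U \<in> finite_part ` rinf_components S" "T \<noteq> U"
      then obtain C D where "C \<in> rinf_components S" "D \<in> rinf_components S" "T = finite_part C" "U = finite_part D" "C \<noteq> D" by blast
      then show "T \<inter> U = {}" using disjoint_rinf_components[of C S D] by (auto simp: finite_part_def)
    qed
  qed
  then show ?thesis using inj by (rule countable_image_inj_on)
qed

lemma open_interval_cases:
  fixes I :: "real set"
  assumes I: "is_interval I" "open I" "I \<noteq> {}"
  shows "I = UNIV \<or> (\<exists>a. I = {..<a}) \<or> (\<exists>a. I = {a<..}) \<or> (\<exists>a b. a < b \<and> I = {a<..<b})"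
proof -
  have nbr: "\<exists>e>0. x - e \<in> I \<and> x + e \<in> I" if x: "x \<in> I" for x
  proof -
    obtain e where e: "0 < e" "ball x e \<subseteq> I" using I(2) x by (rule openE)
    then have "x - e/2 \<in> I" "x + e/2 \<in> I" by (auto simp: subset_iff dist_real_def)
    then show ?thesis using e(1) by (intro exI[of _ "e/2"]) auto
  qed
  have nmax: "\<not> (\<forall>y\<in>I. y \<le> x)" and nmin: "\<not> (\<forall>y\<in>I. x \<le> y)" if "x \<in> I" for x
    using nbr[OF that] by force+
  obtain a b where "I = {} \<or> I = UNIV \<or> I = {..<b} \<or> I = {..b} \<or> I = {a<..} \<or> I = {a..} \<or>
    I = {a<..<b} \<or> I = {a<..b} \<or> I = {a..<b} \<or> I = {a..b}"
    using is_real_interval[OF I(1)] by blast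
  moreover have "I \<noteq> {..b}" using nmax[of b] by auto
  moreover have "I \<noteq> {a..}" using nmin[of a] by auto
  moreover have "I \<noteq> {a<..b}" using nmax[of b] I(3) by auto
  moreover have "I \<noteq> {a..<b}" using nmin[of a] I(3) by auto
  moreover have "I \<noteq> {a..b}" using nmin[of a] I(3) by auto
  moreover have "I = {a<..<b} \<Longrightarrow> a < b" using I(3) by auto
  ultimately show ?thesis using I(3) by blast
qed

text \<open>Without infinity the set is an open interval; with infinity its complement is a compact
  interval or empty. The last two cases, the circle minus one point, are those on which
  \<open>p_int\<close> is \<open>undefined\<close>.\<close>

lemma connected_rinf_open_cases:
  assumes conn: "connectedin rinf_top C" and op: "rinf_open C" and ne: "C \<noteq> {}"
  shows "C = UNIV \<or> (\<exists>a b. a < b \<and> C = Fin ` {a<..<b}) \<or> (\<exists>a. C = Fin ` {..<a}) \<or> (\<exists>b. C = Fin ` {b<..}) \<or>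
    (\<exists>a b. a < b \<and> C = insert Infty (Fin ` ({..<a} \<union> {b<..}))) \<or> C = Fin ` UNIV \<or> (\<exists>a. C = UNIV - {Fin a})"
proof (cases "Infty \<in> C")
  case False
  have "is_interval (finite_part C)"
    unfolding is_interval_1
  proof (intro ballI allI impI, rule ccontr)
    fix x y z assume x: "x \<in> finite_part C" and y: "y \<in> finite_part C" and xzy: "x \<le> z \<and> z \<le> y" and z: "z \<notin> finite_part C"
    have "x \<noteq> z" "z \<noteq> y" using x y z by auto
    then have lt: "x < z" "z < y" using xzy by auto
    have Cz: "C \<subseteq> Fin ` {..<z} \<union> Fin ` {z<..}"
    proof
      fix c assume c: "c \<in> C"
      then obtain u where u: "c = Fin u" using False by (cases c) auto
      then have "u \<noteq> z" using c z by auto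
      then show "c \<in> Fin ` {..<z} \<union> Fin ` {z<..}" using u by (cases "u < z") auto
    qed
    show False
      by (rule connectedinD[OF conn, of "Fin ` {..<z}" "Fin ` {z<..}"])
        (use Cz x y lt in \<open>auto simp: openin_rinf_top rinf_open_Fin_image\<close>)
  qed
  from open_interval_cases[OF this open_finite_part[OF op] rinf_open_nonempty_finite_part[OF op ne]]
  show ?thesis using Fin_image_finite_part[OF False] by metis
next
  case True
  define D where "D = - finite_part C"
  have CD: "C = insert Infty (Fin ` (- D))" using insert_Infty_finite_part[OF True] by (simp add: D_def)
  show ?thesis
  proof (cases "D = {}")
    case True
    then have "finite_part C = UNIV" by (auto simp: D_def)
    then have "C = insert Infty (Fin ` UNIV)" using insert_Infty_finite_part[OF \<open>Infty \<in> C\<close>] by simp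
    also have "\<dots> = UNIV" using insert_Infty_finite_part[of UNIV] by simp
    finally show ?thesis by simp
  next
    case Dne: False
    have "closed D" unfolding D_def using open_finite_part[OF op] by (simp add: closed_Compl)
    moreover have "bounded D"
    proof -
      obtain R where R: "\<And>x. R < \<bar>x\<bar> \<Longrightarrow> Fin x \<in> C" using op True unfolding rinf_open_def by blast
      then have "\<And>x. x \<in> D \<Longrightarrow> \<bar>x\<bar> \<le> R" unfolding D_def by (metis ComplD not_le finite_part_simps(8))
      then show ?thesis unfolding bounded_real by blast
    qed
    ultimately have "compact D" by (simp add: compact_eq_bounded_closed)
    moreover have "is_interval D"
      unfolding is_interval_1
    proof (intro ballI allI impI, rule ccontr)
      fix x y z assume x: "x \<in> D" and y: "y \<in> D" and xzy: "x \<le> z \<and> z \<le> y" and z: "z \<notin> D"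
      have "x \<noteq> z" "z \<noteq> y" using x y z by auto
      then have lt: "x < z" "z < y" using xzy by auto
      \<comment> \<open>The missing points x and y cut the circle into two arcs that would separate
        z from infinity inside C.\<close>
      let ?E1 = "Fin ` {x<..<y}" and ?E2 = "insert Infty (Fin ` ({..<x} \<union> {y<..}))"
      have "rinf_open ?E2"
      proof -
        have "{u. Fin u \<in> ?E2} = {..<x} \<union> {y<..}" by auto
        then show ?thesis unfolding rinf_open_def by (auto intro!: exI[of _ "\<bar>x\<bar> + \<bar>y\<bar>"])
      qed
      moreover have "C \<subseteq> ?E1 \<union> ?E2"
      proof
        fix c assume c: "c \<in> C"
        show "c \<in> ?E1 \<union> ?E2"
        proof (cases c)
          case (Fin u)
          then have "u \<noteq> x" "u \<noteq> y" using c x y by (auto simp: D_def)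
          then have "u \<in> {x<..<y} \<or> u \<in> {..<x} \<union> {y<..}" by auto
          then show ?thesis using Fin by blast
        qed auto
      qed
      moreover have "Fin z \<in> ?E1 \<inter> C" using z lt by (auto simp: D_def)
      then have "?E1 \<inter> C \<noteq> {}" by blast
      ultimately show False
        by (intro connectedinD[OF conn, of ?E1 ?E2])
          (use True z lt in \<open>auto simp: openin_rinf_top rinf_open_Fin_image D_def\<close>)
    qed
    ultimately obtain a b where ab: "D = {a..b}"
      using connected_compact_interval_1[of D] is_interval_connected_1[of D] by blast
    then have "a \<le> b" using Dne by auto
    have "- D = {..<a} \<union> {b<..}" unfolding ab by auto
    then have C: "C = insert Infty (Fin ` ({..<a} \<union> {b<..}))" using CD by simp
    show ?thesis
    proof (cases "a = b")
      case True
      have "insert Infty (Fin ` ({..<a} \<union> {a<..})) = UNIV - {Fin a}"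
      proof (intro equalityI subsetI)
        fix c assume c: "c \<in> UNIV - {Fin a}"
        then show "c \<in> insert Infty (Fin ` ({..<a} \<union> {a<..}))" by (cases c) auto
      qed auto
      then show ?thesis using C True by auto
    next
      case False
      then show ?thesis using C \<open>a \<le> b\<close> order_less_le[of a b] by blast
    qed
  qed
qed

text \<open>The last assumption excludes the arcs whose complement is a single point, for which \<open>p_int\<close> is
  undefined.\<close>
lemma p_int_eq_arc_exp:
  assumes "connectedin rinf_top C" "rinf_open C" "C \<noteq> {}" and z: "z \<in> upper_half"
    and "C = UNIV \<or> \<not> rinf_null (- C)"
  shows "p_int C z = arc_exp (finite_part C) z"
proof -
  have n1: "C \<noteq> Fin ` UNIV"
  proof
    assume C: "C = Fin ` UNIV"
    then have "C \<noteq> UNIV" by auto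
    moreover have "{x. Fin x \<in> - C} = {}" using C by auto
    ultimately show False using assms(5) by (simp add: rinf_null_def)
  qed
  have n2: "C \<noteq> UNIV - {Fin a}" for a
  proof
    assume C: "C = UNIV - {Fin a}"
    then have "C \<noteq> UNIV" by auto
    moreover have "{x. Fin x \<in> - C} = {a}" using C by auto
    ultimately show False using assms(5) by (simp add: rinf_null_def)
  qed
  show ?thesis
    using connected_rinf_open_cases[OF assms(1-3)]
  proof (elim disjE exE conjE)
    assume "C = UNIV"
    then show ?thesis using p_int_UNIV arc_exp_UNIV[OF z] by simp
  next
    fix a b assume "a < b" "C = Fin ` {a<..<b}"
    then show ?thesis using p_int_Ioo[of a b] arc_exp_Ioo[OF z, of a b] by (simp only: finite_part_simps)
  next
    fix a assume "C = Fin ` {..<a}"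
    then show ?thesis using p_int_lessThan arc_exp_lessThan[OF z] by (simp only: finite_part_simps)
  next
    fix b assume "C = Fin ` {b<..}"
    then show ?thesis using p_int_greaterThan arc_exp_greaterThan[OF z] by (simp only: finite_part_simps)
  next
    fix a b assume "a < b" "C = insert Infty (Fin ` ({..<a} \<union> {b<..}))"
    then show ?thesis using p_int_outer[of a b] arc_exp_outer[OF z, of a b] by (simp only: finite_part_simps)
  next
    assume "C = Fin ` UNIV"
    with n1 show ?thesis by contradiction
  next
    fix a assume "C = UNIV - {Fin a}"
    with n2 show ?thesis by contradiction
  qed
qed

text \<open>The integral in \<open>arc_exp\<close> is additive over the disjoint components and the
  exponential turns the sum into a product. Null points such as infinity are invisible to the
  integral.\<close>

lemma krein_prod_eq_arc_exp:
  assumes S: "rinf_open S" and z: "z \<in> upper_half"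
    and nn: "\<And>C. C \<in> rinf_components S \<Longrightarrow> C = UNIV \<or> \<not> rinf_null (- C)"
  shows "krein_prod S z = arc_exp (finite_part S) z"
proof -
  note P = rinf_components_props[OF S]
  let ?Cs = "rinf_components S"
  have p: "p_int C z = arc_exp (finite_part C) z" if "C \<in> ?Cs" for C
    using P[OF that] by (intro p_int_eq_arc_exp z nn that) auto
  have meas: "finite_part C \<in> sets borel" if "C \<in> ?Cs" for C
    using open_finite_part[OF P(4)[OF that]] by simp
  have dis: "finite_part C \<inter> finite_part D = {}" if "C \<in> ?Cs" "D \<in> ?Cs" "C \<noteq> D" for C D
    using disjoint_rinf_components[OF that] by (auto simp: finite_part_def)
  have UN: "finite_part S = (\<Union>C\<in>?Cs. finite_part C)"
    using Union_rinf_components[of S] by (auto simp: finite_part_def)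
  show ?thesis
  proof (cases "finite ?Cs")
    case True
    have "krein_prod S z = (\<Prod>C\<in>?Cs. arc_exp (finite_part C) z)"
      unfolding krein_prod_def Let_def using True p by (simp cong: prod.cong)
    also have "\<dots> = exp (\<Sum>C\<in>?Cs. LINT t:finite_part C|lborel. arg_density z t)"
      unfolding arc_exp_def by (rule exp_sum[OF True, symmetric])
    also have "(\<Sum>C\<in>?Cs. LINT t:finite_part C|lborel. arg_density z t) = (LINT t:(\<Union>C\<in>?Cs. finite_part C)|lborel. arg_density z t)"
      by (rule set_integral_finite_Union[symmetric])
        (use True meas dis z in \<open>auto simp: disjoint_family_on_def set_integrable_arg_density\<close>)
    finally show ?thesis unfolding arc_exp_def UN .
  next
    case False
    note c = countable_rinf_components[OF S]
    define J where "J n = from_nat_into ?Cs n" for n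
    have bij: "bij_betw J UNIV ?Cs" unfolding J_def using bij_betw_from_nat_into[OF c False] by (simp add: bij_betw_def)
    have J: "J n \<in> ?Cs" for n using bij by (auto simp: bij_betw_def)
    have Jdis: "finite_part (J m) \<inter> finite_part (J n) = {}" if "m \<noteq> n" for m n
      using dis[OF J J] bij that by (metis UNIV_I bij_betw_imp_inj_on inj_on_eq_iff)
    have UJ: "(\<Union>n. finite_part (J n)) = finite_part S"
    proof -
      have "range J = ?Cs" using bij by (simp add: bij_betw_def)
      then show ?thesis unfolding UN by (metis image_image)
    qed
    have int: "set_integrable lborel (\<Union>n. finite_part (J n)) (arg_density z)"
      using meas[OF J] z by (intro set_integrable_arg_density) auto
    \<comment> \<open>Continuity of the integral along the growing finite unions; this also supplies
      the convergence that \<open>prodinf_exp\<close> demands.\<close>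
    have incs: "(\<lambda>n. \<Sum>i\<le>n. LINT t:finite_part (J i)|lborel. arg_density z t) \<longlonglongrightarrow> (LINT t:(\<Union>n. finite_part (J n))|lborel. arg_density z t)"
    proof -
      have eq: "(\<Sum>i\<le>n. LINT t:finite_part (J i)|lborel. arg_density z t) = (LINT t:(\<Union>i\<in>{..n}. finite_part (J i))|lborel. arg_density z t)" for n
        by (rule set_integral_finite_Union[symmetric])
          (use meas[OF J] Jdis z in \<open>auto simp: disjoint_family_on_def set_integrable_arg_density\<close>)
      have UU: "(\<Union>n. \<Union>i\<in>{..n}. finite_part (J i)) = (\<Union>n. finite_part (J n))" by blast
      have "(\<lambda>n. LINT t:(\<Union>i\<in>{..n}. finite_part (J i))|lborel. arg_density z t) \<longlonglongrightarrow> (LINT t:(\<Union>n. \<Union>i\<in>{..n}. finite_part (J i))|lborel. arg_density z t)"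
      proof (rule set_integral_cont_up)
        show "\<And>n. (\<Union>i\<in>{..n}. finite_part (J i)) \<in> sets lborel" using meas[OF J] by auto
        show "incseq (\<lambda>n. \<Union>i\<in>{..n}. finite_part (J i))" unfolding incseq_def by (intro allI impI UN_mono) auto
        show "set_integrable lborel (\<Union>n. \<Union>i\<in>{..n}. finite_part (J i)) (arg_density z)" unfolding UU by (rule int)
      qed
      then show ?thesis unfolding eq UU .
    qed
    then have sums: "(\<lambda>i. LINT t:finite_part (J i)|lborel. arg_density z t) sums (LINT t:finite_part S|lborel. arg_density z t)"
      unfolding sums_def_le UJ .
    have "krein_prod S z = prodinf (\<lambda>n. p_int (J n) z)"
      unfolding krein_prod_def Let_def J_def using False by simp
    also have "\<dots> = prodinf (\<lambda>n. exp (LINT t:finite_part (J n)|lborel. arg_density z t))"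
      unfolding p[OF J] arc_exp_def ..
    also have "\<dots> = exp (LINT t:finite_part S|lborel. arg_density z t)"
      using sums by (subst prodinf_exp) (auto simp: sums_iff)
    finally show ?thesis unfolding arc_exp_def .
  qed
qed

section \<open>Regular boundary points\<close>

lemma tameI:
  assumes "\<forall>\<^sub>F z in approach x. cmod (f z) \<le> A" "\<forall>\<^sub>F z in approach x. Im (f z) \<le> B * boundary_weight z"
  shows "tame f x"
  unfolding tame_def
proof (intro exI)
  show "\<forall>\<^sub>F z in approach x. cmod (f z) \<le> max A B \<and> Im (f z) \<le> max A B * boundary_weight z"
    using assms eventually_approach_upper_half
  proof eventually_elim
    case (elim z)
    have "0 \<le> boundary_weight z" using elim(3) by (auto simp: upper_half_def intro!: divide_nonneg_nonneg)
    then have "B * boundary_weight z \<le> max A B * boundary_weight z" by (intro mult_right_mono) auto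
    then show ?case using elim(1,2) by auto
  qed
qed

abbreviation tame_bound :: "(complex \<Rightarrow> complex) \<Rightarrow> real \<Rightarrow> complex \<Rightarrow> bool" where
  "tame_bound f C z \<equiv> z \<in> upper_half \<and> 0 \<le> boundary_weight z \<and> cmod (f z) \<le> C \<and> Im (f z) \<le> C * boundary_weight z"

lemma tameE:
  assumes "tame f x"
  obtains C where "0 \<le> C" "\<forall>\<^sub>F z in approach x. tame_bound f C z"
proof -
  obtain C where C: "\<forall>\<^sub>F z in approach x. cmod (f z) \<le> C \<and> Im (f z) \<le> C * boundary_weight z"
    using assms unfolding tame_def by blast
  show ?thesis
  proof (rule that)
    show "\<forall>\<^sub>F z in approach x. tame_bound f \<bar>C\<bar> z"
      using C eventually_approach_upper_half
    proof eventually_elim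
      case (elim z)
      have w: "0 \<le> boundary_weight z" using elim(2) by (auto simp: upper_half_def intro!: divide_nonneg_nonneg)
      then have "C * boundary_weight z \<le> \<bar>C\<bar> * boundary_weight z" by (intro mult_right_mono) auto
      then show ?case using elim w by linarith
    qed
  qed simp
qed

text \<open>Each term of Im (f g) = Re f Im g + Im f Re g is a bounded factor times one of the order
  of the weight. Nonnegativity of the imaginary parts makes the one-sided bound in
  \<open>tame\<close> a two-sided one.\<close>

lemma tame_mult:
  assumes f: "nevanlinna f" and g: "nevanlinna g" and tf: "tame f x" and tg: "tame g x"
  shows "tame (\<lambda>z. f z * g z) x"
proof -
  obtain C where C: "0 \<le> C" "\<forall>\<^sub>F z in approach x. tame_bound f C z" using tf by (rule tameE)
  obtain D where D: "0 \<le> D" "\<forall>\<^sub>F z in approach x. tame_bound g D z" using tg by (rule tameE)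
  show ?thesis
  proof (rule tameI)
    show "\<forall>\<^sub>F z in approach x. cmod (f z * g z) \<le> C * D"
      using C(2) D(2) by eventually_elim (auto simp: norm_mult C(1) intro!: mult_mono)
    show "\<forall>\<^sub>F z in approach x. Im (f z * g z) \<le> (2 * C * D) * boundary_weight z"
      using C(2) D(2)
    proof eventually_elim
      case (elim z)
      let ?w = "boundary_weight z"
      have pos: "0 \<le> Im (f z)" "0 \<le> Im (g z)" using f g elim by (auto simp: nevanlinna_def)
      have "Re (f z) * Im (g z) \<le> C * (D * ?w)"
        using abs_Re_le_cmod[of "f z"] elim pos C(1) by (intro mult_mono) auto
      moreover have "Im (f z) * Re (g z) \<le> (C * ?w) * D"
        using elim pos C(1) order_trans[OF complex_Re_le_cmod[of "g z"], of D]
        by (intro order_trans[OF mult_left_mono[of "Re (g z)" D] mult_right_mono] D(1)) auto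
      moreover have "X + Y \<le> (2 * C * D) * w" if "X \<le> C * (D * w)" "Y \<le> (C * w) * D" for X Y w :: real
        using that by (simp add: algebra_simps)
      ultimately show ?case unfolding times_complex.sel by blast
    qed
  qed
qed

text \<open>As for products, with the denominator kept above half the modulus of its nonzero
  limit.\<close>

lemma tame_divide:
  assumes f: "nevanlinna f" and g: "nevanlinna g" and tf: "tame f x" and tg: "tame g x"
    and lim: "(g \<longlongrightarrow> complex_of_real v) (approach x)" and v: "v \<noteq> 0"
  shows "tame (\<lambda>z. f z / g z) x"
proof -
  obtain C where C: "0 \<le> C" "\<forall>\<^sub>F z in approach x. tame_bound f C z" using tf by (rule tameE)
  obtain D where D: "0 \<le> D" "\<forall>\<^sub>F z in approach x. tame_bound g D z" using tg by (rule tameE)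
  define c where "c = \<bar>v\<bar> / 2"
  have c: "0 < c" using v by (simp add: c_def)
  have "((\<lambda>z. cmod (g z)) \<longlongrightarrow> \<bar>v\<bar>) (approach x)" using tendsto_norm[OF lim] by simp
  then have big: "\<forall>\<^sub>F z in approach x. c < cmod (g z)"
    by (rule order_tendstoD(1)) (use v in \<open>simp add: c_def\<close>)
  show ?thesis
  proof (rule tameI)
    show "\<forall>\<^sub>F z in approach x. cmod (f z / g z) \<le> C / c"
      using C(2) big by eventually_elim (use c C(1) in \<open>auto simp: norm_divide intro!: frac_le\<close>)
    show "\<forall>\<^sub>F z in approach x. Im (f z / g z) \<le> (2 * C * D / c\<^sup>2) * boundary_weight z"
      using C(2) D(2) big
    proof eventually_elim
      case (elim z)
      let ?w = "boundary_weight z"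
      have pos: "0 \<le> Im (f z)" "0 \<le> Im (g z)" using f g elim by (auto simp: nevanlinna_def)
      have A: "Im (f z) * Re (g z) \<le> (C * ?w) * D"
        using elim pos C(1) order_trans[OF complex_Re_le_cmod[of "g z"], of D]
        by (intro order_trans[OF mult_left_mono[of "Re (g z)" D] mult_right_mono] D(1)) auto
      have "(- Re (f z)) * Im (g z) \<le> C * (D * ?w)"
        using abs_Re_le_cmod[of "f z"] elim pos C(1) by (intro mult_mono) auto
      moreover have "X - P * Q \<le> 2 * C * D * w" if "X \<le> (C * w) * D" "(- P) * Q \<le> C * (D * w)" for X P Q w :: real
        using that by (simp add: algebra_simps)
      ultimately have B: "Im (f z) * Re (g z) - Re (f z) * Im (g z) \<le> 2 * C * D * ?w" using A by blast
      have "Im (f z / g z) = (Im (f z) * Re (g z) - Re (f z) * Im (g z)) / (cmod (g z))\<^sup>2"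
        by (simp add: Im_divide cmod_power2)
      also have "\<dots> \<le> (2 * C * D * ?w) / c\<^sup>2"
      proof (rule frac_le)
        show "0 \<le> 2 * C * D * ?w" using C(1) D(1) elim by (intro mult_nonneg_nonneg) auto
        show "c\<^sup>2 \<le> (cmod (g z))\<^sup>2" using elim c by (intro power_mono) auto
      qed (use B c in auto)
      also have "\<dots> = (2 * C * D / c\<^sup>2) * ?w" by simp
      finally show ?case .
    qed
  qed
qed

lemma nevanlinna_exp:
  assumes "nevanlinna h" "\<And>z. z \<in> upper_half \<Longrightarrow> Im (h z) \<le> pi"
  shows "nevanlinna (\<lambda>z. exp (h z))"
proof -
  have "0 \<le> Im (exp (h z))" if "z \<in> upper_half" for z
    using assms that unfolding Im_exp nevanlinna_def by (intro mult_nonneg_nonneg sin_ge_zero) auto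
  then show ?thesis using assms unfolding nevanlinna_def by (auto intro!: holomorphic_intros)
qed

text \<open>The inequality \<open>sin x \<le> x\<close> for nonnegative x carries the bound on the
  imaginary part through the exponential.\<close>

lemma tame_exp:
  assumes h: "nevanlinna h" and t: "tame h x"
  shows "tame (\<lambda>z. exp (h z)) x"
proof -
  obtain C where C: "0 \<le> C" "\<forall>\<^sub>F z in approach x. tame_bound h C z" using t by (rule tameE)
  show ?thesis
  proof (rule tameI)
    show "\<forall>\<^sub>F z in approach x. cmod (exp (h z)) \<le> exp C"
      using C(2)
    proof eventually_elim
      case (elim z)
      then show ?case using complex_Re_le_cmod[of "h z"] by simp
    qed
    show "\<forall>\<^sub>F z in approach x. Im (exp (h z)) \<le> (exp C * C) * boundary_weight z"
      using C(2)
    proof eventually_elim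
      case (elim z)
      have pos: "0 \<le> Im (h z)" using h elim by (auto simp: nevanlinna_def)
      have "Im (exp (h z)) = exp (Re (h z)) * sin (Im (h z))" by (rule Im_exp)
      also have "\<dots> \<le> exp (Re (h z)) * Im (h z)" by (intro mult_left_mono sin_x_le_x pos) auto
      also have "\<dots> \<le> exp C * (C * boundary_weight z)"
        using complex_Re_le_cmod[of "h z"] elim pos by (intro mult_mono) auto
      finally show ?case by simp
    qed
  qed
qed

text \<open>Near a positive boundary value of exp h the argument \<theta> = Im h lies below pi/2,
  where \<theta> is at most tan \<theta> = Im (exp h) / Re (exp h), which is of the order of the
  weight. Two-sided bounds on |exp h| control Re h.\<close>

lemma tame_log_pos:
  assumes h: "\<And>z. z \<in> upper_half \<Longrightarrow> 0 \<le> Im (h z) \<and> Im (h z) \<le> pi"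
    and t: "tame (\<lambda>z. exp (h z)) x" and lim: "((\<lambda>z. exp (h z)) \<longlongrightarrow> complex_of_real v) (approach x)" and v: "0 < v"
  shows "tame h x"
proof -
  obtain C where C: "0 \<le> C" "\<forall>\<^sub>F z in approach x. tame_bound (\<lambda>z. exp (h z)) C z" using t by (rule tameE)
  have "((\<lambda>z. Re (exp (h z))) \<longlongrightarrow> v) (approach x)" using tendsto_Re[OF lim] by simp
  then have big: "\<forall>\<^sub>F z in approach x. v / 2 < Re (exp (h z))"
    by (rule order_tendstoD(1)) (use v in simp)
  show ?thesis
  proof (rule tameI)
    show "\<forall>\<^sub>F z in approach x. cmod (h z) \<le> \<bar>ln (v / 2)\<bar> + \<bar>ln C\<bar> + pi"
      using C(2) big
    proof eventually_elim
      case (elim z)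
      have e: "exp (Re (h z)) \<le> C" "v / 2 < exp (Re (h z))"
        using elim complex_Re_le_cmod[of "exp (h z)"] by auto
      then have "0 < C" using v by (meson exp_gt_zero less_le_trans)
      have "Re (h z) \<le> ln C" using e(1) \<open>0 < C\<close> by (simp add: ln_ge_iff)
      moreover have "ln (v / 2) < Re (h z)" 
      proof -
        have "ln (v / 2) < ln (exp (Re (h z)))" by (subst ln_less_cancel_iff) (use e(2) v in auto)
        then show ?thesis by simp
      qed
      moreover have "cmod (h z) \<le> \<bar>Re (h z)\<bar> + \<bar>Im (h z)\<bar>" by (rule cmod_le)
      moreover have "\<bar>Im (h z)\<bar> \<le> pi" using h[of z] elim by simp
      ultimately show ?case by linarith
    qed
    show "\<forall>\<^sub>F z in approach x. Im (h z) \<le> (2 * C / v) * boundary_weight z"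
      using C(2) big
    proof eventually_elim
      case (elim z)
      define \<theta> where "\<theta> = Im (h z)"
      have \<theta>: "0 \<le> \<theta>" "\<theta> \<le> pi" using h[of z] elim by (auto simp: \<theta>_def)
      have R: "0 < Re (exp (h z))" using elim(2) v by linarith
      then have cos: "0 < cos \<theta>" by (simp add: Re_exp \<theta>_def zero_less_mult_iff)
      have "\<theta> < pi / 2"
      proof (rule ccontr)
        assume "\<not> \<theta> < pi / 2"
        then have "cos \<theta> \<le> cos (pi / 2)" using \<theta> by (intro cos_monotone_0_pi_le) auto
        then show False using cos by simp
      qed
      then have "\<bar>\<theta>\<bar> \<le> \<bar>tan \<theta>\<bar>" using \<theta> by (intro abs_tan_ge) auto
      moreover have "0 \<le> tan \<theta>" unfolding tan_def using cos \<theta> by (intro divide_nonneg_pos sin_ge_zero) auto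
      ultimately have "\<theta> \<le> tan \<theta>" using \<theta> by simp
      also have "\<dots> = Im (exp (h z)) / Re (exp (h z))"
        by (simp add: Im_exp Re_exp \<theta>_def tan_def)
      also have "\<dots> \<le> (C * boundary_weight z) / (v / 2)"
        using elim C(1) v by (intro frac_le mult_nonneg_nonneg) auto
      also have "\<dots> = (2 * C / v) * boundary_weight z" by (simp add: mult_ac)
      finally show ?case by (simp add: \<theta>_def)
    qed
  qed
qed

text \<open>Reflection: \<open>exp (\<i> * pi - h z)\<close> is -1 / exp h, whose boundary value is
  positive, so the positive case applies.\<close>

lemma tame_log_neg:
  assumes h: "\<And>z. z \<in> upper_half \<Longrightarrow> 0 \<le> Im (h z) \<and> Im (h z) \<le> pi" and nev: "nevanlinna (\<lambda>z. exp (h z))"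
    and t: "tame (\<lambda>z. exp (h z)) x" and lim: "((\<lambda>z. exp (h z)) \<longlongrightarrow> complex_of_real v) (approach x)" and v: "v < 0"
  shows "tame (\<lambda>z. \<i> * pi - h z) x"
proof (rule tame_log_pos)
  have eq: "exp (\<i> * pi - h z) = - 1 / exp (h z)" for z
    by (simp add: exp_diff)
  have "nevanlinna (\<lambda>_. - 1)" by (simp add: nevanlinna_def)
  moreover have "tame (\<lambda>_. - 1) x" by (rule tameI[where A = 1 and B = 0]) auto
  ultimately show "tame (\<lambda>z. exp (\<i> * pi - h z)) x"
    unfolding eq by (intro tame_divide[OF _ nev _ t lim]) (use v in auto)
  have "((\<lambda>z. - 1 / exp (h z)) \<longlongrightarrow> - 1 / complex_of_real v) (approach x)"
    by (intro tendsto_intros lim) (use v in auto)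
  then show "((\<lambda>z. exp (\<i> * pi - h z)) \<longlongrightarrow> complex_of_real (- 1 / v)) (approach x)"
    unfolding eq by simp
  show "0 < - 1 / v" using v by (simp add: divide_neg_neg)
qed (use h in auto)

text \<open>With zero linear coefficient, infinity is regular as soon as all real points of large
  modulus are; this is how infinity is handled in the factorization.\<close>

lemma nev_rep_tame_Infty_local:
  assumes rep: "nev_rep f 0 \<beta> \<rho>" and null: "\<And>x. R < \<bar>x\<bar> \<Longrightarrow> \<exists>e>0. emeasure \<rho> {x - e<..<x + e} = 0"
  shows "tame f Infty" "\<exists>v. (f \<longlongrightarrow> complex_of_real v) (approach Infty)"
proof -
  have sb: "sets \<rho> = sets borel" using rep by (simp add: nev_rep_def)
  have "{t::real. R < \<bar>t\<bar>} \<in> sets borel" by measurable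
  then have "emeasure \<rho> {t. R < \<bar>t\<bar>} = 0" by (intro null_of_locally_null[OF sb]) (use null in auto)
  from nev_rep_tame_Infty[OF rep this] show "tame f Infty" "\<exists>v. (f \<longlongrightarrow> complex_of_real v) (approach Infty)" by auto
qed

lemma tame_Infty_nbhd:
  assumes "tame f Infty"
  shows "\<exists>R. \<forall>x. R < \<bar>x\<bar> \<longrightarrow> tame f (Fin x)"
proof -
  obtain U where "rinf_open U" "Infty \<in> U" "\<forall>y\<in>U. tame f y" using tame_local[OF assms] by blast
  then show ?thesis unfolding rinf_open_def by blast
qed

lemma tame_Fin_nbhd:
  assumes "tame f (Fin x)"
  shows "\<exists>e>0. \<forall>y. x - e < y \<longrightarrow> y < x + e \<longrightarrow> tame f (Fin y)"
proof -
  obtain U where U: "rinf_open U" "Fin x \<in> U" "\<And>y. y \<in> U \<Longrightarrow> tame f y" using tame_local[OF assms] by blast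
  have "open (finite_part U)" using U(1) by (rule open_finite_part)
  moreover have "x \<in> finite_part U" using U(2) by simp
  ultimately obtain e where e: "0 < e" "ball x e \<subseteq> finite_part U" by (rule openE)
  have "tame f (Fin y)" if "x - e < y" "y < x + e" for y
  proof -
    have "y \<in> ball x e" using that by (simp add: dist_real_def abs_if)
    then show ?thesis using e(2) U(3) by (auto simp: subset_iff)
  qed
  then show ?thesis using e(1) by blast
qed

text \<open>A positive linear coefficient would make Im f unbounded along the imaginary
  axis.\<close>

lemma tame_Infty_imp:
  assumes rep: "nev_rep f \<alpha> \<beta> \<rho>" and t: "tame f Infty"
  shows "\<alpha> = 0" "\<exists>R. \<forall>x. R < \<bar>x\<bar> \<longrightarrow> (\<exists>e>0. emeasure \<rho> {x - e<..<x + e} = 0)"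
proof -
  obtain C where C: "0 \<le> C" "\<forall>\<^sub>F z in approach Infty. tame_bound f C z" using t by (rule tameE)
  then obtain b where b: "\<And>z. z \<in> upper_half \<Longrightarrow> b \<le> cmod z \<Longrightarrow> cmod (f z) \<le> C"
    unfolding eventually_approach_Infty by blast
  note r = rep[unfolded nev_rep_iff]
  show "\<alpha> = 0"
  proof (rule ccontr)
    assume "\<alpha> \<noteq> 0"
    then have \<alpha>: "0 < \<alpha>" using r by simp
    \<comment> \<open>Large enough for the bound on f to apply at iy and for
      \<open>\<alpha> * y\<close> to exceed that bound by 1.\<close>
    define y where "y = \<bar>b\<bar> + (C + 1) / \<alpha>"
    have y0: "0 < (C + 1) / \<alpha>" using \<alpha> C(1) by simp
    have u: "Complex 0 y \<in> upper_half" using y0 by (simp add: y_def upper_half_def)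
    have "b \<le> cmod (Complex 0 y)" using y0 by (simp add: y_def cmod_def)
    from b[OF u this] have "Im (f (Complex 0 y)) \<le> C" using abs_Im_le_cmod[of "f (Complex 0 y)"] by linarith
    moreover have "Im (f (Complex 0 y)) \<ge> \<alpha> * y"
      using r u Im_integral_nev_kernel_nonneg[of \<rho> "Complex 0 y"] by simp
    moreover have "\<alpha> * y \<ge> C + 1"
    proof -
      have "\<alpha> * ((C + 1) / \<alpha>) = C + 1" "0 \<le> \<alpha> * \<bar>b\<bar>" using \<alpha> by auto
      then show ?thesis unfolding y_def distrib_left by linarith
    qed
    ultimately show False by linarith
  qed
  show "\<exists>R. \<forall>x. R < \<bar>x\<bar> \<longrightarrow> (\<exists>e>0. emeasure \<rho> {x - e<..<x + e} = 0)"
    using tame_Infty_nbhd[OF t] tame_Fin_imp_null[OF rep] by blast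
qed

section \<open>Boundary limits, and \<open>nev_Omega\<close> and \<open>nev_Gamma\<close> through
  \<open>tame\<close>\<close>

lemma tame_limit:
  assumes "nevanlinna f" "tame f x"
  shows "(f \<longlongrightarrow> complex_of_real (nev_val f x)) (approach x)"
proof -
  obtain \<alpha> \<beta> \<rho> where rep: "nev_rep f \<alpha> \<beta> \<rho>" using nev_rep_exists[OF assms(1)] by blast
  have "\<exists>v. (f \<longlongrightarrow> complex_of_real v) (approach x)"
  proof (cases x)
    case (Fin a)
    then show ?thesis using tame_Fin_imp_null[OF rep] assms(2) nev_rep_tame_Fin(2)[OF rep] by blast
  next
    case Infty
    then have "nev_rep f 0 \<beta> \<rho>" using tame_Infty_imp(1)[OF rep] assms(2) rep by simp
    then show ?thesis using tame_Infty_imp(2)[OF rep] assms(2) Infty nev_rep_tame_Infty_local(2) by blast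
  qed
  then show ?thesis using nev_val_eqI by metis
qed

text \<open>Removes the choice of the triple: the equivalence of \<open>tame\<close> with local
  vanishing is applied to the triple selected by \<open>SOME\<close>, and the right side depends on
  f alone.\<close>

lemma nev_Omega_eq:
  assumes "nevanlinna f"
  shows "nev_Omega f = {x. tame f x}"
proof -
  obtain \<alpha>0 \<beta>0 \<rho>0 where "nev_rep f \<alpha>0 \<beta>0 \<rho>0" using nev_rep_exists[OF assms] by blast
  then have "nev_rep f (fst (\<alpha>0, \<beta>0, \<rho>0)) (fst (snd (\<alpha>0, \<beta>0, \<rho>0))) (snd (snd (\<alpha>0, \<beta>0, \<rho>0)))" by simp
  then have "nev_rep f (fst (nev_triple f)) (fst (snd (nev_triple f))) (snd (snd (nev_triple f)))"
    unfolding nev_triple_def by (rule someI)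
  moreover obtain \<alpha> \<beta> \<rho> where tr: "nev_triple f = (\<alpha>, \<beta>, \<rho>)" by (cases "nev_triple f") auto
  ultimately have rep: "nev_rep f \<alpha> \<beta> \<rho>" by simp
  have sb: "sets \<rho> = sets borel" and \<alpha>0: "0 \<le> \<alpha>" using rep by (simp_all add: nev_rep_def)
  have fin_iff: "a \<notin> measure_support \<rho> \<longleftrightarrow> tame f (Fin a)" for a
  proof
    assume "a \<notin> measure_support \<rho>"
    then obtain e where "0 < e" "emeasure \<rho> {a - e<..<a + e} = 0" by (auto simp: measure_support_def not_less)
    then show "tame f (Fin a)" by (rule nev_rep_tame_Fin(1)[OF rep])
  next
    assume "tame f (Fin a)"
    then show "a \<notin> measure_support \<rho>" using tame_Fin_imp_null[OF rep, of a] by (auto simp: measure_support_def)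
  qed
  have inf_iff: "\<not> (0 < \<alpha> \<or> \<not> bounded (measure_support \<rho>)) \<longleftrightarrow> tame f Infty"
  proof
    assume "\<not> (0 < \<alpha> \<or> \<not> bounded (measure_support \<rho>))"
    then have \<alpha>: "\<alpha> = 0" and "bounded (measure_support \<rho>)" using \<alpha>0 by auto
    then obtain L where L: "\<And>t. t \<in> measure_support \<rho> \<Longrightarrow> \<bar>t\<bar> \<le> L" unfolding bounded_real by blast
    have "{t::real. L < \<bar>t\<bar>} \<in> sets borel" by measurable
    then have "emeasure \<rho> {t. L < \<bar>t\<bar>} = 0"
      by (intro emeasure_off_support[OF sb]) (use L in \<open>auto simp: not_le[symmetric]\<close>)
    then show "tame f Infty" using nev_rep_tame_Infty(1) rep \<alpha> by blast
  next
    assume t: "tame f Infty"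
    obtain R where R: "\<And>x. R < \<bar>x\<bar> \<Longrightarrow> tame f (Fin x)" using tame_Infty_nbhd[OF t] by blast
    have "\<bar>t\<bar> \<le> R" if "t \<in> measure_support \<rho>" for t
      using R[of t] fin_iff[of t] that by (meson not_le)
    then have "bounded (measure_support \<rho>)" unfolding bounded_real by blast
    then show "\<not> (0 < \<alpha> \<or> \<not> bounded (measure_support \<rho>))" using tame_Infty_imp(1)[OF rep t] by simp
  qed
  have "x \<in> nev_Omega f \<longleftrightarrow> tame f x" for x
  proof (cases x)
    case (Fin a)
    then show ?thesis using fin_iff[of a] Fin by (auto simp: nev_Omega_def nev_sigma_def tr)
  next
    case Infty
    then show ?thesis using inf_iff Infty by (auto simp: nev_Omega_def nev_sigma_def tr)
  qed
  then show ?thesis by blast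
qed

lemma nev_Gamma_eq: "nevanlinna f \<Longrightarrow> nev_Gamma f = {x. tame f x \<and> nev_val f x < 0}"
  by (simp add: nev_Gamma_def nev_Omega_eq)

lemma rinf_open_localI:
  assumes "\<And>x. x \<in> S \<Longrightarrow> \<exists>U. rinf_open U \<and> x \<in> U \<and> U \<subseteq> S"
  shows "rinf_open S"
proof -
  have "openin rinf_top S" by (subst openin_subopen) (use assms in \<open>simp add: openin_rinf_top\<close>)
  then show ?thesis by (simp add: openin_rinf_top)
qed

lemma rinf_open_tame: "rinf_open {x. tame f x}"
proof (rule rinf_open_localI)
  fix x assume "x \<in> {x. tame f x}"
  then show "\<exists>U. rinf_open U \<and> x \<in> U \<and> U \<subseteq> {x. tame f x}" using tame_local[of f x] by blast
qed

text \<open>The bounds that make x regular and f negative there hold on a half-neighbourhood, hence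
  with the same constants at all nearby boundary points.\<close>

lemma rinf_open_nev_Gamma:
  assumes "nevanlinna f"
  shows "rinf_open (nev_Gamma f)"
proof (rule rinf_open_localI)
  fix x assume "x \<in> nev_Gamma f"
  then have t: "tame f x" and v: "nev_val f x < 0" by (auto simp: nev_Gamma_eq[OF assms])
  have "((\<lambda>z. Re (f z)) \<longlongrightarrow> nev_val f x) (approach x)" using tendsto_Re[OF tame_limit[OF assms t]] by simp
  \<comment> \<open>Half of the boundary value leaves a strictly negative margin that survives the
    limit at neighbouring points.\<close>
  then have "\<forall>\<^sub>F z in approach x. Re (f z) < nev_val f x / 2" by (rule order_tendstoD(2)) (use v in simp)
  moreover obtain C where "\<forall>\<^sub>F z in approach x. cmod (f z) \<le> C \<and> Im (f z) \<le> C * boundary_weight z"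
    using t unfolding tame_def by blast
  ultimately have "\<forall>\<^sub>F z in approach x. Re (f z) < nev_val f x / 2 \<and> cmod (f z) \<le> C \<and> Im (f z) \<le> C * boundary_weight z"
    by (rule eventually_conj)
  then obtain U where U: "rinf_open U" "x \<in> U"
    and ev: "\<And>y. y \<in> U \<Longrightarrow> \<forall>\<^sub>F z in approach y. Re (f z) < nev_val f x / 2 \<and> cmod (f z) \<le> C \<and> Im (f z) \<le> C * boundary_weight z"
    using eventually_approach_local by blast
  have "y \<in> nev_Gamma f" if y: "y \<in> U" for y
  proof -
    have ty: "tame f y" unfolding tame_def by (rule exI[of _ C], rule eventually_mono[OF ev[OF y]]) auto
    have "((\<lambda>z. Re (f z)) \<longlongrightarrow> nev_val f y) (approach y)" using tendsto_Re[OF tame_limit[OF assms ty]] by simp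
    moreover have "\<forall>\<^sub>F z in approach y. Re (f z) \<le> nev_val f x / 2" by (rule eventually_mono[OF ev[OF y]]) auto
    ultimately have "nev_val f y \<le> nev_val f x / 2" using tendsto_upperbound approach_neq_bot by blast
    then show ?thesis using v ty by (simp add: nev_Gamma_eq[OF assms])
  qed
  then show "\<exists>U. rinf_open U \<and> x \<in> U \<and> U \<subseteq> nev_Gamma f" using U by blast
qed

text \<open>By \<open>boundary_val_inj\<close> two zeros make f constant, and the constant is its
  boundary value 0.\<close>

lemma zero_between_unique:
  assumes f: "nevanlinna f" and t: "\<And>y. a < y \<Longrightarrow> y < b \<Longrightarrow> tame f (Fin y)"
    and x: "a < x1" "x1 < x2" "x2 < b" and eq: "nev_val f (Fin x1) = 0" "nev_val f (Fin x2) = 0" and z: "z \<in> upper_half"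
  shows "f z = 0"
proof -
  obtain \<alpha> \<beta> \<rho> where rep: "nev_rep f \<alpha> \<beta> \<rho>" using nev_rep_exists[OF f] by blast
  have sb: "sets \<rho> = sets borel" using rep by (simp add: nev_rep_def)
  have null: "emeasure \<rho> {a<..<b} = 0"
    by (rule null_of_locally_null[OF sb]) (use t tame_Fin_imp_null[OF rep] in auto)
  have bv: "boundary_val \<alpha> \<beta> \<rho> y = nev_val f (Fin y)" if y: "a < y" "y < b" for y
  proof -
    obtain e where "0 < e" "emeasure \<rho> {y - e<..<y + e} = 0" using tame_Fin_imp_null[OF rep t[OF y]] by blast
    from nev_val_eqI[OF nev_rep_tame_Fin(2)[OF rep this]] show ?thesis by simp
  qed
  have "boundary_val \<alpha> \<beta> \<rho> x1 = boundary_val \<alpha> \<beta> \<rho> x2" using bv[of x1] bv[of x2] x eq by simp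
  then have c: "f w = complex_of_real \<beta>" if "w \<in> upper_half" for w
    by (rule boundary_val_inj[OF rep null x]) (rule that)
  have "((\<lambda>_. complex_of_real \<beta>) \<longlongrightarrow> complex_of_real 0) (approach (Fin x1))"
  proof (rule Lim_transform_eventually)
    show "(f \<longlongrightarrow> complex_of_real 0) (approach (Fin x1))" using tame_limit[OF f t[of x1]] x eq by simp
    show "\<forall>\<^sub>F w in approach (Fin x1). f w = complex_of_real \<beta>"
      by (rule eventually_mono[OF eventually_approach_upper_half]) (rule c)
  qed
  then have "complex_of_real \<beta> = complex_of_real 0" using tendsto_unique[OF approach_neq_bot tendsto_const] by blast
  then show ?thesis using c[OF z] by simp
qed

lemma nev_rep_bounded_Im:
  assumes rep: "nev_rep h \<alpha> \<beta> \<rho>" and b: "\<And>z. z \<in> upper_half \<Longrightarrow> Im (h z) \<le> B"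
  shows "\<alpha> = 0"
proof (rule ccontr)
  note r = rep[unfolded nev_rep_iff]
  assume "\<alpha> \<noteq> 0"
  then have \<alpha>: "0 < \<alpha>" using r by simp
  define y where "y = (\<bar>B\<bar> + 1) / \<alpha>"
  have y0: "0 < y" using \<alpha> by (simp add: y_def)
  have u: "Complex 0 y \<in> upper_half" using y0 by (simp add: upper_half_def)
  have "Im (h (Complex 0 y)) \<ge> \<alpha> * y"
    using r u Im_integral_nev_kernel_nonneg[of \<rho> "Complex 0 y"] by simp
  moreover have "\<alpha> * y = \<bar>B\<bar> + 1" using \<alpha> by (simp add: y_def)
  ultimately show False using b[OF u] by linarith
qed

text \<open>Cutting the measure along \<open>B\<close> splits h into summands, hence exp h into
  factors. Since the kernel has nonnegative imaginary part, the summand over \<open>B\<close> has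
  imaginary part between 0 and Im h, so its exponential is again a Nevanlinna function when Im h is
  at most pi.\<close>

lemma nev_rep_density_indicator:
  assumes rep: "nev_rep h 0 \<beta> \<mu>" and B: "B \<in> sets borel"
  shows "nev_rep (\<lambda>z. complex_of_real \<beta> + (\<integral>t. indicator B t *\<^sub>R nev_kernel z t \<partial>\<mu>)) 0 \<beta> (density \<mu> (indicator B))"
    and "\<And>A. A \<in> sets borel \<Longrightarrow> emeasure (density \<mu> (indicator B)) A = emeasure \<mu> (B \<inter> A)"
    and "\<And>z. z \<in> upper_half \<Longrightarrow> Im (\<integral>t. indicator B t *\<^sub>R nev_kernel z t \<partial>\<mu>) \<le> Im (h z)"
    and "\<And>z. z \<in> upper_half \<Longrightarrow> h z = complex_of_real \<beta> + (\<integral>t. indicator B t *\<^sub>R nev_kernel z t \<partial>\<mu>) + (\<integral>t. indicator (- B) t *\<^sub>R nev_kernel z t \<partial>\<mu>)"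
proof -
  note r = rep[unfolded nev_rep_iff]
  have sb: "sets \<mu> = sets borel" using r by simp
  have B': "B \<in> sets \<mu>" "- B \<in> sets \<mu>" using B sb by auto
  interpret finite_measure \<mu> using r by simp
  show em: "emeasure (density \<mu> (indicator B)) A = emeasure \<mu> (B \<inter> A)" if "A \<in> sets borel" for A
    using that sb B' by (subst emeasure_density) (auto simp: indicator_inter_arith[symmetric] intro!: nn_integral_indicator)
  have dens: "(\<integral>t. nev_kernel z t \<partial>density \<mu> (indicator B)) = (\<integral>t. indicator B t *\<^sub>R nev_kernel z t \<partial>\<mu>)" for z
  proof -
    have "density \<mu> (indicator B) = density \<mu> (\<lambda>t. ennreal (indicator B t))" by (simp add: ennreal_indicator)
    also have "(\<integral>t. nev_kernel z t \<partial>\<dots>) = (\<integral>t. indicator B t *\<^sub>R nev_kernel z t \<partial>\<mu>)"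
      by (rule integral_density) (use B' measurable_nev_kernel_sets[OF sb] in auto)
    finally show ?thesis .
  qed
  have fin: "finite_measure (density \<mu> (indicator B))"
    by (rule finite_measureI) (use em[of UNIV] sets_eq_imp_space_eq[OF sb] in \<open>simp add: emeasure_eq_measure\<close>)
  show "nev_rep (\<lambda>z. complex_of_real \<beta> + (\<integral>t. indicator B t *\<^sub>R nev_kernel z t \<partial>\<mu>)) 0 \<beta> (density \<mu> (indicator B))"
    unfolding nev_rep_iff dens using sb fin by simp
  fix z assume z: "z \<in> upper_half"
  have iz: "integrable \<mu> (nev_kernel z)" using r z by (intro integrable_nev_kernel) auto
  have i1: "integrable \<mu> (\<lambda>t. indicator B t *\<^sub>R nev_kernel z t)" and i2: "integrable \<mu> (\<lambda>t. indicator (- B) t *\<^sub>R nev_kernel z t)"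
    using B' iz by (auto intro!: integrable_mult_indicator)
  have "(\<integral>t. nev_kernel z t \<partial>\<mu>) = (\<integral>t. indicator B t *\<^sub>R nev_kernel z t + indicator (- B) t *\<^sub>R nev_kernel z t \<partial>\<mu>)"
    by (intro Bochner_Integration.integral_cong refl) (auto simp: indicator_def)
  also have "\<dots> = (\<integral>t. indicator B t *\<^sub>R nev_kernel z t \<partial>\<mu>) + (\<integral>t. indicator (- B) t *\<^sub>R nev_kernel z t \<partial>\<mu>)"
    by (rule Bochner_Integration.integral_add[OF i1 i2])
  finally show split: "h z = complex_of_real \<beta> + (\<integral>t. indicator B t *\<^sub>R nev_kernel z t \<partial>\<mu>) + (\<integral>t. indicator (- B) t *\<^sub>R nev_kernel z t \<partial>\<mu>)"
    using r z by simp
  have "0 \<le> Im (\<integral>t. indicator (- B) t *\<^sub>R nev_kernel z t \<partial>\<mu>)"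
    unfolding integral_Im[OF i2, symmetric] using Im_nev_kernel_nonneg[OF z]
    by (intro integral_nonneg_AE AE_I2) (auto simp: indicator_def)
  then show "Im (\<integral>t. indicator B t *\<^sub>R nev_kernel z t \<partial>\<mu>) \<le> Im (h z)" unfolding split by simp
qed

section \<open>The factorization\<close>

lemma null_density_poisson_weight:
  assumes "sets \<mu> = sets borel" "A \<in> sets borel"
  shows "emeasure (density \<mu> poisson_weight) A = 0 \<longleftrightarrow> emeasure \<mu> A = 0"
proof -
  have m: "poisson_weight \<in> borel_measurable \<mu>"
    unfolding measurable_cong_sets[OF assms(1) refl] by measurable
  have pw: "poisson_weight t \<noteq> 0" for t
    using one_plus_square_pos[of t] by (simp add: poisson_weight_def not_le)
  have "A \<in> null_sets (density \<mu> poisson_weight) \<longleftrightarrow> A \<in> null_sets \<mu>"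
    unfolding null_sets_density_iff[OF m] using pw AE_iff_null_sets[of A \<mu>] assms by auto
  then show ?thesis using assms by (simp add: null_sets_def)
qed

text \<open>Both h and \<open>\<i> * pi - h\<close> being represented encodes that Im h lies between
  0 and pi. The linear coefficients are fixed at 0, the only value compatible with bounded imaginary
  parts (\<open>nev_rep_bounded_Im\<close>).\<close>

locale log_pair =
  fixes h :: "complex \<Rightarrow> complex" and \<beta> \<beta>' :: real and \<mu> \<mu>' :: "real measure"
  assumes rep: "nev_rep h 0 \<beta> \<mu>" and rep': "nev_rep (\<lambda>z. \<i> * pi - h z) 0 \<beta>' \<mu>'"
begin

lemma sets_eq: "sets \<mu> = sets borel" "sets \<mu>' = sets borel"
  using rep rep' by (auto simp: nev_rep_def)

lemma nevanlinna_h: "nevanlinna h" and nevanlinna_h': "nevanlinna (\<lambda>z. \<i> * pi - h z)"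
  using rep rep' nev_rep_imp_nevanlinna by blast+

lemma Im_h: "z \<in> upper_half \<Longrightarrow> 0 \<le> Im (h z) \<and> Im (h z) \<le> pi"
  using nevanlinna_h nevanlinna_h' by (auto simp: nevanlinna_def)

lemma nevanlinna_exp_h: "nevanlinna (\<lambda>z. exp (h z))"
  using nevanlinna_exp[OF nevanlinna_h] Im_h by blast

lemma sum_eq_lborel:
  "A \<in> sets borel \<Longrightarrow> emeasure (density \<mu> poisson_weight) A + emeasure (density \<mu>' poisson_weight) A = emeasure lborel A"
  by (rule complementary_measures[OF rep rep']) simp_all

text \<open>Absolute continuity, since each weighted measure is a summand of Lebesgue
  measure.\<close>

lemma null_of_lborel_null:
  assumes "A \<in> sets borel" "emeasure lborel A = 0"
  shows "emeasure \<mu> A = 0" "emeasure \<mu>' A = 0"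
  using sum_eq_lborel[OF assms(1)] assms null_density_poisson_weight[OF sets_eq(1)] null_density_poisson_weight[OF sets_eq(2)]
  by (auto simp: add_eq_0_iff_both_eq_0)

lemma null_near_negative:
  assumes "tame (\<lambda>z. exp (h z)) (Fin x)" "nev_val (\<lambda>z. exp (h z)) (Fin x) < 0"
  shows "\<exists>e>0. emeasure \<mu>' {x - e<..<x + e} = 0"
  using tame_log_neg[OF Im_h nevanlinna_exp_h assms(1) tame_limit[OF nevanlinna_exp_h assms(1)] assms(2)] tame_Fin_imp_null[OF rep'] by blast

lemma open_finite_part_Gamma: "open (finite_part (nev_Gamma (\<lambda>z. exp (h z))))"
  by (intro open_finite_part rinf_open_nev_Gamma nevanlinna_exp_h)

lemma null_Gamma: "emeasure \<mu>' (finite_part (nev_Gamma (\<lambda>z. exp (h z)))) = 0"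
proof (rule null_of_locally_null[OF sets_eq(2)])
  fix t assume "t \<in> finite_part (nev_Gamma (\<lambda>z. exp (h z)))"
  then show "\<exists>e>0. emeasure \<mu>' {t - e<..<t + e} = 0"
    using null_near_negative[of t] by (simp add: nev_Gamma_eq[OF nevanlinna_exp_h])
qed (use open_finite_part_Gamma in simp)

text \<open>A zero of \<open>exp \<circ> h\<close> on the line is isolated because the boundary function is strictly increasing,
  so zeros contribute nothing to \<open>\<mu>\<close>.\<close>
lemma null_off_Gamma:
  assumes t: "tame (\<lambda>z. exp (h z)) (Fin x)"
  shows "\<exists>e>0. emeasure \<mu> ({x - e<..<x + e} - finite_part (nev_Gamma (\<lambda>z. exp (h z)))) = 0"
proof -
  let ?f = "\<lambda>z. exp (h z)"
  obtain e where e: "0 < e" and te: "\<And>y. x - e < y \<Longrightarrow> y < x + e \<Longrightarrow> tame ?f (Fin y)"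
    using tame_Fin_nbhd[OF t] by blast
  \<comment> \<open>Near x a point outside \<Gamma> has boundary value 0 and lies in
    \<open>Z\<close>, or a positive one and then h is regular there, so that it lies in
    \<open>P\<close>. Both sets are null for \<mu>.\<close>
  define P where "P = finite_part {y. tame h y}"
  define Z where "Z = {y. x - e < y \<and> y < x + e \<and> nev_val ?f (Fin y) = 0}"
  have P: "open P" unfolding P_def by (intro open_finite_part rinf_open_tame)
  have nP: "emeasure \<mu> P = 0"
    by (rule null_of_locally_null[OF sets_eq(1)]) (use P tame_Fin_imp_null[OF rep] in \<open>auto simp: P_def\<close>)
  have "\<exists>u. Z \<subseteq> {u}"
  proof (rule ccontr)
    assume "\<nexists>u. Z \<subseteq> {u}"
    then obtain u v where "u \<in> Z" "v \<in> Z" "u \<noteq> v" by blast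
    then obtain u v where uv: "u \<in> Z" "v \<in> Z" "u < v" by (metis linorder_neqE_linordered_idom)
    have "\<i> \<in> upper_half" by (simp add: upper_half_def)
    then have "?f \<i> = 0"
      using uv te by (intro zero_between_unique[OF nevanlinna_exp_h, of "x - e" "x + e" u v]) (auto simp: Z_def)
    then show False by simp
  qed
  then obtain u where u: "Z \<subseteq> {u}" by blast
  then have "Z \<in> sets borel" using subset_singletonD by fastforce
  moreover have "emeasure lborel Z = 0"
    using u by (metis emeasure_empty emeasure_lborel_singleton subset_singletonD)
  ultimately have nZ: "emeasure \<mu> Z = 0" by (rule null_of_lborel_null(1))
  have "P \<in> null_sets \<mu>" "Z \<in> null_sets \<mu>"
    using P nP nZ \<open>Z \<in> sets borel\<close> sets_eq(1) by (auto simp: null_sets_def)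
  then have "P \<union> Z \<in> null_sets \<mu>" by (rule null_sets.Un)
  moreover have "{x - e<..<x + e} - finite_part (nev_Gamma ?f) \<subseteq> P \<union> Z"
  proof
    fix y assume y: "y \<in> {x - e<..<x + e} - finite_part (nev_Gamma ?f)"
    then have ty: "tame ?f (Fin y)" using te by auto
    then have "0 \<le> nev_val ?f (Fin y)" using y by (auto simp: nev_Gamma_eq[OF nevanlinna_exp_h] not_less)
    then consider "nev_val ?f (Fin y) = 0" | "0 < nev_val ?f (Fin y)" by linarith
    then show "y \<in> P \<union> Z"
    proof cases
      case 1
      then show ?thesis using y by (simp add: Z_def)
    next
      case 2
      then show ?thesis using tame_log_pos[OF Im_h ty tame_limit[OF nevanlinna_exp_h ty]] by (simp add: P_def)
    qed
  qed
  moreover have "{x - e<..<x + e} - finite_part (nev_Gamma ?f) \<in> sets \<mu>"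
    using open_finite_part_Gamma sets_eq(1) by auto
  ultimately have "{x - e<..<x + e} - finite_part (nev_Gamma ?f) \<in> null_sets \<mu>" using null_sets_subset by blast
  then show ?thesis using e by (intro exI[of _ e]) (auto simp: null_sets_def)
qed

text \<open>Where \<mu>' vanishes, the weighted \<mu> must be all of Lebesgue measure; dividing the
  weight out again with \<open>iw\<close> leaves dt / (1 + t^2).\<close>

lemma integral_full_part:
  assumes B: "B \<in> sets borel" and null: "emeasure \<mu>' B = 0"
  shows "(\<integral>t. indicator B t *\<^sub>R nev_kernel z t \<partial>\<mu>) = (LINT t:B|lborel. arg_density z t)"
proof -
  define iw where "iw t = ennreal (1 / (1 + t\<^sup>2))" for t :: real
  have iw: "iw \<in> borel_measurable borel" unfolding iw_def by measurable
  have B\<mu>: "B \<in> sets \<mu>" using B sets_eq by simp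
  have mw: "poisson_weight \<in> borel_measurable \<mu>" "iw \<in> borel_measurable \<mu>"
    unfolding measurable_cong_sets[OF sets_eq(1) refl] using iw by measurable
  have "density (density \<mu> poisson_weight) (indicator B) = density lborel (indicator B)"
  proof (rule measure_eqI)
    fix A assume "A \<in> sets (density (density \<mu> poisson_weight) (indicator B))"
    then have A: "A \<in> sets borel" using sets_eq by simp
    have "emeasure (density \<mu>' poisson_weight) (B \<inter> A) \<le> emeasure (density \<mu>' poisson_weight) B"
      using B A sets_eq by (intro emeasure_mono) auto
    also have "\<dots> = 0" using null_density_poisson_weight[OF sets_eq(2) B] null by simp
    finally have "emeasure (density \<mu> poisson_weight) (B \<inter> A) = emeasure lborel (B \<inter> A)"
      using sum_eq_lborel[of "B \<inter> A"] A B by simp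
    then show "emeasure (density (density \<mu> poisson_weight) (indicator B)) A = emeasure (density lborel (indicator B)) A"
      using A B B\<mu> sets_eq by (simp add: emeasure_restricted)
  qed (use sets_eq in simp)
  then have "density (density (density \<mu> poisson_weight) (indicator B)) iw = density (density lborel (indicator B)) iw" by simp
  then have "density \<mu> (\<lambda>t. poisson_weight t * (indicator B t * iw t)) = density lborel (\<lambda>t. indicator B t * iw t)"
    using mw B\<mu> B iw by (simp add: density_density_eq mult.assoc)
  moreover have "poisson_weight t * (indicator B t * iw t) = ennreal (indicator B t)" for t
  proof -
    have "ennreal (1 + t\<^sup>2) * ennreal (1 / (1 + t\<^sup>2)) = 1"
      using one_plus_square_pos[of t] by (simp add: ennreal_mult[symmetric] del: ennreal_plus)
    then show ?thesis by (auto simp: poisson_weight_def iw_def indicator_def)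
  qed
  moreover have "indicator B t * iw t = ennreal (indicator B t / (1 + t\<^sup>2))" for t
    by (auto simp: iw_def indicator_def)
  ultimately have eq: "density \<mu> (\<lambda>t. ennreal (indicator B t)) = density lborel (\<lambda>t. ennreal (indicator B t / (1 + t\<^sup>2)))" by simp
  have "(\<integral>t. indicator B t *\<^sub>R nev_kernel z t \<partial>\<mu>) = (\<integral>t. nev_kernel z t \<partial>density \<mu> (\<lambda>t. ennreal (indicator B t)))"
    by (rule integral_density[symmetric]) (use B\<mu> measurable_nev_kernel_sets[OF sets_eq(1)] in auto)
  also have "\<dots> = (\<integral>t. (indicator B t / (1 + t\<^sup>2)) *\<^sub>R nev_kernel z t \<partial>lborel)"
    unfolding eq using B one_plus_square_pos by (intro integral_density) (auto intro: less_imp_le)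
  also have "\<dots> = (LINT t:B|lborel. arg_density z t)"
    unfolding set_lebesgue_integral_def arg_density_def
    by (intro Bochner_Integration.integral_cong refl) (simp add: scaleR_conv_of_real)
  finally show ?thesis .
qed

text \<open>If \<mu>' = 0, then \<open>\<i> * pi - h\<close> is a real constant and exp h a negative
  one. This disposes of the arcs on which \<open>p_int\<close> is \<open>undefined\<close>.\<close>

lemma Gamma_UNIV_if_full:
  assumes "emeasure \<mu>' UNIV = 0"
  shows "nev_Gamma (\<lambda>z. exp (h z)) = UNIV"
proof -
  have hc: "\<i> * pi - h z = complex_of_real \<beta>'" if z: "z \<in> upper_half" for z
  proof -
    have "AE t in \<mu>'. False" using assms sets_eq_imp_space_eq[OF sets_eq(2)] sets_eq(2) by (intro AE_I[of _ _ UNIV]) auto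
    then have "(\<integral>t. nev_kernel z t \<partial>\<mu>') = (\<integral>t. 0 \<partial>\<mu>')"
      by (intro integral_cong_AE) (auto elim: eventually_mono simp: measurable_nev_kernel_sets[OF sets_eq(2)])
    then show ?thesis using rep' z by (simp add: nev_rep_iff)
  qed
  have ec: "exp (h z) = complex_of_real (- exp (- \<beta>'))" if "z \<in> upper_half" for z
  proof -
    have "h z = \<i> * pi - complex_of_real \<beta>'" using hc[OF that] by (simp add: algebra_simps)
    then have "exp (h z) = - exp (- complex_of_real \<beta>')"
      by (simp add: exp_diff exp_minus inverse_eq_divide)
    then show ?thesis by (simp flip: exp_of_real)
  qed
  have t: "tame (\<lambda>z. exp (h z)) x" for x
  proof -
    have "tame (\<lambda>z. complex_of_real (- exp (- \<beta>'))) x"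
      by (rule tameI[where A = "exp (- \<beta>')" and B = 0]) auto
    then show ?thesis using tame_cong[of "\<lambda>z. exp (h z)" "\<lambda>z. complex_of_real (- exp (- \<beta>'))"] ec by blast
  qed
  have "nev_val (\<lambda>z. exp (h z)) x = - exp (- \<beta>')" for x
  proof (rule nev_val_eqI, rule Lim_transform_eventually[OF tendsto_const])
    show "\<forall>\<^sub>F z in approach x. complex_of_real (- exp (- \<beta>')) = exp (h z)"
      by (rule eventually_mono[OF eventually_approach_upper_half]) (simp only: ec)
  qed
  then show ?thesis using t by (simp add: nev_Gamma_eq[OF nevanlinna_exp_h])
qed

lemma krein_prod_Gamma:
  assumes z: "z \<in> upper_half"
  shows "krein_prod (nev_Gamma (\<lambda>z. exp (h z))) z =
    exp (\<integral>t. indicator (finite_part (nev_Gamma (\<lambda>z. exp (h z)))) t *\<^sub>R nev_kernel z t \<partial>\<mu>)"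
proof -
  let ?\<Gamma> = "nev_Gamma (\<lambda>z. exp (h z))"
  have op: "rinf_open ?\<Gamma>" by (rule rinf_open_nev_Gamma[OF nevanlinna_exp_h])
  \<comment> \<open>If the complement of C is null, then \<mu>' vanishes on it by absolute
    continuity and on C because C is part of \<Gamma>. Hence \<mu>' = 0, \<Gamma> is the whole
    circle and C its only component.\<close>
  have nn: "C = UNIV \<or> \<not> rinf_null (- C)" if C: "C \<in> rinf_components ?\<Gamma>" for C
  proof (rule disjCI)
    assume "\<not> \<not> rinf_null (- C)"
    then have null: "rinf_null (- C)" by simp
    note CP = rinf_components_props[OF op C]
    have bC: "- finite_part C \<in> sets borel" using open_finite_part[OF CP(4)] by simp
    have "{x. Fin x \<in> - C} = - finite_part C" by (auto simp: finite_part_def)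
    then have "- finite_part C \<in> null_sets lebesgue" using null by (simp add: rinf_null_def)
    then have "emeasure lborel (- finite_part C) = 0" using bC by (simp add: null_sets_def)
    then have n1: "- finite_part C \<in> null_sets \<mu>'" using null_of_lborel_null(2)[OF bC] bC sets_eq by (simp add: null_sets_def)
    have n2: "finite_part ?\<Gamma> \<in> null_sets \<mu>'" using null_Gamma open_finite_part_Gamma sets_eq by (simp add: null_sets_def)
    have "UNIV = - finite_part C \<union> finite_part ?\<Gamma>" using CP(2) by (auto simp: finite_part_def)
    then have "UNIV \<in> null_sets \<mu>'" using null_sets.Un[OF n1 n2] by simp
    then have "?\<Gamma> = UNIV" by (intro Gamma_UNIV_if_full) (simp add: null_sets_def)
    then show "C = UNIV" using C rinf_components_UNIV by simp
  qed
  have "krein_prod ?\<Gamma> z = arc_exp (finite_part ?\<Gamma>) z" by (rule krein_prod_eq_arc_exp[OF op z nn])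
  then show ?thesis
    unfolding arc_exp_def using integral_full_part[OF _ null_Gamma, of z] open_finite_part_Gamma by simp
qed

end

lemma log_pair_exists:
  assumes "nevanlinna h" "\<And>z. z \<in> upper_half \<Longrightarrow> Im (h z) \<le> pi"
  shows "\<exists>\<beta> \<beta>' \<mu> \<mu>'. log_pair h \<beta> \<beta>' \<mu> \<mu>'"
proof -
  obtain \<alpha> \<beta> \<mu> where r: "nev_rep h \<alpha> \<beta> \<mu>" using nev_rep_exists[OF assms(1)] by blast
  have "nevanlinna (\<lambda>z. \<i> * pi - h z)"
    using assms unfolding nevanlinna_def by (auto intro!: holomorphic_intros)
  then obtain \<alpha>' \<beta>' \<mu>' where r': "nev_rep (\<lambda>z. \<i> * pi - h z) \<alpha>' \<beta>' \<mu>'" using nev_rep_exists by blast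
  have "\<alpha> = 0" by (rule nev_rep_bounded_Im[OF r assms(2)])
  moreover have "\<alpha>' = 0" by (rule nev_rep_bounded_Im[OF r', of pi]) (use assms(1) in \<open>auto simp: nevanlinna_def\<close>)
  ultimately show ?thesis using r r' unfolding log_pair_def by blast
qed

text \<open>The principal logarithm works: a function with a real value is constant, and otherwise
  its values lie strictly in the upper half-plane, off the cut.\<close>

lemma nevanlinna_log:
  assumes f: "nevanlinna f" and ne: "\<exists>z\<in>upper_half. f z \<noteq> 0"
  shows "\<exists>h. nevanlinna h \<and> (\<forall>z\<in>upper_half. Im (h z) \<le> pi \<and> f z = exp (h z))"
proof -
  have nz: "f z \<noteq> 0" if "z \<in> upper_half" for z
  proof
    assume "f z = 0"
    then have "\<And>w. w \<in> upper_half \<Longrightarrow> f w = 0" using nevanlinna_constant[OF f that] by simp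
    then show False using ne by blast
  qed
  have hol: "(\<lambda>z. Ln (f z)) holomorphic_on upper_half"
  proof (cases "\<exists>z0\<in>upper_half. Im (f z0) = 0")
    case True
    then obtain z0 where z0: "z0 \<in> upper_half" "Im (f z0) = 0" by blast
    show ?thesis
      by (rule holomorphic_transform[OF holomorphic_on_const[of "Ln (f z0)"]])
        (use nevanlinna_constant[OF f z0] in simp)
  next
    case False
    then have "f z \<notin> \<real>\<^sub>\<le>\<^sub>0" if "z \<in> upper_half" for z
      using that by (auto simp: complex_nonpos_Reals_iff)
    moreover have "f holomorphic_on upper_half" using f by (simp add: nevanlinna_def)
    ultimately show ?thesis by (intro holomorphic_on_Ln') auto
  qed
  have Im: "0 \<le> Im (Ln (f z)) \<and> Im (Ln (f z)) \<le> pi" if "z \<in> upper_half" for z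
    using Im_Ln_pos_le[OF nz[OF that]] f that by (simp add: nevanlinna_def)
  show ?thesis
    by (rule exI[of _ "\<lambda>z. Ln (f z)"]) (use hol Im nz in \<open>auto simp: nevanlinna_def\<close>)
qed

lemma nev_Gamma_cong:
  assumes f: "nevanlinna f" and g: "nevanlinna g" and eq: "\<And>z. z \<in> upper_half \<Longrightarrow> f z = g z"
  shows "nev_Gamma f = nev_Gamma g"
proof -
  have t: "tame f x \<longleftrightarrow> tame g x" for x by (rule tame_cong[OF eq])
  have "nev_val f x = nev_val g x" if "tame g x" for x
  proof (rule nev_val_eqI, rule Lim_transform_eventually[OF tame_limit[OF g that]])
    show "\<forall>\<^sub>F z in approach x. g z = f z"
      by (rule eventually_mono[OF eventually_approach_upper_half]) (use eq in simp)
  qed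
  then show ?thesis unfolding nev_Gamma_eq[OF f] nev_Gamma_eq[OF g] using t by auto
qed

text \<open>An open set exceeding the regular set by a Lebesgue null set is still null for the
  absolutely continuous \<nu>, so all its points are regular already.\<close>

lemma lebesgue_regular_tame:
  assumes rep: "nev_rep G 0 \<beta> \<nu>"
    and ac: "\<And>A. A \<in> sets borel \<Longrightarrow> emeasure lborel A = 0 \<Longrightarrow> emeasure \<nu> A = 0"
  shows "lebesgue_regular {x. tame G x}"
proof -
  let ?S = "{x. tame G x}"
  have sb: "sets \<nu> = sets borel" using rep by (simp add: nev_rep_def)
  have op: "rinf_open ?S" by (rule rinf_open_tame)
  have SR: "finite_part ?S \<in> null_sets \<nu>"
  proof -
    have "emeasure \<nu> (finite_part ?S) = 0"
      by (rule null_of_locally_null[OF sb]) (use open_finite_part[OF op] tame_Fin_imp_null[OF rep] in auto)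
    then show ?thesis using open_finite_part[OF op] sb by (simp add: null_sets_def)
  qed
  have sub: "U \<subseteq> ?S" if U: "rinf_open U" "?S \<subseteq> U" "rinf_null (U - ?S)" for U
  proof -
    have bU: "finite_part (U - ?S) \<in> sets borel" using open_finite_part[OF U(1)] open_finite_part[OF op] by simp
    have "finite_part (U - ?S) \<in> null_sets lebesgue" using U(3) by (simp only: rinf_null_def finite_part_def)
    then have "emeasure lborel (finite_part (U - ?S)) = 0" using bU by (simp add: null_sets_def)
    then have "finite_part (U - ?S) \<in> null_sets \<nu>" using ac[OF bU] bU sb by (simp add: null_sets_def)
    from null_sets.Un[OF this SR] have nU: "finite_part U \<in> null_sets \<nu>"
      using null_sets_subset[of "finite_part (U - ?S) \<union> finite_part ?S" \<nu> "finite_part U"] open_finite_part[OF U(1)] sb by (auto simp: finite_part_def)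
    have loc: "\<exists>e>0. emeasure \<nu> {a - e<..<a + e} = 0" if "Fin a \<in> U" for a
    proof -
      have "a \<in> finite_part U" using that by simp
      then obtain e where e: "0 < e" "ball a e \<subseteq> finite_part U" using openE[OF open_finite_part[OF U(1)]] by metis
      have "{a - e<..<a + e} = ball a e" by (auto simp: dist_real_def)
      then have "{a - e<..<a + e} \<in> null_sets \<nu>" using null_sets_subset[OF nU, of "{a - e<..<a + e}"] e(2) sb by auto
      then show ?thesis using e(1) by blast
    qed
    show "U \<subseteq> ?S"
    proof
      fix x assume x: "x \<in> U"
      show "x \<in> ?S"
      proof (cases x)
        case (Fin a)
        then show ?thesis using loc[of a] x nev_rep_tame_Fin(1)[OF rep] by auto
      next
        case Infty
        then obtain R where "\<And>t. R < \<bar>t\<bar> \<Longrightarrow> Fin t \<in> U" using U(1) x unfolding rinf_open_def by blast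
        then show ?thesis using nev_rep_tame_Infty_local(1)[OF rep, of R] loc Infty by simp
      qed
    qed
  qed
  have "rinf_null (?S - ?S)" by (simp add: rinf_null_def)
  then have "rinf_reg_hull ?S = ?S" unfolding rinf_reg_hull_def using sub op by blast
  then show ?thesis unfolding lebesgue_regular_def using op by simp
qed

theorem theorem4p2:
  fixes f :: "complex \<Rightarrow> complex"
  assumes "nevanlinna f"
    and "\<exists>z\<in>upper_half. f z \<noteq> 0"
  shows "\<exists>g. nevanlinna g \<and>
           (\<forall>z\<in>upper_half. f z = krein_prod (nev_Gamma f) z * g z) \<and>
           nev_sigma g \<subseteq> nev_sigma f \<and>
           (\<forall>x\<in>nev_Omega g. 0 < nev_val g x) \<and>
           lebesgue_regular (nev_Omega g) \<and>
           nev_Omega f = nev_Omega (krein_prod (nev_Gamma f)) \<inter> nev_Omega g"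
proof -
  note f = assms(1)
  obtain h where h: "nevanlinna h" and hle: "\<And>z. z \<in> upper_half \<Longrightarrow> Im (h z) \<le> pi" and fh: "\<And>z. z \<in> upper_half \<Longrightarrow> f z = exp (h z)"
    using nevanlinna_log[OF assms] by blast
  obtain \<beta> \<beta>' \<mu> \<mu>' where "log_pair h \<beta> \<beta>' \<mu> \<mu>'" using log_pair_exists[OF h hle] by blast
  then interpret F: log_pair h \<beta> \<beta>' \<mu> \<mu>' .
  define \<Gamma> where "\<Gamma> = nev_Gamma f"
  have \<Gamma>h: "nev_Gamma (\<lambda>z. exp (h z)) = \<Gamma>"
    unfolding \<Gamma>_def by (rule nev_Gamma_cong[OF F.nevanlinna_exp_h f]) (simp add: fh)
  have tame_f: "tame f x \<longleftrightarrow> tame (\<lambda>z. exp (h z)) x" for x by (rule tame_cong[OF fh])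
  define B where "B = finite_part \<Gamma>"
  have B: "B \<in> sets borel" "- B \<in> sets borel" using F.open_finite_part_Gamma by (simp_all add: B_def \<Gamma>h)
  define \<kappa> where "\<kappa> z = (\<integral>t. indicator B t *\<^sub>R nev_kernel z t \<partial>\<mu>)" for z
  \<comment> \<open>The constant \<beta> goes to \<open>G\<close>: the kernel at z = i equals
    \<open>\<i>\<close>, so exp \<kappa> has modulus 1 there, as the normalisation of the arc
    factors prescribes.\<close>
  define G where "G z = complex_of_real \<beta> + (\<integral>t. indicator (- B) t *\<^sub>R nev_kernel z t \<partial>\<mu>)" for z
  define \<nu> where "\<nu> = density \<mu> (indicator (- B))"
  define g where "g z = exp (G z)" for z
  note R1 = nev_rep_density_indicator[OF F.rep B(1), folded \<kappa>_def]
  note R2 = nev_rep_density_indicator[OF F.rep B(2), folded G_def \<nu>_def]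
  have em\<nu>: "emeasure \<nu> A = emeasure \<mu> (A - B)" if "A \<in> sets borel" for A
    using R2(2)[OF that] by (simp add: Diff_eq Int_commute)
  have sb\<nu>: "sets \<nu> = sets borel" using R2(1) by (simp add: nev_rep_def)
  have acn: "emeasure \<nu> A = 0" if "A \<in> sets borel" "emeasure lborel A = 0" for A
  proof -
    have "emeasure \<mu> (A - B) \<le> emeasure \<mu> A" using that(1) F.sets_eq by (intro emeasure_mono) auto
    then show ?thesis using F.null_of_lborel_null(1)[OF that] em\<nu>[OF that(1)] by simp
  qed
  have krein: "krein_prod \<Gamma> z = exp (\<kappa> z)" if "z \<in> upper_half" for z
    using F.krein_prod_Gamma[OF that] by (simp add: \<Gamma>h \<kappa>_def B_def)
  have fkg: "f z = krein_prod \<Gamma> z * g z" if z: "z \<in> upper_half" for z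
  proof -
    have "h z = \<kappa> z + G z"
      using R1(4)[OF z] by (simp add: G_def \<kappa>_def)
    then show ?thesis unfolding fh[OF z] krein[OF z] g_def by (simp add: exp_add)
  qed
  have nG: "nevanlinna G" by (rule nev_rep_imp_nevanlinna[OF R2(1)])
  have Gle: "Im (G z) \<le> pi" if "z \<in> upper_half" for z
    using R2(3)[OF that] hle[OF that] by (simp add: G_def)
  have ng: "nevanlinna g" unfolding g_def by (rule nevanlinna_exp[OF nG Gle])
  have n\<kappa>: "nevanlinna \<kappa>"
  proof -
    have "nevanlinna (\<lambda>z. complex_of_real \<beta> + \<kappa> z)" by (rule nev_rep_imp_nevanlinna[OF R1(1)])
    then have hol: "(\<lambda>z. complex_of_real \<beta> + \<kappa> z) holomorphic_on upper_half" and "\<forall>z\<in>upper_half. 0 \<le> Im (\<kappa> z)"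
      unfolding nevanlinna_def by auto
    moreover note holomorphic_on_diff[OF hol holomorphic_on_const[of "complex_of_real \<beta>"]]
    moreover have "(\<lambda>z. (complex_of_real \<beta> + \<kappa> z) - complex_of_real \<beta>) = \<kappa>" by auto
    ultimately show ?thesis unfolding nevanlinna_def by (simp only:)
  qed
  have "Im (\<kappa> z) \<le> pi" if "z \<in> upper_half" for z
    using R1(3)[OF that] hle[OF that] by simp
  then have "nevanlinna (\<lambda>z. exp (\<kappa> z))" by (rule nevanlinna_exp[OF n\<kappa>])
  then have nk: "nevanlinna (krein_prod \<Gamma>)"
    unfolding nevanlinna_def using krein by (auto intro: holomorphic_transform)
  \<comment> \<open>From this pair only \<gamma>' and \<nu>' are kept; the first representation is
    replaced by the explicit one with \<nu>.\<close>
  obtain \<gamma> \<gamma>' \<nu>0 \<nu>' where "log_pair G \<gamma> \<gamma>' \<nu>0 \<nu>'" using log_pair_exists[OF nG Gle] by blast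
  then have "log_pair G \<beta> \<gamma>' \<nu> \<nu>'" using R2(1) unfolding log_pair_def by blast
  then interpret G: log_pair G \<beta> \<gamma>' \<nu> \<nu>' .
  \<comment> \<open>\<nu> is \<mu> off \<Gamma>, which vanishes near every regular point of f by
    \<open>null_off_Gamma\<close>; infinity follows from the large real points.\<close>
  have tame_G_of_f: "tame G x" if t: "tame f x" for x
  proof -
    have loc: "\<exists>e>0. emeasure \<nu> {a - e<..<a + e} = 0" if ta: "tame f (Fin a)" for a
    proof -
      obtain e where e: "0 < e" "emeasure \<mu> ({a - e<..<a + e} - B) = 0"
        using F.null_off_Gamma[of a] ta unfolding tame_f \<Gamma>h B_def by blast
      then show ?thesis using em\<nu>[of "{a - e<..<a + e}"] by auto
    qed
    show ?thesis
    proof (cases x)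
      case (Fin a)
      then show ?thesis using loc[of a] t nev_rep_tame_Fin(1)[OF R2(1)] by auto
    next
      case Infty
      then show ?thesis using tame_Infty_nbhd[of f] t nev_rep_tame_Infty_local(1)[OF R2(1)] loc by blast
    qed
  qed
  \<comment> \<open>Where \<open>g\<close> is negative, \<open>\<nu>\<close> has full density, hence so has \<open>\<mu>\<close>, and \<open>f\<close> is negative there; but \<open>\<nu>\<close>
    vanishes on \<open>\<Gamma>\<close>.\<close>
  have Gamma_g: "Fin x \<notin> nev_Gamma g" for x
  proof
    assume x: "Fin x \<in> nev_Gamma g"
    then have "tame (\<lambda>z. exp (G z)) (Fin x)" "nev_val (\<lambda>z. exp (G z)) (Fin x) < 0"
      using x[unfolded nev_Gamma_eq[OF ng]] unfolding g_def[abs_def] by auto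
    then obtain e where e: "0 < e" and n': "emeasure \<nu>' {x - e<..<x + e} = 0" using G.null_near_negative by blast
    let ?I = "{x - e<..<x + e}"
    have w\<nu>: "emeasure (density \<nu> poisson_weight) ?I = emeasure lborel ?I"
      using G.sum_eq_lborel[of ?I] n' null_density_poisson_weight[OF G.sets_eq(2), of ?I] by simp
    have le: "emeasure (density \<nu> poisson_weight) ?I \<le> emeasure (density \<mu> poisson_weight) ?I"
    proof -
      have m: "poisson_weight \<in> borel_measurable \<mu>"
        unfolding measurable_cong_sets[OF F.sets_eq(1) refl] by measurable
      have "density \<nu> poisson_weight = density (density \<mu> poisson_weight) (indicator (- B))"
        unfolding \<nu>_def using m B F.sets_eq by (simp add: density_density_eq mult.commute)
      then have "emeasure (density \<nu> poisson_weight) ?I = emeasure (density \<mu> poisson_weight) (- B \<inter> ?I)"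
        using B F.sets_eq by (simp add: emeasure_restricted)
      also have "\<dots> \<le> emeasure (density \<mu> poisson_weight) ?I" using F.sets_eq by (intro emeasure_mono) auto
      finally show ?thesis .
    qed
    have lb: "emeasure lborel ?I = ennreal (2 * e)" using e by simp
    have "emeasure (density \<mu>' poisson_weight) ?I = 0"
    proof -
      have "ennreal (2 * e) + emeasure (density \<mu>' poisson_weight) ?I \<le> emeasure (density \<mu> poisson_weight) ?I + emeasure (density \<mu>' poisson_weight) ?I"
        using le w\<nu> lb by (intro add_right_mono) simp
      also have "\<dots> = ennreal (2 * e) + 0" using F.sum_eq_lborel[of ?I] lb by simp
      finally have "emeasure (density \<mu>' poisson_weight) ?I \<le> 0"
        unfolding ennreal_add_left_cancel_le by auto
      then show ?thesis by simp
    qed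
    then have n\<mu>': "emeasure \<mu>' ?I = 0" using null_density_poisson_weight[OF F.sets_eq(2), of ?I] by simp
    \<comment> \<open>Where \<mu>' vanishes, \<open>\<i> * pi - h\<close> has real boundary values
      v, so exp h continues with the negative values -1 / exp v.\<close>
    have "?I \<subseteq> B"
    proof
      fix y assume y: "y \<in> ?I"
      define d where "d = min (y - (x - e)) (x + e - y)"
      have d: "0 < d" using y by (simp add: d_def)
      have "emeasure \<mu>' {y - d<..<y + d} \<le> emeasure \<mu>' ?I"
        using F.sets_eq by (intro emeasure_mono) (auto simp: d_def)
      then have nd: "emeasure \<mu>' {y - d<..<y + d} = 0" using n\<mu>' by simp
      note T = nev_rep_tame_Fin[OF F.rep' d nd]
      define v where "v = boundary_val 0 \<beta>' \<mu>' y"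
      have eq: "exp (h z) = (- 1) / exp (\<i> * pi - h z)" for z by (simp add: exp_diff)
      have lim: "((\<lambda>z. exp (\<i> * pi - h z)) \<longlongrightarrow> complex_of_real (exp v)) (approach (Fin y))"
        using tendsto_exp[OF T(2)] by (simp only: v_def exp_of_real)
      have "tame (\<lambda>z. exp (h z)) (Fin y)"
        unfolding eq
      proof (rule tame_divide[OF _ _ _ _ lim])
        show "nevanlinna (\<lambda>_. - 1)" by (simp add: nevanlinna_def)
        show "nevanlinna (\<lambda>z. exp (\<i> * pi - h z))"
          by (rule nevanlinna_exp[OF F.nevanlinna_h']) (use F.Im_h in auto)
        show "tame (\<lambda>_. - 1) (Fin y)" by (rule tameI[where A = 1 and B = 0]) auto
        show "tame (\<lambda>z. exp (\<i> * pi - h z)) (Fin y)" by (rule tame_exp[OF F.nevanlinna_h' T(1)])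
      qed simp
      moreover have "nev_val (\<lambda>z. exp (h z)) (Fin y) = - 1 / exp v"
      proof (rule nev_val_eqI)
        have "((\<lambda>z. (- 1) / exp (\<i> * pi - h z)) \<longlongrightarrow> (- 1) / complex_of_real (exp v)) (approach (Fin y))"
          by (intro tendsto_divide tendsto_const lim) simp
        then show "((\<lambda>z. exp (h z)) \<longlongrightarrow> complex_of_real (- 1 / exp v)) (approach (Fin y))"
          unfolding eq[symmetric] by simp
      qed
      ultimately have "Fin y \<in> nev_Gamma (\<lambda>z. exp (h z))"
        by (simp add: nev_Gamma_eq[OF F.nevanlinna_exp_h])
      then show "y \<in> B" by (simp add: \<Gamma>h B_def)
    qed
    then have IB: "?I - B = {}" by blast
    have "?I \<in> sets borel" by simp
    from em\<nu>[OF this, unfolded IB] have "emeasure \<nu> ?I = 0" by simp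
    then have "emeasure (density \<nu> poisson_weight) ?I = 0" using null_density_poisson_weight[OF sb\<nu>, of ?I] by simp
    then show False using w\<nu> lb e by simp
  qed
  \<comment> \<open>\<Gamma>(g) has no real points, so \<open>null_off_Gamma\<close> applied to
    \<open>G\<close> says that \<nu> itself vanishes near each regular real point of g.\<close>
  have tame_G_of_g: "tame G x" if t: "tame g x" for x
  proof -
    have loc: "\<exists>e>0. emeasure \<nu> {a - e<..<a + e} = 0" if "tame g (Fin a)" for a
    proof -
      have "finite_part (nev_Gamma (\<lambda>z. exp (G z))) = {}" using Gamma_g by (auto simp: g_def[abs_def] finite_part_def)
      then show ?thesis using G.null_off_Gamma[of a] that by (simp add: g_def[abs_def])
    qed
    show ?thesis
    proof (cases x)
      case (Fin a)
      then show ?thesis using loc[of a] t nev_rep_tame_Fin(1)[OF R2(1)] by auto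
    next
      case Infty
      then show ?thesis using tame_Infty_nbhd[of g] t nev_rep_tame_Infty_local(1)[OF R2(1)] loc by blast
    qed
  qed
  have tame_g_of_G: "tame g x" if "tame G x" for x
    unfolding g_def[abs_def] by (rule tame_exp[OF nG that])
  have val_g: "(g \<longlongrightarrow> complex_of_real (exp (nev_val G x))) (approach x)" if "tame g x" for x
    using tendsto_exp[OF tame_limit[OF nG tame_G_of_g[OF that]]] by (simp only: g_def[abs_def] exp_of_real)
  have \<Omega>g: "nev_Omega g = {x. tame G x}"
    unfolding nev_Omega_eq[OF ng] using tame_G_of_g tame_g_of_G by blast
  have fg: "nev_Omega f \<subseteq> nev_Omega g"
    unfolding \<Omega>g nev_Omega_eq[OF f] using tame_G_of_f by blast
  show ?thesis
  proof (intro exI[of _ g] conjI ballI)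
    show "nevanlinna g" by (rule ng)
    show "f z = krein_prod (nev_Gamma f) z * g z" if "z \<in> upper_half" for z
      using fkg[OF that] by (simp add: \<Gamma>_def)
    show "nev_sigma g \<subseteq> nev_sigma f" using fg by (auto simp: nev_Omega_def)
    show "0 < nev_val g x" if "x \<in> nev_Omega g" for x
      using nev_val_eqI[OF val_g[of x]] that by (simp add: nev_Omega_eq[OF ng])
    show "lebesgue_regular (nev_Omega g)"
      unfolding \<Omega>g by (rule lebesgue_regular_tame[OF R2(1) acn])
    \<comment> \<open>From left to right the Krein product is the quotient f / g, where g has the
      nonzero limit found in \<open>val_g\<close>; from right to left f is the product.\<close>
    have "tame f x \<longleftrightarrow> tame (krein_prod \<Gamma>) x \<and> tame g x" for x
    proof
      assume t: "tame f x"
      have tg: "tame g x" by (rule tame_g_of_G[OF tame_G_of_f[OF t]])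
      have "tame (\<lambda>z. f z / g z) x"
        by (rule tame_divide[OF f ng t tg val_g[OF tg]]) simp
      moreover have "f z / g z = krein_prod \<Gamma> z" if "z \<in> upper_half" for z
        using fkg[OF that] by (simp add: g_def)
      ultimately have "tame (krein_prod \<Gamma>) x" using tame_cong[of "\<lambda>z. f z / g z" "krein_prod \<Gamma>"] by blast
      then show "tame (krein_prod \<Gamma>) x \<and> tame g x" using tg ..
    next
      assume "tame (krein_prod \<Gamma>) x \<and> tame g x"
      then have "tame (\<lambda>z. krein_prod \<Gamma> z * g z) x" by (intro tame_mult nk ng) auto
      then show "tame f x" using tame_cong[of f "\<lambda>z. krein_prod \<Gamma> z * g z"] fkg by blast
    qed
    then show "nev_Omega f = nev_Omega (krein_prod (nev_Gamma f)) \<inter> nev_Omega g"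
      unfolding nev_Omega_eq[OF f] nev_Omega_eq[OF ng] \<Gamma>_def[symmetric] nev_Omega_eq[OF nk] by blast
  qed
qed

end
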